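(* Let $V=(V_1,\ldots,V_k)$ be a $k$-tuple of doubly $\Lambda$-commuting row isometries acting on a Hilbert space $\mathcal K$. Then the following statements hold. (i) There is a $*$-representation $\pi:C^*(\{S_{i,s}\})\to B(\mathcal K)$ such that $\pi(S_{i,s})=V_{i,s}$ for any $i\in\{1,\ldots,k\}$ and $s\in\{1,\ldots,n_i\}$. Moreover, any $*$-representation of $C^*(\{S_{i,s}\})$ is determined by a $k$-tuple of doubly $\Lambda$-commuting row isometries. (ii) $C^*(\{S_{i,s}\})$ is the universal $C^*$-algebra generated by a $k$-tuple of doubly $\Lambda$-commuting row isometries. (iii) If $$\bigcap_{i\in\{1,\ldots,k\},\ s\in\{1,\ldots,n_i\}}\ker V_{i,s}^*\neq\{0\},$$ then the $C^*$-algebra $C^*(\{V_{i,s}\})$ is isomorphic to $C^*(\{S_{i,s}\})$.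
   Context: Fix integers $k\ge1$, $n_1,\ldots,n_k\ge 1$ and, for $i\ne j$ in $\{1,\ldots,k\}$, an $n_i\times n_j$ matrix $\Lambda_{i,j}=[\lambda_{i,j}(s,t)]$ with entries in $\mathbb T=\{z\in\mathbb C:|z|=1\}$, such that $\lambda_{j,i}(t,s)=\overline{\lambda_{i,j}(s,t)}$. A row isometry $V_i=[V_{i,1}\cdots V_{i,n_i}]$ on $\mathcal K$ consists of $V_{i,s}\in B(\mathcal K)$ with $V_{i,s}^*V_{i,t}=\delta_{st}I$. Row isometries $V_1,\ldots,V_k$ are doubly $\Lambda$-commuting if $V_{i,s}^*V_{j,t}=\overline{\lambda_{i,j}(s,t)}\,V_{j,t}V_{i,s}^*$ for all $i\neq j$ and all $s,t$. $C^*(\{V_{i,s}\})$ is the $C^*$-algebra generated by all the $V_{i,s}$. $\mathbb F_{n_i}^+$ is the unital free semigroup with generators $g_1^i,\ldots,g_{n_i}^i$ and neutral element $g_0^i$. The standard $k$-tuple $S=(S_1,\ldots,S_k)$, $S_i=[S_{i,1}\cdots S_{i,n_i}]$, which is a $k$-tuple of doubly $\Lambda$-commuting row isometries, acts on $\ell^2(\mathbb F_{n_1}^+\times\cdots\times\mathbb F_{n_k}^+)$ with standard basis $\chi_{(\alpha_1,\ldots,\alpha_k)}$ by $$S_{i,s}\chi_{(\alpha_1,\ldots,\alpha_k)}=\boldsymbol\lambda_{i,1}(s,\alpha_1)\cdots\boldsymbol\lambda_{i,i-1}(s,\alpha_{i-1})\chi_{(\alpha_1,\ldots,\alpha_{i-1},g_s^i\alpha_i,\alpha_{i+1},\ldots,\alpha_k)},$$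 where $\boldsymbol\lambda_{i,j}(s,g^j_{j_1}\cdots g^j_{j_q})=\prod_{b=1}^q\lambda_{i,j}(s,j_b)$, $\boldsymbol\lambda_{i,j}(s,g_0^j)=1$ (no factor if $i=1$). In (i), the tuple determining a $*$-representation $\pi$ is the one with entries $\pi(S_{i,s})$. "Universal" in (ii) means: for every $k$-tuple $V$ of doubly $\Lambda$-commuting row isometries on a Hilbert space there is a surjective $*$-homomorphism $C^*(\{S_{i,s}\})\to C^*(\{V_{i,s}\})$ with $S_{i,s}\mapsto V_{i,s}$. *)

theory Defs
  imports "HOL-Analysis.Analysis"
begin

section \<open>Complex Hilbert spaces\<close>

class scaleC =
  fixes scaleC :: "complex \<Rightarrow> 'a \<Rightarrow> 'a"  (infixr "*\<^sub>C" 75)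

text \<open>The complex inner product is linear in its first argument. Positive definiteness and the
  relation to the norm are inherited from \<^class>\<open>real_inner\<close> through the last axiom.\<close>

class complex_hilbert = real_inner + complete_space + scaleC +
  fixes cinner :: "'a \<Rightarrow> 'a \<Rightarrow> complex"
  assumes scaleC_add_right: "c *\<^sub>C (x + y) = c *\<^sub>C x + c *\<^sub>C y"
    and scaleC_add_left: "(c + d) *\<^sub>C x = c *\<^sub>C x + d *\<^sub>C x"
    and scaleC_scaleC: "c *\<^sub>C (d *\<^sub>C x) = (c * d) *\<^sub>C x"
    and scaleC_of_real: "complex_of_real r *\<^sub>C x = r *\<^sub>R x"
    and cinner_commute: "cinner y x = cnj (cinner x y)"
    and cinner_add_left: "cinner (x + y) z = cinner x z + cinner y z"
    and cinner_scaleC_left: "cinner (c *\<^sub>C x) y = c * cinner x y"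
    and inner_eq_Re_cinner: "inner x y = Re (cinner x y)"

lemma norm_scaleC: "norm (c *\<^sub>C x) = cmod c * norm (x :: 'a::complex_hilbert)"
proof -
  have r: "cinner x (d *\<^sub>C y) = cnj d * cinner x y" for d and x y :: 'a
    by (metis cinner_commute cinner_scaleC_left complex_cnj_mult)
  have "cinner (c *\<^sub>C x) (c *\<^sub>C x) = complex_of_real ((cmod c)\<^sup>2) * cinner x x"
    unfolding complex_norm_square cinner_scaleC_left r by (metis mult.assoc mult.commute)
  then have "inner (c *\<^sub>C x) (c *\<^sub>C x) = (cmod c)\<^sup>2 * inner x x"
    by (simp add: inner_eq_Re_cinner)
  then show ?thesis
    by (simp add: norm_eq_sqrt_inner real_sqrt_mult)
qed

lemma bounded_linear_scaleC: "bounded_linear (\<lambda>x :: 'a::complex_hilbert. c *\<^sub>C x)"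
proof (rule bounded_linear_intro)
  show "c *\<^sub>C (r *\<^sub>R x) = r *\<^sub>R (c *\<^sub>C x)" for r and x :: 'a
    by (simp add: scaleC_scaleC mult.commute flip: scaleC_of_real)
  show "norm (c *\<^sub>C x) \<le> norm x * cmod c" for x :: 'a
    by (simp add: norm_scaleC)
qed (rule scaleC_add_right)

instantiation blinfun :: (real_normed_vector, complex_hilbert) scaleC
begin

lift_definition scaleC_blinfun :: "complex \<Rightarrow> ('a \<Rightarrow>\<^sub>L 'b) \<Rightarrow> ('a \<Rightarrow>\<^sub>L 'b)"
  is "\<lambda>c T x. c *\<^sub>C T x"
  by (rule bounded_linear_compose[OF bounded_linear_scaleC])

instance ..

end


section \<open>Square summable families\<close>

typedef 'x ell2 = "{f :: 'x \<Rightarrow> complex. (\<lambda>x. (cmod (f x))\<^sup>2) summable_on UNIV}"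
  morphisms ell2_fun Abs_ell2
  by (rule exI[of _ "\<lambda>_. 0"]) simp

setup_lifting type_definition_ell2

lemma ell2_add_summable:
  assumes "(\<lambda>x. (cmod (f x))\<^sup>2) summable_on UNIV" "(\<lambda>x. (cmod (g x))\<^sup>2) summable_on UNIV"
  shows "(\<lambda>x. (cmod (f x + g x))\<^sup>2) summable_on UNIV"
proof -
  have "(\<lambda>x. 2 * (cmod (f x))\<^sup>2 + 2 * (cmod (g x))\<^sup>2) summable_on UNIV"
    using assms by (intro summable_on_add summable_on_cmult_right)
  moreover have "norm ((cmod (f x + g x))\<^sup>2) \<le> 2 * (cmod (f x))\<^sup>2 + 2 * (cmod (g x))\<^sup>2" for x
  proof -
    have "(cmod (f x + g x))\<^sup>2 \<le> (cmod (f x) + cmod (g x))\<^sup>2"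
      by (simp add: norm_triangle_ineq power_mono)
    also have "\<dots> \<le> 2 * (cmod (f x))\<^sup>2 + 2 * (cmod (g x))\<^sup>2"
      using sum_squares_bound[of "cmod (f x)" "cmod (g x)"] by (simp add: power2_sum)
    finally show ?thesis by simp
  qed
  ultimately have "(\<lambda>x. norm ((cmod (f x + g x))\<^sup>2)) summable_on UNIV"
    by (rule Infinite_Sum.abs_summable_on_comparison_test')
  then show ?thesis
    by simp
qed

lemma ell2_scale_summable:
  assumes "(\<lambda>x. (cmod (f x))\<^sup>2) summable_on UNIV"
  shows "(\<lambda>x. (cmod (c * f x))\<^sup>2) summable_on UNIV"
  using assms by (simp add: norm_mult power_mult_distrib summable_on_cmult_right)

lemma ell2_mult_summable:
  assumes "(\<lambda>x. (cmod (f x))\<^sup>2) summable_on UNIV" "(\<lambda>x. (cmod (g x))\<^sup>2) summable_on UNIV"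
  shows "(\<lambda>x. f x * cnj (g x)) summable_on UNIV"
proof -
  have "(\<lambda>x. (cmod (f x))\<^sup>2 + (cmod (g x))\<^sup>2) summable_on UNIV"
    using assms by (intro summable_on_add)
  moreover have "norm (f x * cnj (g x)) \<le> (cmod (f x))\<^sup>2 + (cmod (g x))\<^sup>2" for x
  proof -
    have "2 * (cmod (f x) * cmod (g x)) \<le> (cmod (f x))\<^sup>2 + (cmod (g x))\<^sup>2"
      using sum_squares_bound[of "cmod (f x)" "cmod (g x)"] by simp
    moreover have "0 \<le> cmod (f x) * cmod (g x)"
      by simp
    ultimately show ?thesis
      unfolding norm_mult complex_mod_cnj by linarith
  qed
  ultimately have "(\<lambda>x. norm (f x * cnj (g x))) summable_on UNIV"
    by (rule Infinite_Sum.abs_summable_on_comparison_test')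
  then show ?thesis
    by (rule abs_summable_summable)
qed

instantiation ell2 :: (type) "{real_inner, scaleC}"
begin

lift_definition zero_ell2 :: "'a ell2" is "\<lambda>_. 0" by simp

lift_definition plus_ell2 :: "'a ell2 \<Rightarrow> 'a ell2 \<Rightarrow> 'a ell2" is "\<lambda>f g x. f x + g x"
  by (rule ell2_add_summable)

lift_definition scaleC_ell2 :: "complex \<Rightarrow> 'a ell2 \<Rightarrow> 'a ell2" is "\<lambda>c f x. c * f x"
  by (rule ell2_scale_summable)

lift_definition uminus_ell2 :: "'a ell2 \<Rightarrow> 'a ell2" is "\<lambda>f x. - f x" by simp

definition minus_ell2 :: "'a ell2 \<Rightarrow> 'a ell2 \<Rightarrow> 'a ell2"
  where "minus_ell2 f g = f + - g"

definition scaleR_ell2 :: "real \<Rightarrow> 'a ell2 \<Rightarrow> 'a ell2"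
  where "scaleR_ell2 r f = complex_of_real r *\<^sub>C f"

definition inner_ell2 :: "'a ell2 \<Rightarrow> 'a ell2 \<Rightarrow> real"
  where "inner_ell2 f g = Re (\<Sum>\<^sub>\<infinity>x. ell2_fun f x * cnj (ell2_fun g x))"

definition norm_ell2 :: "'a ell2 \<Rightarrow> real"
  where "norm_ell2 f = sqrt (inner f f)"

definition sgn_ell2 :: "'a ell2 \<Rightarrow> 'a ell2"
  where "sgn_ell2 f = scaleR (inverse (norm f)) f"

definition dist_ell2 :: "'a ell2 \<Rightarrow> 'a ell2 \<Rightarrow> real"
  where "dist_ell2 f g = norm (f - g)"

definition uniformity_ell2 :: "('a ell2 \<times> 'a ell2) filter"
  where "uniformity_ell2 = (INF e\<in>{0<..}. principal {(x, y). dist x y < e})"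

definition open_ell2 :: "'a ell2 set \<Rightarrow> bool"
  where "open_ell2 U \<longleftrightarrow> (\<forall>x\<in>U. eventually (\<lambda>(x', y). x' = x \<longrightarrow> y \<in> U) uniformity)"

lemma ell2_inner_summable:
  "(\<lambda>x. ell2_fun f x * cnj (ell2_fun g x)) summable_on UNIV"
  using ell2_fun[of f] ell2_fun[of g] by (simp add: ell2_mult_summable)

lemma ell2_inner_self:
  "inner (f :: 'a ell2) f = (\<Sum>\<^sub>\<infinity>x. (cmod (ell2_fun f x))\<^sup>2)"
proof -
  have "inner f f = (\<Sum>\<^sub>\<infinity>x. Re (ell2_fun f x * cnj (ell2_fun f x)))"
    unfolding inner_ell2_def by (rule infsum_Re[symmetric]) (rule ell2_inner_summable)
  also have "\<dots> = (\<Sum>\<^sub>\<infinity>x. (cmod (ell2_fun f x))\<^sup>2)"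
    by (rule infsum_cong) (simp add: complex_mult_cnj cmod_power2)
  finally show ?thesis .
qed

instance
proof
  fix f g h :: "'a ell2" and r s :: real
  show "f + g + h = f + (g + h)" "f + g = g + f" "0 + f = f" "- f + f = 0" "f - g = f + - g"
    by (simp add: minus_ell2_def | transfer, simp add: add_ac)+
  show "r *\<^sub>R (f + g) = r *\<^sub>R f + r *\<^sub>R g" "(r + s) *\<^sub>R f = r *\<^sub>R f + s *\<^sub>R f"
    "r *\<^sub>R s *\<^sub>R f = (r * s) *\<^sub>R f" "1 *\<^sub>R f = f"
    unfolding scaleR_ell2_def by (transfer; simp add: algebra_simps)+
  show "sgn f = scaleR (inverse (norm f)) f" "dist f g = norm (f - g)" "norm f = sqrt (inner f f)"
    by (simp_all add: sgn_ell2_def dist_ell2_def norm_ell2_def)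
  show "uniformity = (INF e\<in>{0<..}. principal {(x, y :: 'a ell2). dist x y < e})"
    by (rule uniformity_ell2_def)
  show "open U \<longleftrightarrow> (\<forall>x\<in>U. \<forall>\<^sub>F (x', y) in uniformity. x' = x \<longrightarrow> y \<in> U)" for U :: "'a ell2 set"
    by (rule open_ell2_def)
  have "inner f g = Re (cnj (\<Sum>\<^sub>\<infinity>x. ell2_fun f x * cnj (ell2_fun g x)))"
    by (simp add: inner_ell2_def)
  also have "\<dots> = inner g f"
    unfolding infsum_cnj[symmetric] inner_ell2_def by (simp add: mult.commute)
  finally show "inner f g = inner g f" .
  show "inner (f + g) h = inner f h + inner g h"
    using infsum_add[OF ell2_inner_summable[of f h] ell2_inner_summable[of g h]]
    by (simp add: inner_ell2_def plus_ell2.rep_eq distrib_right)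
  show "inner (r *\<^sub>R f) g = r * inner f g"
    by (simp add: inner_ell2_def scaleR_ell2_def scaleC_ell2.rep_eq mult.assoc infsum_cmult_right')
  show "0 \<le> inner f f"
    unfolding ell2_inner_self by (rule infsum_nonneg) simp
  show "inner f f = 0 \<longleftrightarrow> f = 0"
  proof
    assume "inner f f = 0"
    then have "(cmod (ell2_fun f x))\<^sup>2 = 0" for x
      using ell2_fun[of f] nonneg_infsum_le_0D[of "\<lambda>x. (cmod (ell2_fun f x))\<^sup>2" UNIV x]
      by (simp add: ell2_inner_self)
    then show "f = 0"
      by (simp add: fun_eq_iff zero_ell2.rep_eq flip: ell2_fun_inject)
  qed (simp add: ell2_inner_self zero_ell2.rep_eq)
qed

end

lemma ell2_norm_square: "(norm f)\<^sup>2 = (\<Sum>\<^sub>\<infinity>x. (cmod (ell2_fun f x))\<^sup>2)"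
  by (simp add: power2_norm_eq_inner ell2_inner_self)

lemma ell2_sum_le_norm_square:
  assumes "finite F"
  shows "(\<Sum>x\<in>F. (cmod (ell2_fun f x))\<^sup>2) \<le> (norm f)\<^sup>2"
  unfolding ell2_norm_square using assms ell2_fun[of f] by (intro finite_sum_le_infsum) auto

lemma ell2_cmod_le_norm: "cmod (ell2_fun f x) \<le> norm f"
  using ell2_sum_le_norm_square[of "{x}" f] by (simp add: power2_le_iff_abs_le)

lemma ell2_norm_square_le:
  assumes "\<And>F. finite F \<Longrightarrow> (\<Sum>x\<in>F. (cmod (ell2_fun f x))\<^sup>2) \<le> b"
  shows "(norm f)\<^sup>2 \<le> b"
  unfolding ell2_norm_square using assms ell2_fun[of f] by (intro infsum_le_finite_sums) auto

lemma ell2_fun_diff: "ell2_fun (f - g) x = ell2_fun f x - ell2_fun g x"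
  unfolding minus_ell2_def plus_ell2.rep_eq uminus_ell2.rep_eq by simp

lemma ell2_complete:
  fixes u :: "nat \<Rightarrow> 'x ell2"
  assumes "Cauchy u"
  shows "convergent u"
proof -
  have "Cauchy (\<lambda>m. ell2_fun (u m) x)" for x
  proof (rule CauchyI)
    fix e :: real
    assume "0 < e"
    then obtain M where "\<forall>m\<ge>M. \<forall>p\<ge>M. norm (u m - u p) < e"
      using CauchyD[OF assms] by blast
    moreover have "norm (ell2_fun (u m) x - ell2_fun (u p) x) \<le> norm (u m - u p)" for m p
      using ell2_cmod_le_norm[of "u m - u p" x] by (simp add: ell2_fun_diff)
    ultimately show "\<exists>M. \<forall>m\<ge>M. \<forall>p\<ge>M. norm (ell2_fun (u m) x - ell2_fun (u p) x) < e"
      by (meson order_le_less_trans)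
  qed
  then have "\<exists>l. \<forall>x. (\<lambda>m. ell2_fun (u m) x) \<longlonglongrightarrow> l x"
    unfolding Cauchy_convergent_iff convergent_def by (rule choice[OF allI])
  then obtain l where l: "\<And>x. (\<lambda>m. ell2_fun (u m) x) \<longlonglongrightarrow> l x"
    by blast
  have tail: "(\<Sum>x\<in>F. (cmod (l x - ell2_fun (u m) x))\<^sup>2) \<le> e\<^sup>2"
    if "finite F" "\<And>p. p \<ge> M \<Longrightarrow> norm (u p - u m) \<le> e" for F m M e
  proof (rule tendsto_upperbound)
    show "(\<lambda>p. \<Sum>x\<in>F. (cmod (ell2_fun (u p) x - ell2_fun (u m) x))\<^sup>2)
        \<longlonglongrightarrow> (\<Sum>x\<in>F. (cmod (l x - ell2_fun (u m) x))\<^sup>2)"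
      by (intro tendsto_intros l)
    show "\<forall>\<^sub>F p in sequentially.
        (\<Sum>x\<in>F. (cmod (ell2_fun (u p) x - ell2_fun (u m) x))\<^sup>2) \<le> e\<^sup>2"
      using eventually_ge_at_top[of M]
    proof eventually_elim
      case (elim p)
      have "(\<Sum>x\<in>F. (cmod (ell2_fun (u p - u m) x))\<^sup>2) \<le> (norm (u p - u m))\<^sup>2"
        using that(1) by (rule ell2_sum_le_norm_square)
      also have "\<dots> \<le> e\<^sup>2"
        using that(2)[OF elim] by (simp add: power_mono)
      finally show ?case
        by (simp add: ell2_fun_diff)
    qed
  qed simp
  obtain M where M: "\<And>m p. m \<ge> M \<Longrightarrow> p \<ge> M \<Longrightarrow> norm (u p - u m) \<le> 1"
    using CauchyD[OF assms zero_less_one] by (blast intro: less_imp_le)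
  have "(\<lambda>x. (cmod (l x - ell2_fun (u M) x))\<^sup>2) summable_on UNIV"
    using tail[of _ M M 1] M
    by (intro nonneg_bdd_above_summable_on bdd_aboveI2[of _ _ 1]) auto
  then have "(\<lambda>x. (cmod ((l x - ell2_fun (u M) x) + ell2_fun (u M) x))\<^sup>2) summable_on UNIV"
    using ell2_fun[of "u M"] by (intro ell2_add_summable) auto
  then have L: "ell2_fun (Abs_ell2 l) = l"
    by (simp add: Abs_ell2_inverse)
  have "u \<longlonglongrightarrow> Abs_ell2 l"
  proof (rule LIMSEQ_I)
    fix r :: real
    assume "r > 0"
    then obtain N where N: "\<And>m p. m \<ge> N \<Longrightarrow> p \<ge> N \<Longrightarrow> norm (u p - u m) < r / 2"
      using CauchyD[OF assms half_gt_zero] by blast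
    have "norm (u m - Abs_ell2 l) < r" if "m \<ge> N" for m
    proof -
      have "(norm (Abs_ell2 l - u m))\<^sup>2 \<le> (r / 2)\<^sup>2"
        using tail[of _ N m "r / 2"] N[OF that]
        by (intro ell2_norm_square_le) (auto simp: ell2_fun_diff L less_imp_le)
      then have "norm (Abs_ell2 l - u m) \<le> r / 2"
        using \<open>r > 0\<close> by (simp add: power2_le_iff_abs_le)
      then show ?thesis
        using \<open>r > 0\<close> by (simp add: norm_minus_commute)
    qed
    then show "\<exists>N. \<forall>m\<ge>N. norm (u m - Abs_ell2 l) < r"
      by blast
  qed
  then show ?thesis
    by (rule convergentI)
qed

instantiation ell2 :: (type) complex_hilbert
begin

definition cinner_ell2 :: "'a ell2 \<Rightarrow> 'a ell2 \<Rightarrow> complex"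
  where "cinner_ell2 f g = (\<Sum>\<^sub>\<infinity>x. ell2_fun f x * cnj (ell2_fun g x))"

instance
proof
  fix f g h :: "'a ell2" and c d :: complex and r :: real
  show "Cauchy u \<Longrightarrow> convergent u" for u :: "nat \<Rightarrow> 'a ell2"
    by (rule ell2_complete)
  show "c *\<^sub>C (f + g) = c *\<^sub>C f + c *\<^sub>C g" "(c + d) *\<^sub>C f = c *\<^sub>C f + d *\<^sub>C f"
    "c *\<^sub>C d *\<^sub>C f = (c * d) *\<^sub>C f"
    by (transfer; simp add: algebra_simps)+
  show "complex_of_real r *\<^sub>C f = r *\<^sub>R f"
    by (simp add: scaleR_ell2_def)
  show "cinner g f = cnj (cinner f g)"
    unfolding cinner_ell2_def infsum_cnj[symmetric] by (simp add: mult.commute)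
  show "cinner (f + g) h = cinner f h + cinner g h"
    using infsum_add[OF ell2_inner_summable[of f h] ell2_inner_summable[of g h]]
    by (simp add: cinner_ell2_def plus_ell2.rep_eq distrib_right)
  show "cinner (c *\<^sub>C f) g = c * cinner f g"
    by (simp add: cinner_ell2_def scaleC_ell2.rep_eq mult.assoc infsum_cmult_right')
  show "inner f g = Re (cinner f g)"
    by (simp add: inner_ell2_def cinner_ell2_def)
qed

end

lift_definition chi :: "'x \<Rightarrow> 'x ell2" is "\<lambda>a x. if x = a then 1 else 0"
proof -
  fix a :: 'x
  have "(\<lambda>x. (cmod (if x = a then 1 else 0))\<^sup>2) summable_on UNIV
      \<longleftrightarrow> (\<lambda>x. (cmod (if x = a then 1 else 0))\<^sup>2) summable_on {a}"
    by (rule summable_on_cong_neutral) auto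
  then show "(\<lambda>x. (cmod (if x = a then 1 else 0))\<^sup>2) summable_on UNIV"
    by simp
qed


section \<open>Operators on closed subspaces and C*-algebras\<close>

text \<open>A Hilbert space is given by a closed complex subspace \<open>H\<close> of a type of class
  \<^class>\<open>complex_hilbert\<close>; the whole type is the case \<open>H = UNIV\<close>. Subspaces are needed because
  \<open>l\<^sup>2\<close> of a product of free semigroups depends on the numerical parameters \<open>k\<close> and \<open>n\<close>.
  An operator on \<open>H\<close> is represented by its extension by \<open>0\<close> to the orthogonal complement
  of \<open>H\<close>. This identification respects the norm, sums, products and adjoints; the identity
  operator of \<open>H\<close> becomes the orthogonal projection onto \<open>H\<close>.\<close>

definition closed_csubspace :: "'a::complex_hilbert set \<Rightarrow> bool" where
  "closed_csubspace H \<longleftrightarrow>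
     0 \<in> H \<and> (\<forall>x\<in>H. \<forall>y\<in>H. x + y \<in> H) \<and> (\<forall>c. \<forall>x\<in>H. c *\<^sub>C x \<in> H) \<and> closed H"

definition bounded_ops :: "'a::complex_hilbert set \<Rightarrow> ('a \<Rightarrow>\<^sub>L 'a) set" where
  "bounded_ops H = {T :: 'a \<Rightarrow>\<^sub>L 'a. (\<forall>c x. T (c *\<^sub>C x) = c *\<^sub>C T x) \<and> (\<forall>x. T x \<in> H) \<and>
     (\<forall>x. (\<forall>h\<in>H. cinner x h = 0) \<longrightarrow> T x = 0)}"

definition id_op :: "'a::complex_hilbert set \<Rightarrow> 'a \<Rightarrow>\<^sub>L 'a" where
  "id_op H = (THE P. P \<in> bounded_ops H \<and> (\<forall>x\<in>H. P x = x))"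

definition adj :: "('a::complex_hilbert \<Rightarrow>\<^sub>L 'a) \<Rightarrow> 'a \<Rightarrow>\<^sub>L 'a" where
  "adj T = (THE R. R \<in> bounded_ops UNIV \<and> (\<forall>x y. cinner (T x) y = cinner x (R y)))"

definition cstar_algebra :: "('a::complex_hilbert \<Rightarrow>\<^sub>L 'a) set \<Rightarrow> bool" where
  "cstar_algebra A \<longleftrightarrow> A \<subseteq> bounded_ops UNIV \<and> 0 \<in> A \<and>
     (\<forall>a\<in>A. \<forall>b\<in>A. a + b \<in> A) \<and> (\<forall>c. \<forall>a\<in>A. c *\<^sub>C a \<in> A) \<and>
     (\<forall>a\<in>A. \<forall>b\<in>A. a o\<^sub>L b \<in> A) \<and> (\<forall>a\<in>A. adj a \<in> A) \<and> closed A"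

definition star_hom ::
    "('a::complex_hilbert \<Rightarrow>\<^sub>L 'a) set \<Rightarrow> ('b::complex_hilbert \<Rightarrow>\<^sub>L 'b) set \<Rightarrow>
     (('a \<Rightarrow>\<^sub>L 'a) \<Rightarrow> ('b \<Rightarrow>\<^sub>L 'b)) \<Rightarrow> bool" where
  "star_hom A B \<phi> \<longleftrightarrow> (\<forall>a\<in>A. \<phi> a \<in> B) \<and>
     (\<forall>a\<in>A. \<forall>b\<in>A. \<phi> (a + b) = \<phi> a + \<phi> b) \<and> (\<forall>c. \<forall>a\<in>A. \<phi> (c *\<^sub>C a) = c *\<^sub>C \<phi> a) \<and>
     (\<forall>a\<in>A. \<forall>b\<in>A. \<phi> (a o\<^sub>L b) = \<phi> a o\<^sub>L \<phi> b) \<and> (\<forall>a\<in>A. \<phi> (adj a) = adj (\<phi> a))"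

definition cstar_isomorphic ::
    "('a::complex_hilbert \<Rightarrow>\<^sub>L 'a) set \<Rightarrow> ('b::complex_hilbert \<Rightarrow>\<^sub>L 'b) set \<Rightarrow> bool" where
  "cstar_isomorphic A B \<longleftrightarrow> (\<exists>\<phi>. star_hom A B \<phi> \<and> bij_betw \<phi> A B)"

text \<open>Representations on \<open>H\<close> of an algebra \<open>A\<close> of operators on \<open>H\<^sub>0\<close> that contains the
  identity of \<open>H\<^sub>0\<close>; as usual for unital C*-algebras they are required to be unital.\<close>

definition star_representation ::
    "'a::complex_hilbert set \<Rightarrow> ('a \<Rightarrow>\<^sub>L 'a) set \<Rightarrow> 'b::complex_hilbert set \<Rightarrow>
     (('a \<Rightarrow>\<^sub>L 'a) \<Rightarrow> ('b \<Rightarrow>\<^sub>L 'b)) \<Rightarrow> bool" where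
  "star_representation H\<^sub>0 A H \<pi> \<longleftrightarrow> star_hom A (bounded_ops H) \<pi> \<and> \<pi> (id_op H\<^sub>0) = id_op H"


section \<open>Doubly commuting row isometries\<close>

text \<open>The entry \<open>\<lambda>\<^sub>i\<^sub>,\<^sub>j(s,t)\<close> is \<open>lam i j s t\<close>, the operator \<open>V\<^sub>i\<^sub>,\<^sub>s\<close> is \<open>V i s\<close>; only indices
  \<open>i, j \<in> {1..k}\<close> with \<open>i \<noteq> j\<close>, \<open>s \<in> {1..n i}\<close> and \<open>t \<in> {1..n j}\<close> are relevant.\<close>

definition twist_matrices ::
    "nat \<Rightarrow> (nat \<Rightarrow> nat) \<Rightarrow> (nat \<Rightarrow> nat \<Rightarrow> nat \<Rightarrow> nat \<Rightarrow> complex) \<Rightarrow> bool" where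
  "twist_matrices k n lam \<longleftrightarrow>
     (\<forall>i\<in>{1..k}. \<forall>j\<in>{1..k}. i \<noteq> j \<longrightarrow> (\<forall>s\<in>{1..n i}. \<forall>t\<in>{1..n j}.
        cmod (lam i j s t) = 1 \<and> lam j i t s = cnj (lam i j s t)))"

definition row_isometry ::
    "'a::complex_hilbert set \<Rightarrow> nat \<Rightarrow> (nat \<Rightarrow> 'a \<Rightarrow>\<^sub>L 'a) \<Rightarrow> bool" where
  "row_isometry H m W \<longleftrightarrow> (\<forall>s\<in>{1..m}. W s \<in> bounded_ops H) \<and>
     (\<forall>s\<in>{1..m}. \<forall>t\<in>{1..m}. adj (W s) o\<^sub>L W t = (if s = t then id_op H else 0))"

definition doubly_commuting_row_isometries ::
    "'a::complex_hilbert set \<Rightarrow> nat \<Rightarrow> (nat \<Rightarrow> nat) \<Rightarrow> (nat \<Rightarrow> nat \<Rightarrow> nat \<Rightarrow> nat \<Rightarrow> complex) \<Rightarrow>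
     (nat \<Rightarrow> nat \<Rightarrow> 'a \<Rightarrow>\<^sub>L 'a) \<Rightarrow> bool" where
  "doubly_commuting_row_isometries H k n lam V \<longleftrightarrow>
     (\<forall>i\<in>{1..k}. row_isometry H (n i) (V i)) \<and>
     (\<forall>i\<in>{1..k}. \<forall>j\<in>{1..k}. i \<noteq> j \<longrightarrow> (\<forall>s\<in>{1..n i}. \<forall>t\<in>{1..n j}.
        adj (V i s) o\<^sub>L V j t = cnj (lam i j s t) *\<^sub>C (V j t o\<^sub>L adj (V i s))))"

definition cstar_generated ::
    "nat \<Rightarrow> (nat \<Rightarrow> nat) \<Rightarrow> (nat \<Rightarrow> nat \<Rightarrow> 'a::complex_hilbert \<Rightarrow>\<^sub>L 'a) \<Rightarrow> ('a \<Rightarrow>\<^sub>L 'a) set" where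
  "cstar_generated k n V = cstar_algebra hull {V i s | i s. i \<in> {1..k} \<and> s \<in> {1..n i}}"


section \<open>The standard tuple\<close>

text \<open>The free semigroup on \<open>m\<close> generators is \<^term>\<open>lists {1..m}\<close>: a word is the list of the
  indices of its letters, the neutral element is the empty list.\<close>

definition words :: "nat \<Rightarrow> (nat \<Rightarrow> nat) \<Rightarrow> (nat \<Rightarrow> nat list) set" where
  "words k n = (\<Pi>\<^sub>E i\<in>{1..k}. lists {1..n i})"

definition fock_space :: "nat \<Rightarrow> (nat \<Rightarrow> nat) \<Rightarrow> (nat \<Rightarrow> nat list) ell2 set" where
  "fock_space k n = {f. \<forall>\<alpha>. \<alpha> \<notin> words k n \<longrightarrow> ell2_fun f \<alpha> = 0}"

definition word_twist ::
    "(nat \<Rightarrow> nat \<Rightarrow> nat \<Rightarrow> nat \<Rightarrow> complex) \<Rightarrow> nat \<Rightarrow> nat \<Rightarrow> nat \<Rightarrow> nat list \<Rightarrow> complex" where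
  "word_twist lam i j s w = (\<Prod>t\<leftarrow>w. lam i j s t)"

definition standard_tuple ::
    "nat \<Rightarrow> (nat \<Rightarrow> nat) \<Rightarrow> (nat \<Rightarrow> nat \<Rightarrow> nat \<Rightarrow> nat \<Rightarrow> complex) \<Rightarrow>
     nat \<Rightarrow> nat \<Rightarrow> (nat \<Rightarrow> nat list) ell2 \<Rightarrow>\<^sub>L (nat \<Rightarrow> nat list) ell2" where
  "standard_tuple k n lam i s =
     (THE T. T \<in> bounded_ops (fock_space k n) \<and>
        (\<forall>\<alpha>\<in>words k n. T (chi \<alpha>) =
           (\<Prod>j\<in>{1..<i}. word_twist lam i j s (\<alpha> j)) *\<^sub>C chi (\<alpha>(i := s # \<alpha> i))))"

end

(*
  The main point is to compare a tuple V of doubly Lambda-commuting row isometries on K with the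
  standard tuple S. Cutting the words off at length N with slowly decreasing weights gives, for
  every N, an isometry J_N from K into the tensor product of the Fock space with K, a finite
  version of the noncommutative Poisson kernel, with (S* tensor 1) J_N - J_N V* = O(1 / sqrt N).
  As S and V are isometric, also (S tensor 1) J_N - J_N V tends to 0. The pairs (a, b) for which
  (a tensor 1) J_N - J_N b and the same expression for the adjoints tend to 0 pointwise form a
  closed *-algebra containing all the pairs (S_is, V_is), and norm b <= norm a on it because J_N is
  isometric; so it is the graph of the required homomorphism.

  Uniqueness in (i) and surjectivity in (ii) need that *-homomorphisms of C*-algebras are
  contractive and have closed range. Both are obtained without spectral theory from Banach's fixed
  point theorem, which solves 2 y = a* a + y^2 and y + a a* y = a inside the algebra.

  For (iii), a nonzero kernel of the homomorphism would contain the vacuum projection of the Fock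
  space, whose image is the product of the projections 1 - sum_s V_is V_is*; but this product fixes
  every vector in the intersection of the kernels of the V_is*.
*)

theory Submission
  imports Defs
begin

text \<open>The obstacle is that \<open>V\<close> need not be pure. The exact Poisson kernel sends x
  to the family of the vectors V_w* x cut down by the defect projections; it is isometric only if
  the mass of x on long words tends to 0, and for a single unitary it is even 0. A sharp cut-off at
  length M restores isometry but leaves an intertwining error of order 1 at level M. Averaging the
  squared weights over the cut-offs M = 0, ..., N - 1 spreads this error: neighbouring square-root
  weights differ by at most 1 / sqrt N.

  The twist enters through the order of the factors: moving an adjoint of row i past the factors of
  the rows j < i yields exactly the scalar in the definition of S_i.

  A vector of the tensor product is represented by its coordinate sequences along finite orthonormal
  sets, and a tensor 1 acts on each sequence separately. Upper bounds come from Bessel's inequality;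
  exact norms need an orthonormal set large enough for the finitely many vectors involved.

  Surjectivity is a separate issue because the generated algebra is a hull: it contains limits of
  polynomials in the generators, and only closedness of the image captures them.\<close>

section \<open>Inner products and orthogonal projections\<close>

instance complex_hilbert \<subseteq> banach ..

lemma cinner_add_right: "cinner x (y + z) = cinner x y + cinner x z"
  for x :: "'a::complex_hilbert"
  by (metis cinner_add_left cinner_commute complex_cnj_add)

lemma cinner_scaleC_right: "cinner x (c *\<^sub>C y) = cnj c * cinner x y"
  for x :: "'a::complex_hilbert"
  by (metis cinner_scaleC_left cinner_commute complex_cnj_mult)

text \<open>\<open>real_inner\<close> provides the Cauchy-Schwarz inequality only for the real part;
  multiplying \<open>x\<close> by the unimodular \<open>u\<close> makes the complex inner product
  real and nonnegative.\<close>

lemma cmod_cinner_le: "cmod (cinner x y) \<le> norm x * norm y"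
  for x :: "'a::complex_hilbert"
proof (cases "cinner x y = 0")
  case False
  define u where "u = cnj (sgn (cinner x y))"
  have u: "cmod u = 1"
    using False by (simp add: u_def norm_sgn)
  have "u * cinner x y = cmod (cinner x y)"
    unfolding u_def sgn_div_norm
    using False complex_norm_square[of "cinner x y"]
    by (simp add: scaleR_conv_of_real field_simps power2_eq_square)
  then have "cmod (cinner x y) = inner (u *\<^sub>C x) y"
    by (simp add: inner_eq_Re_cinner cinner_scaleC_left)
  also have "\<dots> \<le> norm (u *\<^sub>C x) * norm y"
    by (rule norm_cauchy_schwarz)
  finally show ?thesis
    by (simp add: norm_scaleC u)
qed simp

lemma scaleR_scaleC: "r *\<^sub>R x = complex_of_real r *\<^sub>C x"
  for x :: "'a::complex_hilbert"
  by (simp add: scaleC_of_real)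

text \<open>Bounded bilinearity is meant over the reals and so covers conjugate linearity in the
  second argument; it supplies the rules for differences, sums and continuity.\<close>

interpretation cinner: bounded_bilinear "cinner :: 'a::complex_hilbert \<Rightarrow> 'a \<Rightarrow> complex"
proof
  show "\<exists>K. \<forall>a b :: 'a. norm (cinner a b) \<le> norm a * norm b * K"
    by (rule exI[of _ 1]) (simp add: cmod_cinner_le)
qed (simp_all add: cinner_add_left cinner_add_right scaleR_scaleC cinner_scaleC_left
    cinner_scaleC_right scaleR_conv_of_real)

interpretation scaleC: bounded_bilinear "scaleC :: complex \<Rightarrow> 'a::complex_hilbert \<Rightarrow> 'a"
proof
  show "\<exists>K. \<forall>a. \<forall>b :: 'a. norm (a *\<^sub>C b) \<le> norm a * norm b * K"
    by (rule exI[of _ 1]) (simp add: norm_scaleC)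
qed (simp_all add: scaleC_add_left scaleC_add_right scaleR_scaleC scaleC_scaleC
    scaleR_conv_of_real mult.commute)

lemma scaleC_one [simp]: "1 *\<^sub>C x = (x :: 'a::complex_hilbert)"
  using scaleC_of_real[of 1 x] by simp

lemma cinner_self: "cinner x x = complex_of_real ((norm x)\<^sup>2)"
  for x :: "'a::complex_hilbert"
proof -
  have "Im (cinner x x) = 0"
    using arg_cong[OF cinner_commute[of x x], of Im] by simp
  then show ?thesis
    by (simp add: complex_eq_iff power2_norm_eq_inner inner_eq_Re_cinner)
qed

lemma cinner_self_eq_0: "cinner x x = 0 \<longleftrightarrow> x = (0 :: 'a::complex_hilbert)"
  by (simp add: cinner_self)

lemma norm_diff_square:
  "(norm (x - y))\<^sup>2 = (norm x)\<^sup>2 + (norm y)\<^sup>2 - 2 * Re (cinner x y)"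
  for x :: "'a::complex_hilbert"
  by (simp add: power2_norm_eq_inner inner_diff_left inner_diff_right inner_commute
      flip: inner_eq_Re_cinner)

lemma norm_add_orthogonal_square:
  fixes x :: "'a::complex_hilbert"
  assumes "cinner x y = 0"
  shows "(norm (x + y))\<^sup>2 = (norm x)\<^sup>2 + (norm y)\<^sup>2"
  using norm_diff_square[of x "- y"] assms by (simp add: cinner.minus_right)

lemma closed_csubspaceD:
  assumes "closed_csubspace H"
  shows "0 \<in> H" "x \<in> H \<Longrightarrow> y \<in> H \<Longrightarrow> x + y \<in> H" "x \<in> H \<Longrightarrow> c *\<^sub>C x \<in> H" "closed H"
    "x \<in> H \<Longrightarrow> y \<in> H \<Longrightarrow> x - y \<in> H"
proof -
  show "x - y \<in> H" if "x \<in> H" "y \<in> H"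
  proof -
    have "x + complex_of_real (-1) *\<^sub>C y \<in> H"
      using assms that unfolding closed_csubspace_def by blast
    then show ?thesis
      unfolding scaleC_of_real by simp
  qed
qed (use assms in \<open>auto simp: closed_csubspace_def\<close>)

lemma closed_csubspace_UNIV [simp]: "closed_csubspace UNIV"
  by (simp add: closed_csubspace_def)

lemma projection_exists:
  fixes x :: "'a::complex_hilbert"
  assumes H: "closed_csubspace H"
  shows "\<exists>p\<in>H. \<forall>h\<in>H. cinner (x - p) h = 0"
proof -
  note HD = closed_csubspaceD[OF H]
  define d where "d = (INF h\<in>H. (norm (x - h))\<^sup>2)"
  have bdd: "bdd_below ((\<lambda>h. (norm (x - h))\<^sup>2) ` H)"
    by (rule bdd_belowI2[of _ 0]) simp
  have d_le: "d \<le> (norm (x - h))\<^sup>2" if "h \<in> H" for h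
    unfolding d_def using bdd that by (rule cINF_lower)
  have "\<exists>h\<in>H. (norm (x - h))\<^sup>2 < d + 1 / real (Suc m)" for m
    using cINF_less_iff[OF _ bdd, of "d + 1 / real (Suc m)"] HD(1) by (auto simp flip: d_def)
  then obtain u where uH: "\<And>m. u m \<in> H" and u: "\<And>m. (norm (x - u m))\<^sup>2 < d + 1 / real (Suc m)"
    by metis
  have dist: "(norm (u m - u p))\<^sup>2 \<le> 2 / real (Suc m) + 2 / real (Suc p)" for m p
  proof -
    \<comment> \<open>The parallelogram law is applied at the midpoint, which lies in
      \<open>H\<close>, so that its squared distance from \<open>x\<close> is at least
      \<open>d\<close>. This makes the minimising sequence Cauchy.\<close>
    have half: "(1/2) *\<^sub>R (u m + u p) \<in> H"
      using HD uH by (simp add: scaleR_scaleC)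
    have "(norm (u m - u p))\<^sup>2 + 4 * (norm (x - (1/2) *\<^sub>R (u m + u p)))\<^sup>2
        = 2 * (norm (x - u m))\<^sup>2 + 2 * (norm (x - u p))\<^sup>2"
      by (simp add: power2_norm_eq_inner inner_diff_left inner_diff_right inner_add_left
          inner_add_right inner_commute algebra_simps)
    then show ?thesis
      using d_le[OF half] u[of m] u[of p] by linarith
  qed
  have "Cauchy u"
  proof (rule CauchyI)
    fix e :: real
    assume "0 < e"
    then obtain M where M: "4 / e\<^sup>2 < real (Suc M)"
      by (metis reals_Archimedean2 less_trans lessI of_nat_less_iff)
    have "norm (u m - u p) < e" if "m \<ge> M" "p \<ge> M" for m p
    proof -
      have "(norm (u m - u p))\<^sup>2 \<le> 2 / real (Suc M) + 2 / real (Suc M)"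
        using dist[of m p] frac_le[of 2 2 "real (Suc M)" "real (Suc m)"]
          frac_le[of 2 2 "real (Suc M)" "real (Suc p)"] that by simp
      also have "\<dots> = 4 / real (Suc M)"
        by simp
      also have "\<dots> < e\<^sup>2"
        using M \<open>0 < e\<close> by (simp add: field_simps)
      finally show ?thesis
        using \<open>0 < e\<close> by (simp add: power2_less_imp_less)
    qed
    then show "\<exists>M. \<forall>m\<ge>M. \<forall>n\<ge>M. norm (u m - u n) < e"
      by blast
  qed
  then obtain p where p: "u \<longlonglongrightarrow> p"
    using Cauchy_convergent_iff convergent_def by blast
  have pH: "p \<in> H"
    using HD(4) uH p by (rule closed_sequentially)
  have "(norm (x - p))\<^sup>2 \<le> d"
  proof (rule LIMSEQ_le)
    show "(\<lambda>m. (norm (x - u m))\<^sup>2) \<longlonglongrightarrow> (norm (x - p))\<^sup>2"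
      by (intro tendsto_intros p)
    show "(\<lambda>m. d + 1 / real (Suc m)) \<longlonglongrightarrow> d"
      using tendsto_add[OF tendsto_const LIMSEQ_inverse_real_of_nat, of d]
      by (simp add: inverse_eq_divide)
  qed (use u in \<open>auto intro: less_imp_le\<close>)
  then have min: "(norm (x - p))\<^sup>2 \<le> (norm (x - h))\<^sup>2" if "h \<in> H" for h
    using d_le[OF that] by linarith
  have "cinner (x - p) h = 0" if h: "h \<in> H" for h
  proof (rule ccontr)
    define w where "w = cinner (x - p) h"
    \<comment> \<open>The multiple \<open>c\<close> of \<open>h\<close> is the best approximation of
      \<open>x - p\<close> on the line through \<open>h\<close>; moving \<open>p\<close> by
      \<open>c *\<^sub>C h\<close> would lower the squared distance by
      \<open>t * (cmod w)\<^sup>2\<close>.\<close>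
    define t where "t = 1 / (norm h)\<^sup>2"
    assume "cinner (x - p) h \<noteq> 0"
    then have w: "w \<noteq> 0" and h0: "h \<noteq> 0"
      by (auto simp: w_def cinner.zero_right)
    define c where "c = complex_of_real t * w"
    have norm_ch: "norm (c *\<^sub>C h) = t * cmod w * norm h"
      unfolding norm_scaleC c_def norm_mult norm_of_real by (simp add: t_def)
    have "p + c *\<^sub>C h \<in> H"
      using HD pH h by blast
    from min[OF this] have "(norm (x - p))\<^sup>2 \<le> (norm ((x - p) - c *\<^sub>C h))\<^sup>2"
      by (simp add: algebra_simps)
    also have "\<dots> = (norm (x - p))\<^sup>2 + (t * cmod w * norm h)\<^sup>2 - 2 * Re (cnj c * w)"
      unfolding norm_diff_square[of "x - p"] norm_ch cinner_scaleC_right w_def[symmetric] ..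
    also have "Re (cnj c * w) = t * (cmod w)\<^sup>2"
      unfolding cmod_power2 by (simp add: c_def power2_eq_square algebra_simps)
    also have "(t * cmod w * norm h)\<^sup>2 = t * (cmod w)\<^sup>2"
      using h0 by (simp add: t_def power_mult_distrib power2_eq_square)
    finally have "t * (cmod w)\<^sup>2 \<le> 0"
      by simp
    moreover have "t * (cmod w)\<^sup>2 > 0"
      using w h0 by (simp add: t_def)
    ultimately show False
      by simp
  qed
  with pH show ?thesis
    by blast
qed

text \<open>A closed subspace is its own double orthogonal complement: the component of
  \<open>x\<close> orthogonal to \<open>H\<close> is orthogonal to \<open>x\<close> by hypothesis
  and to the projection of \<open>x\<close>, hence to itself.\<close>

lemma mem_csubspace_if_orthogonal:
  assumes H: "closed_csubspace H" and x: "\<And>y. (\<forall>h\<in>H. cinner y h = 0) \<Longrightarrow> cinner x y = 0"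
  shows "x \<in> H"
proof -
  obtain p where p: "p \<in> H" "\<forall>h\<in>H. cinner (x - p) h = 0"
    using projection_exists[OF H] by blast
  have "cinner (x - p) (x - p) = 0"
    using x[OF p(2)] p cinner_commute[of p "x - p"] by (simp add: cinner.diff_left)
  then show ?thesis
    using p(1) by (simp add: cinner_self_eq_0)
qed

lemma cinner_ext_right: "(\<And>x. cinner x y = cinner x z) \<Longrightarrow> y = z"
  for y :: "'a::complex_hilbert"
  using cinner_self_eq_0[of "y - z"] by (simp add: cinner.diff_right)

section \<open>Adjoints and operators on a closed subspace\<close>

lemma bounded_opsD:
  fixes T :: "'a::complex_hilbert \<Rightarrow>\<^sub>L 'a"
  assumes "T \<in> bounded_ops H"
  shows "T (c *\<^sub>C x) = c *\<^sub>C T x" "T x \<in> H" "(\<And>h. h \<in> H \<Longrightarrow> cinner x h = 0) \<Longrightarrow> T x = 0"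
  using assms by (auto simp: bounded_ops_def)

lemma bounded_ops_UNIV_iff: "T \<in> bounded_ops UNIV \<longleftrightarrow> (\<forall>c x. T (c *\<^sub>C x) = c *\<^sub>C T x)"
proof -
  have "T x = 0" if "\<forall>h. cinner x h = 0" for x
    using that cinner_self_eq_0 blinfun.zero_right by metis
  then show ?thesis
    by (auto simp: bounded_ops_def)
qed

lemma bounded_ops_subset_UNIV: "bounded_ops H \<subseteq> bounded_ops UNIV"
  by (auto simp: bounded_ops_UNIV_iff bounded_opsD)

lemma riesz_representation:
  fixes f :: "'a::complex_hilbert \<Rightarrow> complex"
  assumes f: "bounded_linear f" and fC: "\<And>c x. f (c *\<^sub>C x) = c * f x"
  shows "\<exists>y. \<forall>x. f x = cinner x y"
proof (cases "\<forall>x. f x = 0")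
  case False
  interpret f: bounded_linear f by (rule f)
  define H where "H = {x. f x = 0}"
  have "closed H"
    unfolding H_def by (intro closed_Collect_eq f.continuous_on continuous_intros)
  then have H: "closed_csubspace H"
    by (auto simp: closed_csubspace_def H_def f.zero f.add fC)
  from False obtain z where z: "f z \<noteq> 0"
    by blast
  obtain p where p: "p \<in> H" "\<forall>h\<in>H. cinner (z - p) h = 0"
    using projection_exists[OF H] by blast
  define u where "u = z - p"
  have fu: "f u = f z"
    using p(1) by (simp add: u_def f.diff H_def)
  then have u0: "cinner u u \<noteq> 0"
    using z f.zero by (auto simp: cinner_self_eq_0)
  have u_real: "cnj (cinner u u) = cinner u u"
    by (rule cinner_commute[symmetric])
  \<comment> \<open>A vector orthogonal to the kernel of \<open>f\<close> represents
    \<open>f\<close> up to scaling, because \<open>f u *\<^sub>C x - f x *\<^sub>C u\<close> always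
    lies in that kernel.\<close>
  have "f x = cinner x ((cnj (f u) / cinner u u) *\<^sub>C u)" for x
  proof -
    have "f u *\<^sub>C x - f x *\<^sub>C u \<in> H"
      by (simp add: H_def f.diff fC)
    then have "cinner u (f u *\<^sub>C x - f x *\<^sub>C u) = 0"
      using p(2) by (simp add: u_def)
    then have "cinner (f u *\<^sub>C x - f x *\<^sub>C u) u = 0"
      by (metis cinner_commute complex_cnj_zero)
    then show ?thesis
      using u0 by (simp add: cinner.diff_left cinner_scaleC_left cinner_scaleC_right u_real field_simps)
  qed
  then show ?thesis
    by blast
qed (auto intro: exI[of _ 0] simp: cinner.zero_right)

lemma adjoint_exists:
  fixes T :: "'a::complex_hilbert \<Rightarrow>\<^sub>L 'a"
  assumes T: "T \<in> bounded_ops UNIV"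
  shows "\<exists>R :: 'a \<Rightarrow>\<^sub>L 'a. R \<in> bounded_ops UNIV \<and> (\<forall>x y. cinner (T x) y = cinner x (R y)) \<and> norm R \<le> norm T"
proof -
  have "\<exists>z. \<forall>x. cinner (T x) y = cinner x z" for y
  proof (rule riesz_representation)
    show "bounded_linear (\<lambda>x. cinner (T x) y)"
      using bounded_linear_compose[OF cinner.bounded_linear_left blinfun.bounded_linear_right] .
  qed (simp add: bounded_opsD(1)[OF T] cinner_scaleC_left)
  then obtain R where R: "\<And>x y. cinner (T x) y = cinner x (R y)"
    by metis
  have lin: "R (c *\<^sub>C y) = c *\<^sub>C R y" for c y
    by (rule cinner_ext_right) (simp add: cinner_scaleC_right flip: R)
  have bound: "norm (R y) \<le> norm T * norm y" for y
  proof -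
    have "(norm (R y))\<^sup>2 = cmod (cinner (T (R y)) y)"
      unfolding R cinner_self norm_of_real by simp
    also have "\<dots> \<le> norm (T (R y)) * norm y"
      by (rule cmod_cinner_le)
    also have "\<dots> \<le> (norm T * norm (R y)) * norm y"
      by (intro mult_right_mono norm_blinfun) simp
    finally have "norm (R y) * norm (R y) \<le> norm (R y) * (norm T * norm y)"
      by (simp add: power2_eq_square mult_ac)
    then show ?thesis
      by (cases "norm (R y) = 0") auto
  qed
  have "bounded_linear R"
  proof (rule bounded_linear_intro)
    show "R (x + y) = R x + R y" for x y
      by (rule cinner_ext_right) (simp add: cinner_add_right flip: R)
    show "R (r *\<^sub>R y) = r *\<^sub>R R y" for r y
      by (simp add: scaleR_scaleC lin)
    show "norm (R y) \<le> norm y * norm T" for y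
      using bound[of y] by (simp add: mult.commute)
  qed
  then have app: "blinfun_apply (Blinfun R) = R"
    by (rule bounded_linear_Blinfun_apply)
  show ?thesis
    using bound by (intro exI[of _ "Blinfun R"])
      (auto simp: app R bounded_ops_UNIV_iff lin intro!: norm_blinfun_bound)
qed

lemma adj_eqI:
  fixes T R :: "'a::complex_hilbert \<Rightarrow>\<^sub>L 'a"
  assumes "R \<in> bounded_ops UNIV" "\<And>x y. cinner (T x) y = cinner x (R y)"
  shows "adj T = R"
  unfolding adj_def
proof (rule the_equality)
  fix R'
  assume R': "R' \<in> bounded_ops UNIV \<and> (\<forall>x y. cinner (T x) y = cinner x (R' y))"
  show "R' = R"
    by (rule blinfun_eqI, rule cinner_ext_right) (use R' assms(2) in metis)
qed (use assms in auto)

lemma adj_bounded_ops: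
  fixes T :: "'a::complex_hilbert \<Rightarrow>\<^sub>L 'a"
  assumes "T \<in> bounded_ops UNIV"
  shows adj_mem_bounded_ops: "adj T \<in> bounded_ops UNIV"
    and cinner_adj_right: "cinner x (adj T y) = cinner (T x) y"
    and cinner_adj_left: "cinner (adj T x) y = cinner x (T y)"
    and norm_adj_le: "norm (adj T) \<le> norm T"
proof -
  obtain R where R: "R \<in> bounded_ops UNIV" "\<And>x y. cinner (T x) y = cinner x (R y)" "norm R \<le> norm T"
    using adjoint_exists[OF assms] by blast
  then have eq: "adj T = R"
    by (intro adj_eqI)
  then show "norm (adj T) \<le> norm T"
    using R(3) by simp
  from eq show "adj T \<in> bounded_ops UNIV" and r: "cinner x (adj T y) = cinner (T x) y" for x y
    using R(1,2) by auto
  then show "cinner (adj T x) y = cinner x (T y)"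
    using cinner_commute by metis
qed

lemma scaleC_blinfun_apply [simp]: "(c *\<^sub>C T) x = c *\<^sub>C T x"
  for T :: "'a::real_normed_vector \<Rightarrow>\<^sub>L 'b::complex_hilbert"
  by (simp add: scaleC_blinfun.rep_eq)

lemma scaleR_scaleC_blinfun: "r *\<^sub>R T = complex_of_real r *\<^sub>C T"
  for T :: "'a::real_normed_vector \<Rightarrow>\<^sub>L 'b::complex_hilbert"
  by (rule blinfun_eqI) (simp add: blinfun.scaleR_left scaleR_scaleC)

lemma bounded_ops_UNIV_closure:
  fixes a b :: "'a::complex_hilbert \<Rightarrow>\<^sub>L 'a"
  assumes "a \<in> bounded_ops UNIV"
  shows "c *\<^sub>C a \<in> bounded_ops UNIV" "b \<in> bounded_ops UNIV \<Longrightarrow> a + b \<in> bounded_ops UNIV"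
    "b \<in> bounded_ops UNIV \<Longrightarrow> a - b \<in> bounded_ops UNIV"
    "b \<in> bounded_ops UNIV \<Longrightarrow> a o\<^sub>L b \<in> bounded_ops UNIV"
  using assms
  by (auto simp: bounded_ops_UNIV_iff blinfun.add_left blinfun.diff_left scaleC_add_right
      scaleC.diff_right scaleC_scaleC mult.commute)

lemma zero_mem_bounded_ops [simp]: "closed_csubspace H \<Longrightarrow> 0 \<in> bounded_ops H"
  by (simp add: bounded_ops_def closed_csubspace_def scaleC.zero_right)

lemma adj_simps:
  fixes a b :: "'a::complex_hilbert \<Rightarrow>\<^sub>L 'a"
  assumes a: "a \<in> bounded_ops UNIV"
  shows adj_add: "b \<in> bounded_ops UNIV \<Longrightarrow> adj (a + b) = adj a + adj b"
    and adj_diff: "b \<in> bounded_ops UNIV \<Longrightarrow> adj (a - b) = adj a - adj b"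
    and adj_scaleC: "adj (c *\<^sub>C a) = cnj c *\<^sub>C adj a"
    and adj_compose: "b \<in> bounded_ops UNIV \<Longrightarrow> adj (a o\<^sub>L b) = adj b o\<^sub>L adj a"
    and adj_adj: "adj (adj a) = a"
  by (rule adj_eqI;
      simp add: bounded_ops_UNIV_closure a adj_mem_bounded_ops cinner_adj_right cinner_adj_left[OF a]
        blinfun.add_left blinfun.diff_left cinner_add_left cinner_add_right cinner.diff_left
        cinner.diff_right cinner_scaleC_left cinner_scaleC_right)+

lemma adj_zero [simp]: "adj 0 = (0 :: 'a::complex_hilbert \<Rightarrow>\<^sub>L 'a)"
  by (rule adj_eqI) (simp_all add: cinner.zero_left cinner.zero_right)

lemma norm_adj:
  fixes T :: "'a::complex_hilbert \<Rightarrow>\<^sub>L 'a"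
  assumes "T \<in> bounded_ops UNIV"
  shows "norm (adj T) = norm T"
  using norm_adj_le[OF assms] norm_adj_le[OF adj_mem_bounded_ops[OF assms]] by (simp add: adj_adj assms)

lemma norm_adj_diff:
  fixes a b :: "'a::complex_hilbert \<Rightarrow>\<^sub>L 'a"
  assumes "a \<in> bounded_ops UNIV" "b \<in> bounded_ops UNIV"
  shows "norm (adj a - adj b) = norm (a - b)"
  unfolding adj_diff[OF assms, symmetric] by (rule norm_adj) (rule bounded_ops_UNIV_closure(3)[OF assms])

lemma closed_bounded_ops:
  fixes H :: "'a::complex_hilbert set"
  assumes H: "closed_csubspace H"
  shows "closed (bounded_ops H)"
proof -
  have "bounded_ops H = (\<Inter>c. \<Inter>x. {T :: 'a \<Rightarrow>\<^sub>L 'a. T (c *\<^sub>C x) = c *\<^sub>C T x})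
      \<inter> (\<Inter>x. {T :: 'a \<Rightarrow>\<^sub>L 'a. T x \<in> H})
      \<inter> (\<Inter>x\<in>{x. \<forall>h\<in>H. cinner x h = 0}. {T :: 'a \<Rightarrow>\<^sub>L 'a. T x = 0})"
    by (auto simp: bounded_ops_def)
  moreover have "closed {T :: 'a \<Rightarrow>\<^sub>L 'a. T (c *\<^sub>C x) = c *\<^sub>C T x}" for c x
    by (intro closed_Collect_eq scaleC.continuous_on continuous_intros)
  moreover have "closed {T :: 'a \<Rightarrow>\<^sub>L 'a. T x \<in> H}" for x
    using continuous_closed_vimage[OF closed_csubspaceD(4)[OF H], of "\<lambda>T :: 'a \<Rightarrow>\<^sub>L 'a. T x"]
    by (simp add: vimage_def bounded_linear.isCont[OF blinfun.bounded_linear_left])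
  moreover have "closed {T :: 'a \<Rightarrow>\<^sub>L 'a. T x = 0}" for x
    by (intro closed_Collect_eq continuous_intros)
  ultimately show ?thesis
    by (simp add: closed_INT closed_Int)
qed

text \<open>Adjunction exchanges the two conditions on an operator of \<open>H\<close>: the adjoint
  maps into \<open>H\<close> because \<open>T\<close> kills the orthogonal complement, and it kills
  the complement because \<open>T\<close> maps into \<open>H\<close>.\<close>

lemma adj_mem_bounded_ops_subspace:
  assumes H: "closed_csubspace H" and T: "T \<in> bounded_ops H"
  shows "adj T \<in> bounded_ops H"
proof -
  have T': "T \<in> bounded_ops UNIV"
    using T bounded_ops_subset_UNIV by blast
  have "adj T x \<in> H" for x
    by (rule mem_csubspace_if_orthogonal[OF H])
      (simp add: cinner_adj_left[OF T'] bounded_opsD(3)[OF T] cinner.zero_right)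
  moreover have "adj T x = 0" if "\<forall>h\<in>H. cinner x h = 0" for x
  proof -
    have "cinner (adj T x) (adj T x) = cinner x (T (adj T x))"
      by (rule cinner_adj_left[OF T'])
    also have "\<dots> = 0"
      using that bounded_opsD(2)[OF T] by blast
    finally show ?thesis
      by (simp add: cinner_self_eq_0)
  qed
  ultimately show ?thesis
    using adj_mem_bounded_ops[OF T'] by (auto simp: bounded_ops_def)
qed

lemma cstar_algebra_bounded_ops:
  assumes H: "closed_csubspace H"
  shows "cstar_algebra (bounded_ops H)"
  unfolding cstar_algebra_def
proof (intro conjI ballI allI)
  fix a b :: "'a \<Rightarrow>\<^sub>L 'a" and c
  assume a: "a \<in> bounded_ops H"
  show "c *\<^sub>C a \<in> bounded_ops H"
    using a closed_csubspaceD[OF H]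
    by (auto simp: bounded_ops_def scaleC_scaleC mult.commute scaleC.zero_right)
  show "adj a \<in> bounded_ops H"
    by (rule adj_mem_bounded_ops_subspace[OF H a])
  assume b: "b \<in> bounded_ops H"
  show "a + b \<in> bounded_ops H"
    using a b closed_csubspaceD[OF H]
    by (auto simp: bounded_ops_def blinfun.add_left scaleC_add_right)
  show "a o\<^sub>L b \<in> bounded_ops H"
    using a b by (auto simp: bounded_ops_def blinfun.zero_right)
qed (use H bounded_ops_subset_UNIV closed_bounded_ops in auto)

lemma id_op_exists:
  fixes H :: "'a::complex_hilbert set"
  assumes H: "closed_csubspace H"
  shows "\<exists>P. P \<in> bounded_ops H \<and> (\<forall>x\<in>H. P x = x) \<and> (\<forall>x. \<forall>h\<in>H. cinner (x - P x) h = 0) \<and>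
    (\<forall>x. norm (P x) \<le> norm x)"
proof -
  note HD = closed_csubspaceD[OF H]
  obtain P where P: "\<And>x. P x \<in> H" "\<And>x h. h \<in> H \<Longrightarrow> cinner (x - P x) h = 0"
    using projection_exists[OF H] by metis
  have uniq: "P x = p" if "p \<in> H" "\<And>h. h \<in> H \<Longrightarrow> cinner (x - p) h = 0" for x p
  proof -
    have "P x - p \<in> H"
      using P(1) that(1) HD by blast
    then have "cinner (x - p) (P x - p) - cinner (x - P x) (P x - p) = 0"
      using that(2) P(2) by simp
    then have "cinner (P x - p) (P x - p) = 0"
      by (simp add: cinner.diff_left)
    then show ?thesis
      by (simp add: cinner_self_eq_0)
  qed
  have scale: "P (c *\<^sub>C x) = c *\<^sub>C P x" for c x
    using HD P by (intro uniq) (auto simp: cinner_scaleC_left simp flip: scaleC.diff_right)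
  have norm_le: "norm (P x) \<le> norm x" for x
  proof -
    have "(norm (P x + (x - P x)))\<^sup>2 = (norm (P x))\<^sup>2 + (norm (x - P x))\<^sup>2"
      by (rule norm_add_orthogonal_square) (metis P cinner_commute complex_cnj_zero)
    then have "(norm (P x))\<^sup>2 \<le> (norm x)\<^sup>2"
      by simp
    then show ?thesis
      by (simp add: power2_le_iff_abs_le)
  qed
  have "bounded_linear P"
  proof (rule bounded_linear_intro)
    show "P (x + y) = P x + P y" for x y
    proof (rule uniq)
      show "cinner (x + y - (P x + P y)) h = 0" if "h \<in> H" for h
        using P(2)[OF that, of x] P(2)[OF that, of y]
        by (simp add: cinner.diff_left cinner_add_left)
    qed (use HD P in auto)
    show "P (r *\<^sub>R x) = r *\<^sub>R P x" for r x
      by (simp add: scaleR_scaleC scale)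
    show "norm (P x) \<le> norm x * 1" for x
      by (simp add: norm_le)
  qed
  then have app: "blinfun_apply (Blinfun P) = P"
    by (rule bounded_linear_Blinfun_apply)
  have "Blinfun P \<in> bounded_ops H"
    by (auto simp: bounded_ops_def app scale P intro!: uniq HD)
  moreover have "\<forall>x\<in>H. Blinfun P x = x"
    by (auto simp: app cinner.zero_left intro!: uniq)
  ultimately show ?thesis
    using P(2) norm_le by (intro exI[of _ "Blinfun P"]) (simp add: app)
qed

lemma id_op_eqI:
  fixes P :: "'a::complex_hilbert \<Rightarrow>\<^sub>L 'a"
  assumes H: "closed_csubspace H" and P: "P \<in> bounded_ops H" "\<And>x. x \<in> H \<Longrightarrow> P x = x"
  shows "id_op H = P"
  unfolding id_op_def
proof (rule the_equality, use P in blast, rule blinfun_eqI)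
  fix R x
  assume R: "R \<in> bounded_ops H \<and> (\<forall>x\<in>H. R x = x)"
  obtain p where p: "p \<in> H" "\<forall>h\<in>H. cinner (x - p) h = 0"
    using projection_exists[OF H] by blast
  have "P (x - p) = 0" "R (x - p) = 0"
    using p(2) P(1) R by (auto intro: bounded_opsD(3))
  then show "R x = P x"
    using p(1) P(2) R by (simp add: blinfun.diff_right)
qed

lemma id_op:
  assumes H: "closed_csubspace H"
  shows id_op_mem_bounded_ops: "id_op H \<in> bounded_ops H"
    and id_op_apply: "x \<in> H \<Longrightarrow> id_op H x = x"
    and id_op_compose_right: "T \<in> bounded_ops H \<Longrightarrow> T o\<^sub>L id_op H = T"
    and norm_id_op_le: "norm (id_op H y) \<le> norm y"
proof -
  obtain P where P: "P \<in> bounded_ops H" "\<And>x. x \<in> H \<Longrightarrow> P x = x"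
      "\<And>x h. h \<in> H \<Longrightarrow> cinner (x - P x) h = 0" "\<And>x. norm (P x) \<le> norm x"
    using id_op_exists[OF H] by blast
  have eq: "id_op H = P"
    by (rule id_op_eqI[OF H P(1,2)])
  show "id_op H \<in> bounded_ops H" "x \<in> H \<Longrightarrow> id_op H x = x" "norm (id_op H y) \<le> norm y"
    using P by (auto simp: eq)
  show "T o\<^sub>L id_op H = T" if T: "T \<in> bounded_ops H"
  proof (rule blinfun_eqI)
    fix x
    have "T (x - P x) = 0"
      using P(3) by (rule bounded_opsD(3)[OF T])
    then show "(T o\<^sub>L id_op H) x = T x"
      by (simp add: eq blinfun.diff_right)
  qed
qed

section \<open>Homomorphisms of C*-algebras\<close>

interpretation blinfun_compose: bounded_bilinear
  "blinfun_compose :: ('b::real_normed_vector \<Rightarrow>\<^sub>L 'c::real_normed_vector) \<Rightarrow>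
    ('a::real_normed_vector \<Rightarrow>\<^sub>L 'b) \<Rightarrow> 'a \<Rightarrow>\<^sub>L 'c"
  by (rule bounded_bilinear_blinfun_compose)

lemma cstar_algebraD:
  assumes "cstar_algebra A"
  shows "A \<subseteq> bounded_ops UNIV" "0 \<in> A" "a \<in> A \<Longrightarrow> b \<in> A \<Longrightarrow> a + b \<in> A" "a \<in> A \<Longrightarrow> c *\<^sub>C a \<in> A"
    "a \<in> A \<Longrightarrow> b \<in> A \<Longrightarrow> a o\<^sub>L b \<in> A" "a \<in> A \<Longrightarrow> adj a \<in> A" "closed A"
    "a \<in> A \<Longrightarrow> b \<in> A \<Longrightarrow> a - b \<in> A" "a \<in> A \<Longrightarrow> r *\<^sub>R a \<in> A"
proof -
  have scaleR: "r *\<^sub>R a \<in> A" if "a \<in> A" for r a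
    using assms that by (simp add: cstar_algebra_def scaleR_scaleC_blinfun)
  then show "a \<in> A \<Longrightarrow> r *\<^sub>R a \<in> A" .
  show "a - b \<in> A" if "a \<in> A" "b \<in> A"
  proof -
    have "a + (-1) *\<^sub>R b \<in> A"
      using assms that scaleR unfolding cstar_algebra_def by blast
    then show ?thesis
      by simp
  qed
qed (use assms in \<open>auto simp: cstar_algebra_def\<close>)

lemma star_homD:
  assumes A: "cstar_algebra A" and \<phi>: "star_hom A B \<phi>"
  shows "a \<in> A \<Longrightarrow> \<phi> a \<in> B" "a \<in> A \<Longrightarrow> b \<in> A \<Longrightarrow> \<phi> (a + b) = \<phi> a + \<phi> b"
    "a \<in> A \<Longrightarrow> \<phi> (c *\<^sub>C a) = c *\<^sub>C \<phi> a" "a \<in> A \<Longrightarrow> b \<in> A \<Longrightarrow> \<phi> (a o\<^sub>L b) = \<phi> a o\<^sub>L \<phi> b"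
    "a \<in> A \<Longrightarrow> \<phi> (adj a) = adj (\<phi> a)" "\<phi> 0 = 0"
    "a \<in> A \<Longrightarrow> \<phi> (r *\<^sub>R a) = r *\<^sub>R \<phi> a" "a \<in> A \<Longrightarrow> b \<in> A \<Longrightarrow> \<phi> (a - b) = \<phi> a - \<phi> b"
proof -
  note AD = cstar_algebraD[OF A]
  have scaleR: "\<phi> (r *\<^sub>R a) = r *\<^sub>R \<phi> a" if "a \<in> A" for r a
    using \<phi> that by (simp add: star_hom_def scaleR_scaleC_blinfun)
  then show "a \<in> A \<Longrightarrow> \<phi> (r *\<^sub>R a) = r *\<^sub>R \<phi> a" .
  show "\<phi> 0 = 0"
    using scaleR[OF AD(2), of 0] by simp
  show "\<phi> (a - b) = \<phi> a - \<phi> b" if "a \<in> A" "b \<in> A"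
  proof -
    have "\<phi> (a + (-1) *\<^sub>R b) = \<phi> a + (-1) *\<^sub>R \<phi> b"
      using \<phi> that AD(9) scaleR unfolding star_hom_def by metis
    then show ?thesis
      by simp
  qed
qed (use \<phi> in \<open>auto simp: star_hom_def\<close>)

lemma cstar_algebra_sum:
  assumes A: "cstar_algebra A" and f: "\<And>i. i \<in> I \<Longrightarrow> f i \<in> A"
  shows "(\<Sum>i\<in>I. f i) \<in> A"
  using f by (induction I rule: infinite_finite_induct) (auto intro: cstar_algebraD[OF A])

lemma star_hom_sum:
  assumes A: "cstar_algebra A" and \<phi>: "star_hom A B \<phi>" and f: "\<And>i. i \<in> I \<Longrightarrow> f i \<in> A"
  shows "\<phi> (\<Sum>i\<in>I. f i) = (\<Sum>i\<in>I. \<phi> (f i))"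
  using f by (induction I rule: infinite_finite_induct)
    (simp_all add: star_homD[OF A \<phi>] cstar_algebra_sum[OF A])

text \<open>A hull is an intersection, and it consists of complex linear operators as soon as some
  C*-algebra contains \<open>G\<close>; by hypothesis \<open>bounded_ops UNIV\<close> is
  one.\<close>

lemma cstar_algebra_hull:
  assumes "G \<subseteq> bounded_ops UNIV"
  shows "cstar_algebra (cstar_algebra hull G)"
  unfolding cstar_algebra_def[of "_ hull _"]
proof (intro conjI ballI allI)
  show "cstar_algebra hull G \<subseteq> bounded_ops UNIV"
    using assms cstar_algebra_bounded_ops[OF closed_csubspace_UNIV] by (rule hull_minimal)
  show "closed (cstar_algebra hull G)"
    unfolding hull_def by (auto intro: closed_Inter cstar_algebraD)
qed (auto simp: hull_def intro: cstar_algebraD)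

text \<open>If \<open>norm a < 1\<close>, then \<open>1 - a\<^sup>* a\<close> is the square of \<open>1 - y\<close> for a selfadjoint \<open>y\<close> in the
  algebra, the fixed point of \<open>y \<mapsto> (a\<^sup>* a + y\<^sup>2) / 2\<close>; so its image is positive.\<close>

lemma star_hom_norm_le_1:
  assumes A: "cstar_algebra A" and \<phi>: "star_hom A B \<phi>" and B: "B \<subseteq> bounded_ops UNIV"
    and a: "a \<in> A" "norm a < 1"
  shows "norm (\<phi> a) \<le> 1"
proof -
  note AD = cstar_algebraD[OF A] and hom = star_homD[OF A \<phi>]
  have AB: "b \<in> A \<Longrightarrow> b \<in> bounded_ops UNIV" "b \<in> A \<Longrightarrow> \<phi> b \<in> bounded_ops UNIV" for b
    using AD(1) B hom(1) by auto
  define x where "x = adj a o\<^sub>L a"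
  define q where "q = (norm a)\<^sup>2"
  have q: "0 \<le> q" "q < 1"
    using a(2) by (auto simp: q_def power_less_one_iff)
  have xA: "x \<in> A"
    using a AD by (simp add: x_def)
  have nx: "norm x \<le> q"
    unfolding x_def q_def power2_eq_square
    by (rule order_trans[OF norm_blinfun_compose]) (simp add: norm_adj AB a)
  \<comment> \<open>On the ball of radius \<open>q < 1\<close> the map \<open>f\<close> is a
    contraction with constant \<open>q\<close>, and it keeps the ball since (q + q^2) / 2 \<le> q.
    Selfadjointness is expressed by inner products, which makes it a closed condition.\<close>
  define s where "s = {y \<in> A. (\<forall>u v. cinner (y u) v = cinner u (y v)) \<and> norm y \<le> q}"
  define f where "f y = (1/2) *\<^sub>R (x + (y o\<^sub>L y))" for y
  have "closed {y :: 'a \<Rightarrow>\<^sub>L 'a. \<forall>u v. cinner (y u) v = cinner u (y v)}"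
    by (intro closed_Collect_all closed_Collect_eq cinner.continuous_on continuous_intros)
  moreover have "closed {y :: 'a \<Rightarrow>\<^sub>L 'a. norm y \<le> q}"
    by (intro closed_Collect_le continuous_intros)
  moreover have "s = A \<inter> {y :: 'a \<Rightarrow>\<^sub>L 'a. \<forall>u v. cinner (y u) v = cinner u (y v)} \<inter> {y. norm y \<le> q}"
    by (auto simp: s_def)
  ultimately have "complete s"
    using AD(7) by (simp add: complete_eq_closed closed_Int)
  moreover have "s \<noteq> {}"
    using AD(2) q by (auto simp: s_def cinner.zero_left cinner.zero_right intro!: exI[of _ 0])
  moreover have "f ` s \<subseteq> s"
  proof (intro image_subsetI)
    fix y
    assume "y \<in> s"
    then have y: "y \<in> A" "\<And>u v. cinner (y u) v = cinner u (y v)" "norm y \<le> q"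
      by (auto simp: s_def)
    have "norm (y o\<^sub>L y) \<le> q * q"
      using y(3) q by (intro order_trans[OF norm_blinfun_compose] mult_mono) auto
    also have "\<dots> \<le> q"
      using q by (simp add: mult_left_le)
    finally have "norm (x + (y o\<^sub>L y)) \<le> q + q"
      using nx by (rule norm_triangle_mono[rotated])
    moreover have "cinner (f y u) v = cinner u (f y v)" for u v
      by (simp add: f_def x_def blinfun.scaleR_left blinfun.add_left cinner.scaleR_left
          cinner.scaleR_right cinner_add_left cinner_add_right cinner_adj_left cinner_adj_right
          AB a y(2))
    ultimately show "f y \<in> s"
      using xA y(1) AD by (simp add: s_def f_def)
  qed
  moreover have "\<forall>y\<in>s. \<forall>z\<in>s. dist (f y) (f z) \<le> q * dist y z"
  proof (intro ballI)
    fix y z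
    assume "y \<in> s" "z \<in> s"
    then have yz: "norm y \<le> q" "norm z \<le> q"
      by (auto simp: s_def)
    have "f y - f z = (1/2) *\<^sub>R ((y o\<^sub>L (y - z)) + ((y - z) o\<^sub>L z))"
      by (simp add: f_def blinfun_compose.diff_left blinfun_compose.diff_right algebra_simps)
    then have "norm (f y - f z) \<le> (1/2) * (norm (y o\<^sub>L (y - z)) + norm ((y - z) o\<^sub>L z))"
      by (simp add: norm_triangle_ineq)
    also have "\<dots> \<le> (1/2) * (norm y * norm (y - z) + norm (y - z) * norm z)"
      by (intro mult_left_mono add_mono norm_blinfun_compose) auto
    also have "\<dots> \<le> (1/2) * (q * norm (y - z) + norm (y - z) * q)"
      using yz by (intro mult_left_mono add_mono mult_right_mono) auto
    finally show "dist (f y) (f z) \<le> q * dist y z"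
      by (simp add: dist_norm mult.commute)
  qed
  ultimately have "\<exists>!y. y \<in> s \<and> f y = y"
    using q by (intro Banach_fix) auto
  then obtain y where y: "y \<in> A" "\<And>u v. cinner (y u) v = cinner u (y v)" "f y = y"
    by (auto simp: s_def)
  have "adj y = y"
    using y AB by (intro adj_eqI) auto
  then have sa: "cinner (\<phi> y u) v = cinner u (\<phi> y v)" for u v
    using hom(5)[OF y(1)] cinner_adj_left[OF AB(2)[OF y(1)]] by metis
  have \<phi>x: "\<phi> x = adj (\<phi> a) o\<^sub>L \<phi> a"
    using a AD hom by (simp add: x_def)
  have "\<phi> (f y) = (1/2) *\<^sub>R (\<phi> x + (\<phi> y o\<^sub>L \<phi> y))"
    using xA y(1) AD hom by (simp add: f_def)
  then have \<phi>y: "\<phi> y = (1/2) *\<^sub>R (\<phi> x + (\<phi> y o\<^sub>L \<phi> y))"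
    by (simp add: y(3))
  \<comment> \<open>The fixed point equation says that the square of \<open>1 - \<phi> y\<close> is
    \<open>1\<close> minus the adjoint of \<open>\<phi> a\<close> times \<open>\<phi> a\<close>. It
    is evaluated at vectors, since the algebras may lack the identity.\<close>
  have "norm (\<phi> a v) \<le> 1 * norm v" for v
  proof -
    have "cinner v (\<phi> y v) = (1/2) * (cinner v (\<phi> x v) + cinner v (\<phi> y (\<phi> y v)))"
      by (subst \<phi>y) (simp add: blinfun.scaleR_left blinfun.add_left cinner.scaleR_right
          cinner_add_right scaleR_conv_of_real)
    also have "cinner v (\<phi> x v) = cinner (\<phi> a v) (\<phi> a v)"
      by (simp add: \<phi>x cinner_adj_right AB a)
    also have "cinner v (\<phi> y (\<phi> y v)) = cinner (\<phi> y v) (\<phi> y v)"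
      by (simp add: sa)
    finally have "cinner v (\<phi> y v) = complex_of_real (((norm (\<phi> a v))\<^sup>2 + (norm (\<phi> y v))\<^sup>2) / 2)"
      by (simp add: cinner_self)
    then have "2 * Re (cinner v (\<phi> y v)) = (norm (\<phi> a v))\<^sup>2 + (norm (\<phi> y v))\<^sup>2"
      by (simp del: of_real_power of_real_add of_real_divide)
    then have "(norm (v - \<phi> y v))\<^sup>2 = (norm v)\<^sup>2 - (norm (\<phi> a v))\<^sup>2"
      by (simp add: norm_diff_square)
    then have "(norm (\<phi> a v))\<^sup>2 \<le> (norm v)\<^sup>2"
      by (smt (verit) zero_le_power2)
    then show ?thesis
      by (simp add: power2_le_iff_abs_le)
  qed
  then show ?thesis
    by (intro norm_blinfun_bound) auto
qed

text \<open>Dividing by an arbitrary \<open>t > norm a\<close> produces the strict inequality on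
  which the fixed point argument depends.\<close>

lemma star_hom_contractive:
  assumes A: "cstar_algebra A" and \<phi>: "star_hom A B \<phi>" and B: "B \<subseteq> bounded_ops UNIV"
    and a: "a \<in> A"
  shows "norm (\<phi> a) \<le> norm a"
proof (rule dense_ge)
  fix t
  assume t: "norm a < t"
  then have "0 < t"
    by (rule order_le_less_trans[rotated]) simp
  then have "norm (\<phi> ((1/t) *\<^sub>R a)) \<le> 1"
    using t a by (intro star_hom_norm_le_1[OF A \<phi> B] cstar_algebraD(9)[OF A]) auto
  then show "norm (\<phi> a) \<le> t"
    using \<open>0 < t\<close> a by (simp add: star_homD(7)[OF A \<phi>])
qed

section \<open>Continuity and closed range of homomorphisms\<close>

lemma star_hom_tendsto:
  assumes A: "cstar_algebra A" and \<phi>: "star_hom A B \<phi>" and B: "B \<subseteq> bounded_ops UNIV"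
    and u: "\<And>m. u m \<in> A" "u \<longlonglongrightarrow> l"
  shows "l \<in> A" "(\<lambda>m. \<phi> (u m)) \<longlonglongrightarrow> \<phi> l"
proof -
  show l: "l \<in> A"
    by (rule closed_sequentially[OF cstar_algebraD(7)[OF A] u])
  show "(\<lambda>m. \<phi> (u m)) \<longlonglongrightarrow> \<phi> l"
  proof (rule Lim_transform_bound[OF eventuallyI, THEN LIM_zero_cancel])
    show "norm (\<phi> (u m) - \<phi> l) \<le> norm (u m - l)" for m
      using star_hom_contractive[OF A \<phi> B cstar_algebraD(8)[OF A u(1) l]]
      by (simp add: star_homD(8)[OF A \<phi> u(1) l])
    show "(\<lambda>m. u m - l) \<longlonglongrightarrow> 0"
      using u(2) by (rule LIM_zero)
  qed
qed

text \<open>The positive operator \<open>a o\<^sub>L adj a\<close> lies between 0 and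
  \<open>r\<close>, hence so does \<open>r\<close> minus it. Expanding the square proves this
  without spectral theory. It supplies the contraction constant \<open>r / (1 + r)\<close> for
  solving y + a a* y = a.\<close>

lemma norm_id_minus_compose_adj_le:
  fixes a :: "'a::complex_hilbert \<Rightarrow>\<^sub>L 'a"
  assumes a: "a \<in> bounded_ops UNIV" and r: "(norm a)\<^sup>2 \<le> r"
  shows "norm (r *\<^sub>R x - a (adj a x)) \<le> r * norm x"
proof -
  have r0: "0 \<le> r"
    using r by (rule order_trans[rotated]) simp
  have "(norm (a (adj a x)))\<^sup>2 \<le> (norm a * norm (adj a x))\<^sup>2"
    by (intro power_mono norm_blinfun) simp
  also have "\<dots> \<le> r * (norm (adj a x))\<^sup>2"
    using r by (simp add: power_mult_distrib mult_right_mono)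
  finally have le: "(norm (a (adj a x)))\<^sup>2 \<le> r * (norm (adj a x))\<^sup>2" .
  have "cinner x (a (adj a x)) = cinner (adj a x) (adj a x)"
    using cinner_adj_left[OF a] by simp
  then have "(norm (r *\<^sub>R x - a (adj a x)))\<^sup>2
      = r\<^sup>2 * (norm x)\<^sup>2 + (norm (a (adj a x)))\<^sup>2 - 2 * r * (norm (adj a x))\<^sup>2"
    by (simp add: norm_diff_square power_mult_distrib cinner.scaleR_left cinner_self)
  also have "\<dots> \<le> r\<^sup>2 * (norm x)\<^sup>2"
    using le mult_nonneg_nonneg[OF r0 zero_le_power2[of "norm (adj a x)"]] by linarith
  finally show ?thesis
    using r0 by (simp add: power2_le_iff_abs_le flip: power_mult_distrib)
qed

text \<open>The element \<open>y = (1 + a a\<^sup>*)\<^sup>-\<^sup>1 a\<close> has norm at most \<open>1/2\<close>, whatever the norm of \<open>a\<close>, and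
  \<open>\<phi> a - \<phi> y = \<phi> a (\<phi> a)\<^sup>* \<phi> y\<close>.\<close>

lemma star_hom_approximate_lift:
  assumes A: "cstar_algebra A" and \<phi>: "star_hom A B \<phi>" and B: "B \<subseteq> bounded_ops UNIV"
    and a: "a \<in> A" "norm (\<phi> a) \<le> 1"
  shows "\<exists>y\<in>A. norm y \<le> 1/2 \<and> norm (\<phi> a - \<phi> y) \<le> 1/2"
proof -
  note AD = cstar_algebraD[OF A] and hom = star_homD[OF A \<phi>]
  have a': "a \<in> bounded_ops UNIV" "\<phi> a \<in> bounded_ops UNIV"
    using AD(1) B hom(1) a by auto
  define r where "r = (norm a)\<^sup>2"
  \<comment> \<open>A damped iteration for y + a a* y = a: the step size \<open>1 / (1 + r)\<close>
    turns the linear part into \<open>r - a a*\<close> divided by \<open>1 + r\<close>, which is a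
    contraction however large \<open>norm a\<close> is.\<close>
  define f where "f y = y - (1 / (1 + r)) *\<^sub>R (y + (a o\<^sub>L (adj a o\<^sub>L y)) - a)" for y
  have r: "0 \<le> r"
    by (simp add: r_def)
  have lip: "dist (f y) (f z) \<le> (r / (1 + r)) * dist y z" for y z
  proof -
    define d where "d = y - z"
    have "f y - f z = d - (1 / (1 + r)) *\<^sub>R (d + (a o\<^sub>L (adj a o\<^sub>L d)))"
      by (simp add: f_def d_def blinfun_compose.diff_right algebra_simps)
    also have "\<dots> = (1 / (1 + r)) *\<^sub>R ((1 + r) *\<^sub>R d - (d + (a o\<^sub>L (adj a o\<^sub>L d))))"
      unfolding scaleR_diff_right using r by simp
    finally have eq: "f y - f z = (1 / (1 + r)) *\<^sub>R (r *\<^sub>R d - (a o\<^sub>L (adj a o\<^sub>L d)))"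
      by (simp add: scaleR_add_left)
    have "norm (r *\<^sub>R d - (a o\<^sub>L (adj a o\<^sub>L d))) \<le> r * norm d"
    proof (rule norm_blinfun_bound)
      fix x
      have "norm (r *\<^sub>R d x - a (adj a (d x))) \<le> r * norm (d x)"
        by (rule norm_id_minus_compose_adj_le) (simp_all add: a' r_def)
      also have "\<dots> \<le> r * (norm d * norm x)"
        using r by (intro mult_left_mono norm_blinfun)
      finally show "norm ((r *\<^sub>R d - (a o\<^sub>L (adj a o\<^sub>L d))) x) \<le> r * norm d * norm x"
        by (simp add: blinfun.diff_left blinfun.scaleR_left mult.assoc)
    qed (simp add: r)
    then show ?thesis
      using r by (simp add: dist_norm eq d_def[symmetric] divide_right_mono)
  qed
  have "\<exists>!y. y \<in> A \<and> f y = y"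
  proof (rule Banach_fix) 
    show "complete A" "A \<noteq> {}"
      using AD(2,7) by (auto simp: complete_eq_closed)
    show "f ` A \<subseteq> A"
      unfolding f_def using a(1) by (intro image_subsetI AD)
    show "0 \<le> r / (1 + r)" "r / (1 + r) < 1"
      using r by auto
  qed (use lip in auto)
  then obtain y where y: "y \<in> A" "f y = y"
    by blast
  then have "(1 / (1 + r)) *\<^sub>R (y + (a o\<^sub>L (adj a o\<^sub>L y)) - a) = 0"
    by (simp add: f_def)
  then have ya: "y + (a o\<^sub>L (adj a o\<^sub>L y)) = a"
    using r by simp
  have "norm y \<le> 1/2"
  proof (rule norm_blinfun_bound)
    fix x
    \<comment> \<open>The scalar model is t / (1 + t^2) \<le> 1/2. Pairing the equation for
      \<open>y\<close> with \<open>v\<close> gives |v|^2 + |t|^2 \<le> |x| |t|, and completing the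
      square in |t| leaves 2 |v| \<le> |x|.\<close>
    define v where "v = y x"
    define t where "t = adj a v"
    have "cinner (v + a t) v = cinner (a x) v"
      using arg_cong[OF ya, of "\<lambda>T. T x"] by (simp add: v_def t_def blinfun.add_left)
    moreover have "cinner (a t) v = cinner t t" "cinner (a x) v = cinner x t"
      by (simp_all add: t_def cinner_adj_right a')
    ultimately have "(norm v)\<^sup>2 + (norm t)\<^sup>2 = Re (cinner x t)"
      by (simp add: cinner_add_left cinner_self complex_eq_iff)
    also have "\<dots> \<le> norm x * norm t"
      using complex_Re_le_cmod cmod_cinner_le order_trans by blast
    finally have "(2 * norm v)\<^sup>2 \<le> (norm x)\<^sup>2 - (norm x - 2 * norm t)\<^sup>2"
      by (simp add: power2_diff power_mult_distrib)
    also have "\<dots> \<le> (norm x)\<^sup>2"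
      by simp
    finally have "2 * norm v \<le> norm x"
      by (rule power2_le_imp_le) simp
    then show "norm (y x) \<le> 1/2 * norm x"
      by (simp add: v_def)
  qed simp
  moreover have "norm (\<phi> a - \<phi> y) \<le> 1/2"
  proof -
    have "\<phi> (y + (a o\<^sub>L (adj a o\<^sub>L y))) = \<phi> y + (\<phi> a o\<^sub>L (adj (\<phi> a) o\<^sub>L \<phi> y))"
      using a(1) y(1) AD hom by simp
    then have "\<phi> a - \<phi> y = \<phi> a o\<^sub>L (adj (\<phi> a) o\<^sub>L \<phi> y)"
      unfolding ya by (metis add_diff_cancel_left')
    then have "norm (\<phi> a - \<phi> y) \<le> norm (\<phi> a) * (norm (adj (\<phi> a)) * norm (\<phi> y))"
      by (auto intro!: order_trans[OF norm_blinfun_compose] mult_left_mono norm_blinfun_compose)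
    also have "\<dots> \<le> 1 * (1 * (1/2))"
      using a(2) a'(2) star_hom_contractive[OF A \<phi> B y(1)] \<open>norm y \<le> 1/2\<close>
      by (intro mult_mono) (auto simp: norm_adj)
    finally show ?thesis
      by simp
  qed
  ultimately show ?thesis
    using y(1) by blast
qed

text \<open>Successive approximation as in the open mapping theorem: a point \<open>b\<close> of the
  closure is approached by images of elements of \<open>A\<close> whose increments are bounded by a
  geometric series, so that the preimages converge. The approximate lift bounds the increments by
  the current error.\<close>

lemma star_hom_image_closed:
  assumes A: "cstar_algebra A" and \<phi>: "star_hom A B \<phi>" and B: "B \<subseteq> bounded_ops UNIV"
  shows "closed (\<phi> ` A)"
proof -
  note AD = cstar_algebraD[OF A] and hom = star_homD[OF A \<phi>]
  have "b \<in> \<phi> ` A" if b: "b \<in> closure (\<phi> ` A)" for b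
  proof -
    have step: "\<exists>u'\<in>A. norm (u' - u) \<le> \<rho> \<and> norm (b - \<phi> u') \<le> (3/4) * \<rho>"
      if u: "u \<in> A" and le: "norm (b - \<phi> u) \<le> \<rho>" and \<rho>: "0 < \<rho>" for u \<rho>
    proof -
      obtain a where a: "a \<in> A" "dist (\<phi> a) b < \<rho> / 8"
        using b \<rho> unfolding closure_approachable by (metis imageE divide_pos_pos zero_less_numeral)
      \<comment> \<open>The bound 9/8 is the sum of the current error \<open>\<rho>\<close> and the
        \<open>\<rho> / 8\<close> lost in replacing \<open>b\<close> by \<open>\<phi> a\<close>. One
        step leaves at most 1/8 + 9/16 = 11/16 of \<open>\<rho>\<close>, which is below 3/4.\<close>
      define \<sigma> where "\<sigma> = (9/8) * \<rho>"
      have \<sigma>: "0 < \<sigma>"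
        using \<rho> by (simp add: \<sigma>_def)
      define c where "c = (1/\<sigma>) *\<^sub>R (a - u)"
      have cA: "c \<in> A"
        using a(1) u AD by (simp add: c_def)
      have \<phi>c: "\<phi> c = (1/\<sigma>) *\<^sub>R (\<phi> a - \<phi> u)"
        using a(1) u AD hom by (simp add: c_def)
      have "norm (\<phi> a - \<phi> u) \<le> norm (\<phi> a - b) + norm (b - \<phi> u)"
        using norm_triangle_ineq[of "\<phi> a - b" "b - \<phi> u"] by simp
      then have "norm (\<phi> a - \<phi> u) \<le> \<sigma>"
        using a(2) le by (simp add: dist_norm \<sigma>_def)
      then have "norm (\<phi> c) \<le> 1"
        using \<sigma> by (simp add: \<phi>c)
      then obtain y where y: "y \<in> A" "norm y \<le> 1/2" "norm (\<phi> c - \<phi> y) \<le> 1/2"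
        using star_hom_approximate_lift[OF A \<phi> B cA] by blast
      define u' where "u' = u + \<sigma> *\<^sub>R y"
      have "norm (u' - u) \<le> \<rho>"
        using \<sigma> y(2) \<rho> by (simp add: u'_def \<sigma>_def)
      moreover have "norm (b - \<phi> u') \<le> (3/4) * \<rho>"
      proof -
        have "\<phi> u' = \<phi> u + \<sigma> *\<^sub>R \<phi> y"
          using u y(1) AD hom by (simp add: u'_def)
        then have "b - \<phi> u' = (b - \<phi> a) + \<sigma> *\<^sub>R (\<phi> c - \<phi> y)"
          using \<sigma> by (simp add: \<phi>c scaleR_diff_right)
        then have "norm (b - \<phi> u') \<le> norm (b - \<phi> a) + \<sigma> * norm (\<phi> c - \<phi> y)"
          using \<sigma> norm_triangle_ineq[of "b - \<phi> a" "\<sigma> *\<^sub>R (\<phi> c - \<phi> y)"] by (metis norm_scaleR abs_of_pos)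
        also have "\<dots> \<le> \<rho> / 8 + \<sigma> * (1/2)"
          using a(2) \<sigma> y(3)
          by (intro add_mono mult_left_mono) (auto simp: dist_norm norm_minus_commute)
        finally show ?thesis
          using \<rho> by (simp add: \<sigma>_def)
      qed
      moreover have "u' \<in> A"
        using u y(1) AD by (simp add: u'_def)
      ultimately show ?thesis
        by blast
    qed
    \<comment> \<open>The added 1 keeps the tolerances positive even for \<open>b = 0\<close>; the
      iteration starts at \<open>u = 0\<close>.\<close>
    define \<rho> where "\<rho> m = (3/4) ^ m * (norm b + 1)" for m
    have \<rho>: "0 < \<rho> m" for m
      by (simp add: \<rho>_def add_nonneg_pos)
    have "\<exists>u. \<forall>m. (u m \<in> A \<and> norm (b - \<phi> (u m)) \<le> \<rho> m) \<and> norm (u (Suc m) - u m) \<le> \<rho> m"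
    proof (rule dependent_nat_choice)
      show "\<exists>u. u \<in> A \<and> norm (b - \<phi> u) \<le> \<rho> 0"
        using AD(2) hom(6) by (intro exI[of _ 0]) (simp add: \<rho>_def)
      show "\<exists>u'. (u' \<in> A \<and> norm (b - \<phi> u') \<le> \<rho> (Suc m)) \<and> norm (u' - u) \<le> \<rho> m"
        if "u \<in> A \<and> norm (b - \<phi> u) \<le> \<rho> m" for u m
        using step[of u "\<rho> m"] that \<rho> by (auto simp: \<rho>_def mult.assoc)
    qed
    then obtain u where u: "\<And>m. u m \<in> A" "\<And>m. norm (b - \<phi> (u m)) \<le> \<rho> m"
        "\<And>m. norm (u (Suc m) - u m) \<le> \<rho> m"
      by blast
    have sum\<rho>: "summable \<rho>"
      unfolding \<rho>_def by (intro summable_mult2 summable_geometric) simp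
    then have "summable (\<lambda>m. u (Suc m) - u m)"
      using u(3) by (rule summable_comparison_test'[of _ 0])
    then have "convergent (\<lambda>m. \<Sum>l<m. u (Suc l) - u l)"
      by (simp add: summable_iff_convergent)
    then obtain l where "(\<lambda>m. u m - u 0) \<longlonglongrightarrow> l"
      by (auto simp: sum_lessThan_telescope convergent_def)
    then have "(\<lambda>m. (u m - u 0) + u 0) \<longlonglongrightarrow> l + u 0"
      by (intro tendsto_add tendsto_const)
    then have lim: "u \<longlonglongrightarrow> l + u 0"
      by simp
    note lim_\<phi> = star_hom_tendsto[OF A \<phi> B u(1) lim]
    have "(\<lambda>m. \<phi> (u m)) \<longlonglongrightarrow> b"
    proof (rule Lim_transform_bound[OF eventuallyI, THEN LIM_zero_cancel])
      show "norm (\<phi> (u m) - b) \<le> norm (\<rho> m)" for m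
        using u(2)[of m] \<rho>[of m] by (simp add: norm_minus_commute)
      show "\<rho> \<longlonglongrightarrow> 0"
        using sum\<rho> by (rule summable_LIMSEQ_zero)
    qed
    then have "b = \<phi> (l + u 0)"
      using lim_\<phi>(2) by (rule LIMSEQ_unique)
    with lim_\<phi>(1) show ?thesis
      by blast
  qed
  then show ?thesis
    by (metis closure_subset_eq subsetI)
qed

lemma star_hom_image_cstar_algebra:
  assumes A: "cstar_algebra A" and \<phi>: "star_hom A B \<phi>" and B: "B \<subseteq> bounded_ops UNIV"
  shows "cstar_algebra (\<phi> ` A)"
  unfolding cstar_algebra_def[of "_ ` _"]
proof (intro conjI ballI allI star_hom_image_closed[OF A \<phi> B])
  note AD = cstar_algebraD[OF A] and hom = star_homD[OF A \<phi>]
  show "\<phi> ` A \<subseteq> bounded_ops UNIV"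
    using B hom(1) by blast
  show "0 \<in> \<phi> ` A"
    using AD(2) hom(6) by (metis imageI)
  fix a c
  assume "a \<in> \<phi> ` A"
  then obtain a' where a: "a = \<phi> a'" "a' \<in> A"
    by blast
  show "c *\<^sub>C a \<in> \<phi> ` A" "adj a \<in> \<phi> ` A"
    using a AD(4,6) hom(3,5) by (metis imageI)+
  fix b
  assume "b \<in> \<phi> ` A"
  then obtain b' where b: "b = \<phi> b'" "b' \<in> A"
    by blast
  show "a + b \<in> \<phi> ` A" "a o\<^sub>L b \<in> \<phi> ` A"
    using a b AD(3,5) hom(2,4) by (metis imageI)+
qed

text \<open>The equaliser of two homomorphisms is a C*-algebra, closed because both are contractive.
  This is the uniqueness in (i).\<close>

lemma star_hom_eq_on_hull:
  assumes G: "G \<subseteq> bounded_ops UNIV" and B: "B \<subseteq> bounded_ops UNIV"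
    and \<phi>: "star_hom (cstar_algebra hull G) B \<phi>" and \<psi>: "star_hom (cstar_algebra hull G) B \<psi>"
    and eq: "\<And>g. g \<in> G \<Longrightarrow> \<phi> g = \<psi> g" and a: "a \<in> cstar_algebra hull G"
  shows "\<phi> a = \<psi> a"
proof -
  define A where "A = cstar_algebra hull G"
  have A: "cstar_algebra A"
    unfolding A_def using G by (rule cstar_algebra_hull)
  note AD = cstar_algebraD[OF A]
  note h1 = star_homD[OF A \<phi>[folded A_def]] and h2 = star_homD[OF A \<psi>[folded A_def]]
  define E where "E = {a \<in> A. \<phi> a = \<psi> a}"
  have "cstar_algebra E"
    unfolding cstar_algebra_def
  proof (intro conjI)
    show "closed E"
      unfolding closed_sequential_limits
    proof (intro allI impI)
      fix u l
      assume *: "(\<forall>m. u m \<in> E) \<and> u \<longlonglongrightarrow> l"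
      then have u: "\<And>m. u m \<in> A" "\<And>m. \<phi> (u m) = \<psi> (u m)" and lim: "u \<longlonglongrightarrow> l"
        by (auto simp: E_def)
      note l1 = star_hom_tendsto[OF A \<phi>[folded A_def] B u(1) lim]
      have "\<phi> l = \<psi> l"
        using l1(2) star_hom_tendsto(2)[OF A \<psi>[folded A_def] B u(1) lim] unfolding u(2)
        by (rule LIMSEQ_unique)
      then show "l \<in> E"
        using l1(1) by (simp add: E_def)
    qed
  qed (use AD h1 h2 in \<open>auto simp: E_def\<close>)
  moreover have "G \<subseteq> E"
    using eq hull_subset[of G cstar_algebra] by (auto simp: E_def A_def)
  ultimately have "A \<subseteq> E"
    unfolding A_def by (intro hull_minimal)
  then show ?thesis
    using a by (auto simp: E_def A_def)
qed

text \<open>The homomorphism is built from its graph: an asymptotic condition on pairs is stable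
  under the operations but gives no formula for the image. Applied to differences,
  \<open>norm b \<le> norm a\<close> makes the relation single-valued and turns Cauchy sequences of
  first components into Cauchy sequences of second components, so that the domain is closed and
  contains the hull.\<close>

lemma star_hom_if_relation:
  fixes R :: "(('a::complex_hilbert \<Rightarrow>\<^sub>L 'a) \<times> ('b::complex_hilbert \<Rightarrow>\<^sub>L 'b)) set"
  assumes R: "R \<subseteq> bounded_ops UNIV \<times> bounded_ops UNIV" "closed R" "(0, 0) \<in> R"
    and add: "\<And>a b a' b'. (a, b) \<in> R \<Longrightarrow> (a', b') \<in> R \<Longrightarrow> (a + a', b + b') \<in> R"
    and scale: "\<And>a b c. (a, b) \<in> R \<Longrightarrow> (c *\<^sub>C a, c *\<^sub>C b) \<in> R"
    and comp: "\<And>a b a' b'. (a, b) \<in> R \<Longrightarrow> (a', b') \<in> R \<Longrightarrow> (a o\<^sub>L a', b o\<^sub>L b') \<in> R"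
    and adj: "\<And>a b. (a, b) \<in> R \<Longrightarrow> (adj a, adj b) \<in> R"
    and le: "\<And>a b. (a, b) \<in> R \<Longrightarrow> norm b \<le> norm a"
    and G: "G \<subseteq> R"
  shows "\<exists>\<phi>. star_hom (cstar_algebra hull (fst ` G)) (cstar_algebra hull (snd ` G)) \<phi> \<and>
    (\<forall>g\<in>G. \<phi> (fst g) = snd g)"
proof -
  define A where "A = cstar_algebra hull (fst ` G)"
  define B where "B = cstar_algebra hull (snd ` G)"
  have "fst ` G \<subseteq> bounded_ops UNIV" "snd ` G \<subseteq> bounded_ops UNIV"
    using G R(1) by auto
  then have A: "cstar_algebra A" and B: "cstar_algebra B"
    unfolding A_def B_def by (auto intro: cstar_algebra_hull)
  note AD = cstar_algebraD[OF A] and BD = cstar_algebraD[OF B]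
  \<comment> \<open>The restriction to \<open>A \<times> B\<close> puts the values of the map into
    the algebra generated by the second components.\<close>
  define Q where "Q = R \<inter> (A \<times> B)"
  have closed: "closed Q"
    unfolding Q_def using R(2) AD(7) BD(7) by (intro closed_Int closed_Times)
  have Q: "(0, 0) \<in> Q" "(a, b) \<in> Q \<Longrightarrow> (a', b') \<in> Q \<Longrightarrow> (a + a', b + b') \<in> Q"
      "(a, b) \<in> Q \<Longrightarrow> (c *\<^sub>C a, c *\<^sub>C b) \<in> Q"
      "(a, b) \<in> Q \<Longrightarrow> (a', b') \<in> Q \<Longrightarrow> (a o\<^sub>L a', b o\<^sub>L b') \<in> Q"
      "(a, b) \<in> Q \<Longrightarrow> (adj a, adj b) \<in> Q" "(a, b) \<in> Q \<Longrightarrow> norm b \<le> norm a" for a b a' b' c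
    using R(3) add[of a b a' b'] scale[of a b c] comp[of a b a' b'] adj[of a b] le[of a b]
      AD(2) AD(3)[of a a'] AD(4)[of a c] AD(5)[of a a'] AD(6)[of a]
      BD(2) BD(3)[of b b'] BD(4)[of b c] BD(5)[of b b'] BD(6)[of b]
    unfolding Q_def by blast+
  have diff: "(a - a', b - b') \<in> Q" if "(a, b) \<in> Q" "(a', b') \<in> Q" for a b a' b'
  proof -
    have "(a + (-1) *\<^sub>R a', b + (-1) *\<^sub>R b') \<in> Q"
      unfolding scaleR_scaleC_blinfun by (intro Q that)
    then show ?thesis
      by simp
  qed
  have unique: "b = b'" if "(a, b) \<in> Q" "(a, b') \<in> Q" for a b b'
    using Q(6)[OF diff[OF that]] by simp
  define D where "D = fst ` Q"
  have "cstar_algebra D"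
    unfolding cstar_algebra_def
  proof (intro conjI ballI allI)
    show "D \<subseteq> bounded_ops UNIV"
      using AD(1) by (auto simp: D_def Q_def)
    show "closed D"
      unfolding closed_sequential_limits
    proof (intro allI impI)
      fix u l
      assume *: "(\<forall>m. u m \<in> D) \<and> u \<longlonglongrightarrow> l"
      then have "\<forall>m. \<exists>b. (u m, b) \<in> Q"
        by (force simp: D_def)
      then obtain w where w: "\<And>m. (u m, w m) \<in> Q"
        by metis
      have "Cauchy u"
        using * LIMSEQ_imp_Cauchy by blast
      have "Cauchy w"
      proof (rule CauchyI)
        fix e :: real
        assume "0 < e"
        then obtain M where "\<forall>m\<ge>M. \<forall>p\<ge>M. norm (u m - u p) < e"
          using CauchyD[OF \<open>Cauchy u\<close>] by blast
        moreover have "norm (w m - w p) \<le> norm (u m - u p)" for m p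
          using Q(6)[OF diff[OF w w]] .
        ultimately show "\<exists>M. \<forall>m\<ge>M. \<forall>p\<ge>M. norm (w m - w p) < e"
          by (meson order_le_less_trans)
      qed
      then obtain l' where "w \<longlonglongrightarrow> l'"
        using Cauchy_convergent_iff convergent_def by blast
      then have "(\<lambda>m. (u m, w m)) \<longlonglongrightarrow> (l, l')"
        using * by (intro tendsto_Pair) auto
      then have "(l, l') \<in> Q"
        by (rule closed_sequentially[OF closed w])
      then show "l \<in> D"
        by (force simp: D_def)
    qed
    show "0 \<in> D"
      using Q(1) by (force simp: D_def)
    fix a c
    assume "a \<in> D"
    then obtain b where b: "(a, b) \<in> Q"
      by (auto simp: D_def)
    show "c *\<^sub>C a \<in> D" "adj a \<in> D"
      using Q(3)[OF b, of c] Q(5)[OF b] by (force simp: D_def)+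
    fix a'
    assume "a' \<in> D"
    then obtain b' where b': "(a', b') \<in> Q"
      by (auto simp: D_def)
    show "a + a' \<in> D" "a o\<^sub>L a' \<in> D"
      using Q(2)[OF b b'] Q(4)[OF b b'] by (force simp: D_def)+
  qed
  moreover have GQ: "G \<subseteq> Q"
  proof
    fix g
    assume g: "g \<in> G"
    then have "fst g \<in> A" "snd g \<in> B"
      unfolding A_def B_def by (auto intro: hull_inc)
    with g G show "g \<in> Q"
      by (cases g) (auto simp: Q_def)
  qed
  then have "fst ` G \<subseteq> D"
    by (auto simp: D_def)
  ultimately have "A \<subseteq> D"
    unfolding A_def by (intro hull_minimal)
  define \<phi> where "\<phi> a = (SOME b. (a, b) \<in> Q)" for a
  have \<phi>_eq: "\<phi> a = b" if "(a, b) \<in> Q" for a b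
    unfolding \<phi>_def using that unique by blast
  have \<phi>: "(a, \<phi> a) \<in> Q" if "a \<in> A" for a
  proof -
    have "a \<in> D"
      using \<open>A \<subseteq> D\<close> that by blast
    then obtain b where b: "(a, b) \<in> Q"
      by (auto simp: D_def)
    with \<phi>_eq[OF b] show ?thesis
      by simp
  qed
  have "star_hom A B \<phi>"
    unfolding star_hom_def
  proof (intro conjI ballI allI)
    fix a
    assume a: "a \<in> A"
    show "\<phi> a \<in> B"
      using \<phi>[OF a] by (simp add: Q_def)
    show "\<phi> (c *\<^sub>C a) = c *\<^sub>C \<phi> a" "\<phi> (adj a) = adj (\<phi> a)" for c
      by (intro \<phi>_eq Q \<phi> a)+
    fix b
    assume b: "b \<in> A"
    show "\<phi> (a + b) = \<phi> a + \<phi> b" "\<phi> (a o\<^sub>L b) = \<phi> a o\<^sub>L \<phi> b"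
      by (intro \<phi>_eq Q \<phi> a b)+
  qed
  then show ?thesis
    using GQ \<phi>_eq unfolding A_def B_def by (intro exI[of _ \<phi>]) auto
qed

section \<open>Finite orthonormal sets\<close>

definition orthonormal :: "'a::complex_hilbert set \<Rightarrow> bool" where
  "orthonormal E \<longleftrightarrow> finite E \<and> (\<forall>e\<in>E. \<forall>f\<in>E. cinner e f = (if e = f then 1 else 0))"

lemma norm_minus_orthonormal_expansion:
  assumes E: "orthonormal E"
  defines "p \<equiv> \<lambda>v. \<Sum>e\<in>E. cinner v e *\<^sub>C e"
  shows "f \<in> E \<Longrightarrow> cinner (p v) f = cinner v f"
    and "(norm (v - p v))\<^sup>2 = (norm v)\<^sup>2 - (\<Sum>e\<in>E. (cmod (cinner v e))\<^sup>2)"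
proof -
  have p: "cinner (p v) f = cinner v f" if f: "f \<in> E" for f
  proof -
    have "cinner (p v) f = (\<Sum>e\<in>E. if e = f then cinner v f else 0)"
      unfolding p_def cinner.sum_left
      using E f by (intro sum.cong) (auto simp: cinner_scaleC_left orthonormal_def)
    then show ?thesis
      using E f by (simp add: orthonormal_def)
  qed
  then show "f \<in> E \<Longrightarrow> cinner (p v) f = cinner v f" .
  have expand: "cinner u (p v) = (\<Sum>e\<in>E. complex_of_real ((cmod (cinner v e))\<^sup>2))"
    if "\<And>e. e \<in> E \<Longrightarrow> cinner u e = cinner v e" for u
    unfolding p_def cinner.sum_right
    using that by (intro sum.cong) (auto simp: cinner_scaleC_right complex_norm_square mult.commute
        simp del: of_real_power)
  have "(norm (p v))\<^sup>2 = (\<Sum>e\<in>E. (cmod (cinner v e))\<^sup>2)"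
    using expand[OF p] unfolding cinner_self of_real_sum[symmetric] of_real_eq_iff .
  moreover have "Re (cinner v (p v)) = (\<Sum>e\<in>E. (cmod (cinner v e))\<^sup>2)"
    using expand[of v] unfolding of_real_sum[symmetric] by simp
  ultimately show "(norm (v - p v))\<^sup>2 = (norm v)\<^sup>2 - (\<Sum>e\<in>E. (cmod (cinner v e))\<^sup>2)"
    by (simp add: norm_diff_square)
qed

lemma bessel_inequality:
  assumes "orthonormal E"
  shows "(\<Sum>e\<in>E. (cmod (cinner v e))\<^sup>2) \<le> (norm v)\<^sup>2"
  using norm_minus_orthonormal_expansion(2)[OF assms, of v] by (smt (verit) zero_le_power2)

text \<open>Gram-Schmidt, one vector at a time. Equality in Bessel's inequality is the way to say
  that \<open>X\<close> lies in the span of \<open>E'\<close>.\<close>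

lemma orthonormal_extend:
  assumes "orthonormal E" "finite X"
  shows "\<exists>E'. E \<subseteq> E' \<and> orthonormal E' \<and> (\<forall>v\<in>X. (\<Sum>e\<in>E'. (cmod (cinner v e))\<^sup>2) = (norm v)\<^sup>2)"
  using assms(2)
proof induction
  case empty
  then show ?case
    using assms(1) by auto
next
  case (insert v X)
  then obtain E' where E': "E \<subseteq> E'" "orthonormal E'"
      "\<And>x. x \<in> X \<Longrightarrow> (\<Sum>e\<in>E'. (cmod (cinner x e))\<^sup>2) = (norm x)\<^sup>2"
    by blast
  define p where "p = (\<Sum>e\<in>E'. cinner v e *\<^sub>C e)"
  define w where "w = v - p"
  have w: "(norm w)\<^sup>2 = (norm v)\<^sup>2 - (\<Sum>e\<in>E'. (cmod (cinner v e))\<^sup>2)"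
    unfolding w_def p_def by (rule norm_minus_orthonormal_expansion(2)[OF E'(2)])
  have we: "cinner w e = 0" if "e \<in> E'" for e
    using norm_minus_orthonormal_expansion(1)[OF E'(2) that, of v]
    by (simp add: w_def p_def cinner.diff_left)
  show ?case
  proof (cases "w = 0")
    case True
    then show ?thesis
      using E' w by (intro exI[of _ E']) auto
  next
    case False
    define u where "u = complex_of_real (1 / norm w) *\<^sub>C w"
    have uu: "cinner u u = 1"
      unfolding u_def cinner_scaleC_left cinner_scaleC_right unfolding cinner_self
      using False by (simp add: power2_eq_square)
    have ue: "cinner u e = 0" "cinner e u = 0" if "e \<in> E'" for e
    proof -
      show "cinner u e = 0"
        using we[OF that] by (simp add: u_def cinner_scaleC_left)
      then show "cinner e u = 0"
        using cinner_commute[of e u] by simp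
    qed
    have u_notin: "u \<notin> E'"
      using ue(1)[of u] uu by auto
    have fin: "finite E'"
      using E'(2) by (simp add: orthonormal_def)
    have E'': "orthonormal (insert u E')"
      using E'(2) ue uu u_notin by (auto simp: orthonormal_def)
    have sum: "(\<Sum>e\<in>insert u E'. (cmod (cinner x e))\<^sup>2)
        = (cmod (cinner x u))\<^sup>2 + (\<Sum>e\<in>E'. (cmod (cinner x e))\<^sup>2)" for x
      using fin u_notin by simp
    have "cinner p u = 0"
      by (simp add: p_def cinner.sum_left cinner_scaleC_left ue)
    then have "cinner v u = cinner w u"
      by (simp add: w_def cinner.diff_left)
    also have "\<dots> = norm w"
      using False by (simp add: u_def cinner_scaleC_right cinner_self power2_eq_square)
    finally have "(\<Sum>e\<in>insert u E'. (cmod (cinner v e))\<^sup>2) = (norm v)\<^sup>2"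
      using w by (simp add: sum)
    \<comment> \<open>A further unit vector cannot destroy equality for the earlier vectors: it adds
      a nonnegative term, and Bessel's inequality caps the total.\<close>
    moreover have "(\<Sum>e\<in>insert u E'. (cmod (cinner x e))\<^sup>2) = (norm x)\<^sup>2" if "x \<in> X" for x
      using E'(3)[OF that] bessel_inequality[OF E'', of x] sum[of x] by (smt (verit) zero_le_power2)
    ultimately show ?thesis
      using E' E'' by (intro exI[of _ "insert u E'"]) auto
  qed
qed

section \<open>Square summable families\<close>

lemma bounded_linear_ell2_fun: "bounded_linear (\<lambda>f. ell2_fun f x)"
  by (rule bounded_linear_intro[of _ 1])
    (simp_all add: plus_ell2.rep_eq scaleR_ell2_def scaleC_ell2.rep_eq ell2_cmod_le_norm
      scaleR_conv_of_real)

lemma ell2_fun_sum: "ell2_fun (\<Sum>i\<in>I. f i) x = (\<Sum>i\<in>I. ell2_fun (f i) x)"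
  by (rule linear_sum[OF bounded_linear.linear[OF bounded_linear_ell2_fun]])

lemma ell2_eqI: "(\<And>x. ell2_fun f x = ell2_fun g x) \<Longrightarrow> f = g"
  by (metis ell2_fun_inject ext)

lemma ell2_norm_square_finite_support:
  assumes "finite B" "\<And>x. x \<notin> B \<Longrightarrow> ell2_fun f x = 0"
  shows "(norm f)\<^sup>2 = (\<Sum>x\<in>B. (cmod (ell2_fun f x))\<^sup>2)"
proof -
  have "(norm f)\<^sup>2 = (\<Sum>\<^sub>\<infinity>x\<in>B. (cmod (ell2_fun f x))\<^sup>2)"
    unfolding ell2_norm_square using assms(2) by (intro infsum_cong_neutral) auto
  then show ?thesis
    using assms(1) by simp
qed

lemma cinner_chi_right: "cinner f (chi x) = ell2_fun f x"
proof -
  have "cinner f (chi x) = (\<Sum>\<^sub>\<infinity>y\<in>{x}. ell2_fun f y)"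
    unfolding cinner_ell2_def by (rule infsum_cong_neutral) (auto simp: chi.rep_eq)
  then show ?thesis
    by simp
qed

lemma cinner_chi_left: "cinner (chi x) f = cnj (ell2_fun f x)"
  using cinner_commute[of "chi x" f] by (simp add: cinner_chi_right)

text \<open>Passing to the adjoint replaces a density argument: the coordinates of
  \<open>adj (T - R) g\<close> are, up to conjugation, inner products of \<open>g\<close> with the
  vectors \<open>(T - R) (chi x) = 0\<close>.\<close>

lemma ell2_op_eqI:
  assumes T: "T \<in> bounded_ops UNIV" and R: "R \<in> bounded_ops UNIV"
    and chi: "\<And>x. T (chi x) = R (chi x)"
  shows "T = R"
proof -
  have TR: "T - R \<in> bounded_ops UNIV"
    using T R by (simp add: bounded_ops_UNIV_closure)
  have "ell2_fun (adj (T - R) g) x = 0" for g x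
  proof -
    have "cinner (chi x) (adj (T - R) g) = 0"
      by (simp add: cinner_adj_right[OF TR] blinfun.diff_left chi cinner.zero_left)
    then show ?thesis
      by (simp add: cinner_chi_left)
  qed
  then have "adj (T - R) = 0"
    by (intro blinfun_eqI ell2_eqI) (simp add: zero_ell2.rep_eq)
  then show ?thesis
    using adj_adj[OF TR] by simp
qed

section \<open>Weighted composition operators\<close>

text \<open>One family that contains the shifts, their adjoints and the projection onto the Fock
  space. The body describes a bounded operator when \<open>g\<close> is injective on
  \<open>X\<close> and \<open>c\<close> is bounded by 1 there.\<close>

definition wcomp :: "'x set \<Rightarrow> ('x \<Rightarrow> complex) \<Rightarrow> ('x \<Rightarrow> 'x) \<Rightarrow> 'x ell2 \<Rightarrow>\<^sub>L 'x ell2" where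
  "wcomp X c g = Blinfun (\<lambda>f. Abs_ell2 (\<lambda>x. if x \<in> X then c x * ell2_fun f (g x) else 0))"

lemma wcomp_apply:
  assumes inj: "inj_on g X" and c: "\<And>x. x \<in> X \<Longrightarrow> cmod (c x) \<le> 1"
  shows "ell2_fun (wcomp X c g f) x = (if x \<in> X then c x * ell2_fun f (g x) else 0)"
proof -
  define h where "h f x = (if x \<in> X then c x * ell2_fun f (g x) else 0)" for f x
  have sum_le: "(\<Sum>x\<in>F. (cmod (h f x))\<^sup>2) \<le> (norm f)\<^sup>2" if F: "finite F" for F f
  proof -
    have "(\<Sum>x\<in>F. (cmod (h f x))\<^sup>2) = (\<Sum>x\<in>F \<inter> X. (cmod (h f x))\<^sup>2)"
      using F by (intro sum.mono_neutral_right) (auto simp: h_def)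
    also have "\<dots> \<le> (\<Sum>x\<in>F \<inter> X. (cmod (ell2_fun f (g x)))\<^sup>2)"
    proof (rule sum_mono)
      fix x
      assume "x \<in> F \<inter> X"
      then show "(cmod (h f x))\<^sup>2 \<le> (cmod (ell2_fun f (g x)))\<^sup>2"
        using c[of x] by (auto simp: h_def norm_mult intro!: power_mono mult_left_le_one_le)
    qed
    also have "\<dots> = (\<Sum>y\<in>g ` (F \<inter> X). (cmod (ell2_fun f y))\<^sup>2)"
      using inj by (subst sum.reindex) (auto intro: inj_on_subset)
    also have "\<dots> \<le> (norm f)\<^sup>2"
      using F by (intro ell2_sum_le_norm_square) simp
    finally show ?thesis .
  qed
  have "(\<lambda>x. (cmod (h f x))\<^sup>2) summable_on UNIV" for f
    using sum_le[of _ f] by (intro nonneg_bdd_above_summable_on bdd_aboveI2) auto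
  then have rep: "ell2_fun (Abs_ell2 (h f)) = h f" for f
    by (simp add: Abs_ell2_inverse)
  have "bounded_linear (\<lambda>f. Abs_ell2 (h f))"
  proof (rule bounded_linear_intro)
    show "Abs_ell2 (h (f + f')) = Abs_ell2 (h f) + Abs_ell2 (h f')" for f f'
      by (rule ell2_eqI) (simp add: rep h_def plus_ell2.rep_eq distrib_left)
    show "Abs_ell2 (h (r *\<^sub>R f)) = r *\<^sub>R Abs_ell2 (h f)" for r f
      by (rule ell2_eqI) (simp add: rep h_def scaleR_ell2_def scaleC_ell2.rep_eq)
    show "norm (Abs_ell2 (h f)) \<le> norm f * 1" for f
    proof -
      have "(norm (Abs_ell2 (h f)))\<^sup>2 \<le> (norm f)\<^sup>2"
        using sum_le by (intro ell2_norm_square_le) (simp add: rep)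
      then show ?thesis
        by (simp add: power2_le_iff_abs_le)
    qed
  qed
  then have "blinfun_apply (wcomp X c g) = (\<lambda>f. Abs_ell2 (h f))"
    unfolding wcomp_def h_def by (rule bounded_linear_Blinfun_apply)
  then show ?thesis
    by (simp add: rep) (simp add: h_def)
qed

lemma wcomp_mem_bounded_ops:
  assumes "inj_on g X" "\<And>x. x \<in> X \<Longrightarrow> cmod (c x) \<le> 1"
  shows "wcomp X c g \<in> bounded_ops UNIV"
  unfolding bounded_ops_UNIV_iff
  by (intro allI ell2_eqI) (simp add: wcomp_apply[OF assms] scaleC_ell2.rep_eq)

lemma adj_wcomp:
  assumes inj: "inj_on g X" and c: "\<And>x. x \<in> X \<Longrightarrow> cmod (c x) \<le> 1"
    and h: "\<And>x. x \<in> X \<Longrightarrow> h (g x) = x" and Y: "Y = g ` X"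
  shows "adj (wcomp X c g) = wcomp Y (\<lambda>y. cnj (c (h y))) h"
proof (rule adj_eqI)
  have inj': "inj_on h Y"
    using h by (auto simp: Y inj_on_def)
  have c': "cmod (cnj (c (h y))) \<le> 1" if "y \<in> Y" for y
    using that c h by (auto simp: Y)
  show "wcomp Y (\<lambda>y. cnj (c (h y))) h \<in> bounded_ops UNIV"
    using inj' c' by (rule wcomp_mem_bounded_ops)
  show "cinner (wcomp X c g f) u = cinner f (wcomp Y (\<lambda>y. cnj (c (h y))) h u)" for f u
  proof -
    have "cinner (wcomp X c g f) u = (\<Sum>\<^sub>\<infinity>x\<in>X. c x * ell2_fun f (g x) * cnj (ell2_fun u x))"
      unfolding cinner_ell2_def by (rule infsum_cong_neutral) (auto simp: wcomp_apply[OF inj c])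
    also have "\<dots> = (\<Sum>\<^sub>\<infinity>x\<in>X. ((\<lambda>y. c (h y) * ell2_fun f y * cnj (ell2_fun u (h y))) \<circ> g) x)"
      by (rule infsum_cong) (simp add: h)
    also have "\<dots> = (\<Sum>\<^sub>\<infinity>y\<in>Y. c (h y) * ell2_fun f y * cnj (ell2_fun u (h y)))"
      unfolding Y by (rule infsum_reindex[OF inj, symmetric])
    also have "\<dots> = cinner f (wcomp Y (\<lambda>y. cnj (c (h y))) h u)"
      unfolding cinner_ell2_def
      by (rule infsum_cong_neutral) (auto simp: wcomp_apply[OF inj' c'] mult_ac)
    finally show ?thesis .
  qed
qed

section \<open>The standard tuple\<close>

lemma fock_space_closed_csubspace [simp]: "closed_csubspace (fock_space k n)"
proof -
  have "fock_space k n = (\<Inter>\<alpha>\<in>- words k n. {f. ell2_fun f \<alpha> = 0})"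
    by (auto simp: fock_space_def)
  moreover have "closed {f. ell2_fun f \<alpha> = 0}" for \<alpha> :: "nat \<Rightarrow> nat list"
    by (intro closed_Collect_eq continuous_on_const
        bounded_linear.continuous_on[OF bounded_linear_ell2_fun] continuous_on_id)
  ultimately have "closed (fock_space k n)"
    by auto
  then show ?thesis
    by (auto simp: closed_csubspace_def fock_space_def zero_ell2.rep_eq plus_ell2.rep_eq
        scaleC_ell2.rep_eq)
qed

lemma chi_mem_fock_space: "\<alpha> \<in> words k n \<Longrightarrow> chi \<alpha> \<in> fock_space k n"
  by (auto simp: fock_space_def chi.rep_eq)

lemma fock_space_orthogonal:
  assumes "\<And>h. h \<in> fock_space k n \<Longrightarrow> cinner f h = 0" "\<alpha> \<in> words k n"
  shows "ell2_fun f \<alpha> = 0"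
  using assms(1)[OF chi_mem_fock_space[OF assms(2)]] by (simp add: cinner_chi_right)

lemma id_op_fock_space: "ell2_fun (id_op (fock_space k n) f) \<alpha> = (if \<alpha> \<in> words k n then ell2_fun f \<alpha> else 0)"
proof -
  have app: "ell2_fun (wcomp (words k n) (\<lambda>_. 1) (\<lambda>\<alpha>. \<alpha>) f) \<alpha>
      = (if \<alpha> \<in> words k n then ell2_fun f \<alpha> else 0)" for f \<alpha>
    by (simp add: wcomp_apply)
  have "id_op (fock_space k n) = wcomp (words k n) (\<lambda>_. 1) (\<lambda>\<alpha>. \<alpha>)"
  proof (rule id_op_eqI)
    have "wcomp (words k n) (\<lambda>_. 1) (\<lambda>\<alpha>. \<alpha>) f = 0" if "\<forall>h\<in>fock_space k n. cinner f h = 0" for f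
      using fock_space_orthogonal[of k n f] that by (intro ell2_eqI) (simp add: app zero_ell2.rep_eq)
    then show "wcomp (words k n) (\<lambda>_. 1) (\<lambda>\<alpha>. \<alpha>) \<in> bounded_ops (fock_space k n)"
      using wcomp_mem_bounded_ops[of "\<lambda>\<alpha>. \<alpha>" "words k n" "\<lambda>_. 1"]
      by (auto simp: bounded_ops_def fock_space_def app)
    show "wcomp (words k n) (\<lambda>_. 1) (\<lambda>\<alpha>. \<alpha>) f = f" if "f \<in> fock_space k n" for f
      using that by (intro ell2_eqI) (auto simp: app fock_space_def)
  qed simp
  then show ?thesis
    by (simp add: app)
qed

section \<open>Coordinate form of the twisted shifts\<close>

type_synonym fock_op = "(nat \<Rightarrow> nat list) ell2 \<Rightarrow>\<^sub>L (nat \<Rightarrow> nat list) ell2"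

definition twist_coeff ::
    "(nat \<Rightarrow> nat \<Rightarrow> nat \<Rightarrow> nat \<Rightarrow> complex) \<Rightarrow> nat \<Rightarrow> nat \<Rightarrow> (nat \<Rightarrow> nat list) \<Rightarrow> complex" where
  "twist_coeff lam i s \<alpha> = (\<Prod>j\<in>{1..<i}. word_twist lam i j s (\<alpha> j))"

lemma twist_coeff_upd_eq [simp]: "i \<le> j \<Longrightarrow> twist_coeff lam i s (\<alpha>(j := w)) = twist_coeff lam i s \<alpha>"
  unfolding twist_coeff_def by (intro prod.cong) auto

lemma twist_coeff_upd_Cons:
  assumes "1 \<le> j" "j < i"
  shows "twist_coeff lam i s (\<alpha>(j := t # w)) = lam i j s t * twist_coeff lam i s (\<alpha>(j := w))"
proof -
  have "twist_coeff lam i s (\<alpha>(j := v))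
      = word_twist lam i j s v * (\<Prod>l\<in>{1..<i} - {j}. word_twist lam i l s (\<alpha> l))" for v
    unfolding twist_coeff_def using assms by (subst prod.remove[of _ j]) auto
  then show ?thesis
    by (simp add: word_twist_def)
qed

lemma words_upd:
  assumes "\<alpha> \<in> words k n" "i \<in> {1..k}" "w \<in> lists {1..n i}"
  shows "\<alpha>(i := w) \<in> words k n"
  using assms by (auto simp: words_def PiE_def Pi_def extensional_def)

lemma words_lists:
  assumes "\<alpha> \<in> words k n" "i \<in> {1..k}"
  shows "\<alpha> i \<in> lists {1..n i}"
  using assms by (auto simp: words_def)

lemma cmod_twist_coeff:
  assumes "twist_matrices k n lam" "\<alpha> \<in> words k n" "i \<in> {1..k}" "s \<in> {1..n i}"
  shows "cmod (twist_coeff lam i s \<alpha>) = 1"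
proof -
  have uni: "cmod (lam i j s t) = 1" if "j \<in> {1..k}" "i \<noteq> j" "t \<in> {1..n j}" for j t
    using assms that unfolding twist_matrices_def by blast
  have "cmod (word_twist lam i j s w) = 1" if "j \<in> {1..<i}" "w \<in> lists {1..n j}" for j w
    using that(2)
  proof induction
    case (Cons t w)
    have "cmod (lam i j s t) = 1"
      using assms(3) that(1) Cons.hyps(1) by (intro uni) auto
    then show ?case
      using Cons by (simp add: word_twist_def norm_mult)
  qed (simp add: word_twist_def)
  then have "(\<Prod>j\<in>{1..<i}. cmod (word_twist lam i j s (\<alpha> j))) = 1"
    using assms words_lists by (intro prod.neutral) auto
  then show ?thesis
    by (simp add: twist_coeff_def prod_norm)
qed

lemma twist_coeff_mult_cnj:
  assumes "twist_matrices k n lam" "\<alpha> \<in> words k n" "i \<in> {1..k}" "s \<in> {1..n i}"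
  shows "twist_coeff lam i s \<alpha> * cnj (twist_coeff lam i s \<alpha>) = 1"
  using cmod_twist_coeff[OF assms] complex_norm_square[of "twist_coeff lam i s \<alpha>"] by simp

text \<open>The action on basis vectors, read off at the target index. The twist may be evaluated at
  \<open>\<beta>\<close> instead of the shortened tuple, because it involves only the slots below
  \<open>i\<close>.\<close>

definition std_shift ::
    "nat \<Rightarrow> (nat \<Rightarrow> nat) \<Rightarrow> (nat \<Rightarrow> nat \<Rightarrow> nat \<Rightarrow> nat \<Rightarrow> complex) \<Rightarrow>
     nat \<Rightarrow> nat \<Rightarrow> fock_op" where
  "std_shift k n lam i s = wcomp {\<beta> \<in> words k n. \<beta> i \<noteq> [] \<and> hd (\<beta> i) = s} (twist_coeff lam i s)
     (\<lambda>\<beta>. \<beta>(i := tl (\<beta> i)))"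

context
  fixes k n lam
  assumes lam: "twist_matrices k n lam"
begin

lemma std_shift:
  assumes i: "i \<in> {1..k}" and s: "s \<in> {1..n i}"
  shows std_shift_apply: "ell2_fun (std_shift k n lam i s f) \<beta> =
      (if \<beta> \<in> words k n \<and> \<beta> i \<noteq> [] \<and> hd (\<beta> i) = s
       then twist_coeff lam i s \<beta> * ell2_fun f (\<beta>(i := tl (\<beta> i))) else 0)"
    and adj_std_shift_apply: "ell2_fun (adj (std_shift k n lam i s) f) \<beta> =
      (if \<beta> \<in> words k n then cnj (twist_coeff lam i s \<beta>) * ell2_fun f (\<beta>(i := s # \<beta> i)) else 0)"
    and std_shift_mem_bounded_ops: "std_shift k n lam i s \<in> bounded_ops (fock_space k n)"
proof -
  define X where "X = {\<beta> \<in> words k n. \<beta> i \<noteq> [] \<and> hd (\<beta> i) = s}"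
  define g :: "(nat \<Rightarrow> nat list) \<Rightarrow> nat \<Rightarrow> nat list" where "g \<beta> = \<beta>(i := tl (\<beta> i))" for \<beta>
  define h :: "(nat \<Rightarrow> nat list) \<Rightarrow> nat \<Rightarrow> nat list" where "h \<alpha> = \<alpha>(i := s # \<alpha> i)" for \<alpha>
  have hg: "h (g \<beta>) = \<beta>" if "\<beta> \<in> X" for \<beta>
    using that by (auto simp: X_def h_def g_def)
  have inj: "inj_on g X"
    by (rule inj_on_inverseI[of X h g, OF hg])
  have c: "cmod (twist_coeff lam i s \<beta>) \<le> 1" if "\<beta> \<in> X" for \<beta>
    using that cmod_twist_coeff[OF lam _ i s] by (simp add: X_def)
  \<comment> \<open>Deleting the letter \<open>s\<close> maps the tuples with \<open>s\<close> in
    front onto all tuples of words, which is why the adjoint shift has no side condition beyond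
    membership in \<open>words k n\<close>.\<close>
  have Y: "words k n = g ` X"
  proof (intro equalityI subsetI)
    fix \<alpha>
    assume \<alpha>: "\<alpha> \<in> words k n"
    then have "h \<alpha> \<in> words k n"
      unfolding h_def using words_lists[OF \<alpha> i] i s by (intro words_upd) auto
    then have "h \<alpha> \<in> X"
      by (simp add: X_def h_def)
    moreover have "g (h \<alpha>) = \<alpha>"
      by (simp add: g_def h_def)
    ultimately show "\<alpha> \<in> g ` X"
      by force
  next
    fix \<alpha>
    assume "\<alpha> \<in> g ` X"
    then obtain \<beta> where \<beta>: "\<alpha> = g \<beta>" "\<beta> \<in> words k n"
      by (auto simp: X_def)
    have "set (tl (\<beta> i)) \<subseteq> set (\<beta> i)"
      by (cases "\<beta> i") auto
    then show "\<alpha> \<in> words k n"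
      unfolding \<beta>(1) g_def using words_lists[OF \<beta>(2) i] i \<beta>(2)
      by (intro words_upd) auto
  qed
  have eq: "std_shift k n lam i s = wcomp X (twist_coeff lam i s) g"
    by (simp add: std_shift_def X_def g_def[abs_def])
  show app: "ell2_fun (std_shift k n lam i s f) \<beta> =
      (if \<beta> \<in> words k n \<and> \<beta> i \<noteq> [] \<and> hd (\<beta> i) = s
       then twist_coeff lam i s \<beta> * ell2_fun f (\<beta>(i := tl (\<beta> i))) else 0)" for f \<beta>
    unfolding eq by (subst wcomp_apply[OF inj c]) (auto simp: X_def g_def)
  have "adj (std_shift k n lam i s) = wcomp (words k n) (\<lambda>y. cnj (twist_coeff lam i s (h y))) h"
    unfolding eq by (rule adj_wcomp[OF inj c hg Y])
  moreover have "inj_on h (words k n)"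
    using hg by (auto simp: Y inj_on_def)
  moreover have "cmod (cnj (twist_coeff lam i s (h y))) \<le> 1" if "y \<in> words k n" for y
    using cmod_twist_coeff[OF lam that i s] by (simp add: h_def)
  ultimately show "ell2_fun (adj (std_shift k n lam i s) f) \<beta> =
      (if \<beta> \<in> words k n then cnj (twist_coeff lam i s \<beta>) * ell2_fun f (\<beta>(i := s # \<beta> i)) else 0)"
    by (simp add: wcomp_apply) (simp add: h_def)
  have "std_shift k n lam i s f = 0" if "\<forall>h\<in>fock_space k n. cinner f h = 0" for f
  proof (rule ell2_eqI)
    fix \<beta>
    have "ell2_fun f (g \<beta>) = 0" if "\<beta> \<in> X"
      using \<open>\<forall>h\<in>_. _\<close> that Y by (intro fock_space_orthogonal[of k n]) auto
    then show "ell2_fun (std_shift k n lam i s f) \<beta> = ell2_fun 0 \<beta>"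
      by (auto simp: app zero_ell2.rep_eq X_def g_def)
  qed
  moreover have "std_shift k n lam i s \<in> bounded_ops UNIV"
    unfolding eq using inj c by (rule wcomp_mem_bounded_ops)
  ultimately show "std_shift k n lam i s \<in> bounded_ops (fock_space k n)"
    by (auto simp: bounded_ops_def fock_space_def app)
qed

text \<open>The definite description is unambiguous: outside \<open>words k n\<close> the basis
  vectors are orthogonal to the Fock space and are therefore killed by all its operators, and inside
  their images are prescribed.\<close>

lemma standard_tuple_eq:
  assumes i: "i \<in> {1..k}" and s: "s \<in> {1..n i}"
  shows "standard_tuple k n lam i s = std_shift k n lam i s"
  unfolding standard_tuple_def
proof (rule the_equality, intro conjI ballI std_shift_mem_bounded_ops[OF i s])
  have chi: "std_shift k n lam i s (chi \<alpha>)
      = (\<Prod>j\<in>{1..<i}. word_twist lam i j s (\<alpha> j)) *\<^sub>C chi (\<alpha>(i := s # \<alpha> i))"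
    if "\<alpha> \<in> words k n" for \<alpha>
  proof (rule ell2_eqI)
    fix \<beta>
    have "\<beta> \<in> words k n \<and> \<beta> i \<noteq> [] \<and> hd (\<beta> i) = s \<and> \<beta>(i := tl (\<beta> i)) = \<alpha> \<longleftrightarrow> \<beta> = \<alpha>(i := s # \<alpha> i)"
      using words_upd[OF that i, of "s # \<alpha> i"] words_lists[OF that i] s by auto
    then show "ell2_fun (std_shift k n lam i s (chi \<alpha>)) \<beta> =
        ell2_fun ((\<Prod>j\<in>{1..<i}. word_twist lam i j s (\<alpha> j)) *\<^sub>C chi (\<alpha>(i := s # \<alpha> i))) \<beta>"
      unfolding twist_coeff_def[symmetric]
      by (auto simp: std_shift_apply[OF i s] scaleC_ell2.rep_eq chi.rep_eq)
  qed
  then show "std_shift k n lam i s (chi \<alpha>)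
      = (\<Prod>j\<in>{1..<i}. word_twist lam i j s (\<alpha> j)) *\<^sub>C chi (\<alpha>(i := s # \<alpha> i))"
    if "\<alpha> \<in> words k n" for \<alpha>
    using that .
  fix T
  assume T: "T \<in> bounded_ops (fock_space k n) \<and> (\<forall>\<alpha>\<in>words k n. T (chi \<alpha>) =
      (\<Prod>j\<in>{1..<i}. word_twist lam i j s (\<alpha> j)) *\<^sub>C chi (\<alpha>(i := s # \<alpha> i)))"
  have zero: "R (chi \<alpha>) = 0" if "\<alpha> \<notin> words k n" "R \<in> bounded_ops (fock_space k n)" for R \<alpha>
    by (rule bounded_opsD(3)[OF that(2)])
      (use that(1) in \<open>auto simp: cinner_chi_left fock_space_def\<close>)
  show "T = std_shift k n lam i s"
  proof (rule ell2_op_eqI)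
    show "T (chi \<alpha>) = std_shift k n lam i s (chi \<alpha>)" for \<alpha>
      using T chi zero std_shift_mem_bounded_ops[OF i s] by (cases "\<alpha> \<in> words k n") auto
  qed (use T std_shift_mem_bounded_ops[OF i s] bounded_ops_subset_UNIV in auto)
qed

lemma std_shift_row_isometry:
  assumes i: "i \<in> {1..k}" and s: "s \<in> {1..n i}" and t: "t \<in> {1..n i}"
  shows "adj (std_shift k n lam i s) o\<^sub>L std_shift k n lam i t =
    (if s = t then id_op (fock_space k n) else 0)"
proof (intro blinfun_eqI ell2_eqI)
  fix f \<alpha>
  show "ell2_fun ((adj (std_shift k n lam i s) o\<^sub>L std_shift k n lam i t) f) \<alpha> =
      ell2_fun ((if s = t then id_op (fock_space k n) else 0) f) \<alpha>"
  proof (cases "\<alpha> \<in> words k n")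
    case True
    then have "\<alpha>(i := s # \<alpha> i) \<in> words k n"
      using words_lists[OF True i] i s by (intro words_upd) auto
    moreover have "cnj (twist_coeff lam i s \<alpha>) * twist_coeff lam i s \<alpha> = 1"
      using twist_coeff_mult_cnj[OF lam True i s] by (simp add: mult.commute)
    ultimately show ?thesis
      using True by (auto simp: adj_std_shift_apply[OF i s] std_shift_apply[OF i t]
          id_op_fock_space zero_ell2.rep_eq simp flip: mult.assoc)
  qed (auto simp: adj_std_shift_apply[OF i s] id_op_fock_space zero_ell2.rep_eq)
qed

lemma std_shift_doubly_commuting:
  assumes i: "i \<in> {1..k}" and j: "j \<in> {1..k}" and ij: "i \<noteq> j"
    and s: "s \<in> {1..n i}" and t: "t \<in> {1..n j}"
  shows "adj (std_shift k n lam i s) o\<^sub>L std_shift k n lam j t =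
    cnj (lam i j s t) *\<^sub>C (std_shift k n lam j t o\<^sub>L adj (std_shift k n lam i s))"
proof (intro blinfun_eqI ell2_eqI)
  fix f \<alpha>
  let ?S = "std_shift k n lam"
  show "ell2_fun ((adj (?S i s) o\<^sub>L ?S j t) f) \<alpha> =
      ell2_fun ((cnj (lam i j s t) *\<^sub>C (?S j t o\<^sub>L adj (?S i s))) f) \<alpha>"
  proof (cases "\<alpha> \<in> words k n \<and> \<alpha> j \<noteq> [] \<and> hd (\<alpha> j) = t")
    case True
    define w where "w = tl (\<alpha> j)"
    have \<alpha>: "\<alpha> \<in> words k n" and \<alpha>j: "\<alpha> j = t # w"
      using True by (auto simp: w_def)
    have up: "\<alpha>(i := s # \<alpha> i) \<in> words k n" "\<alpha>(j := w) \<in> words k n"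
      using words_lists[OF \<alpha> i] words_lists[OF \<alpha> j] i j s \<alpha> \<alpha>j by (auto intro!: words_upd)
    have \<alpha>_eq: "\<alpha>(j := t # w) = \<alpha>"
      using \<alpha>j by auto
    have "cnj (twist_coeff lam i s \<alpha>) * twist_coeff lam j t (\<alpha>(i := s # \<alpha> i)) =
        cnj (lam i j s t) * (twist_coeff lam j t \<alpha> * cnj (twist_coeff lam i s (\<alpha>(j := w))))"
    \<comment> \<open>The scalar comes from the shift with the larger row index, the only one whose
      twist reads the word in the other slot. For \<open>i < j\<close> it appears as
      \<open>lam j i t s\<close>, the conjugate of \<open>lam i j s t\<close>.\<close>
    proof (cases "j < i")
      case True
      then show ?thesis
        using twist_coeff_upd_Cons[of j i lam s \<alpha> t w] j by (simp add: \<alpha>_eq)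
    next
      case False
      moreover have "lam j i t s = cnj (lam i j s t)"
        using lam i j ij s t unfolding twist_matrices_def by blast
      ultimately show ?thesis
        using twist_coeff_upd_Cons[of i j lam t \<alpha> s "\<alpha> i"] i ij by simp
    qed
    moreover have "ell2_fun ((adj (?S i s) o\<^sub>L ?S j t) f) \<alpha> = cnj (twist_coeff lam i s \<alpha>) *
        (twist_coeff lam j t (\<alpha>(i := s # \<alpha> i)) * ell2_fun f (\<alpha>(i := s # \<alpha> i, j := w)))"
      using up(1) \<alpha> \<alpha>j ij unfolding blinfun_apply_blinfun_compose adj_std_shift_apply[OF i s]
        std_shift_apply[OF j t] by simp
    moreover have "ell2_fun ((cnj (lam i j s t) *\<^sub>C (?S j t o\<^sub>L adj (?S i s))) f) \<alpha> =
        cnj (lam i j s t) * (twist_coeff lam j t \<alpha> * (cnj (twist_coeff lam i s (\<alpha>(j := w))) *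
          ell2_fun f (\<alpha>(j := w, i := s # \<alpha> i))))"
      using up(2) \<alpha> \<alpha>j ij unfolding blinfun_apply_blinfun_compose scaleC_blinfun_apply
        scaleC_ell2.rep_eq adj_std_shift_apply[OF i s] std_shift_apply[OF j t] by simp
    ultimately show ?thesis
      unfolding fun_upd_twist[OF ij] by (simp only: mult.assoc[symmetric])
  next
    case False
    then show ?thesis
      using ij by (auto simp: adj_std_shift_apply[OF i s] std_shift_apply[OF j t] scaleC_ell2.rep_eq)
  qed
qed

lemma standard_tuple_doubly_commuting:
  "doubly_commuting_row_isometries (fock_space k n) k n lam (standard_tuple k n lam)"
  unfolding doubly_commuting_row_isometries_def row_isometry_def
  by (auto simp: standard_tuple_eq std_shift_mem_bounded_ops std_shift_row_isometry
      std_shift_doubly_commuting)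

end

section \<open>Doubly commuting row isometries\<close>

locale commuting_rows =
  fixes K :: "'a::complex_hilbert set" and k :: nat and n :: "nat \<Rightarrow> nat"
    and lam :: "nat \<Rightarrow> nat \<Rightarrow> nat \<Rightarrow> nat \<Rightarrow> complex" and V :: "nat \<Rightarrow> nat \<Rightarrow> 'a \<Rightarrow>\<^sub>L 'a"
  assumes K: "closed_csubspace K" and lam: "twist_matrices k n lam"
    and V: "doubly_commuting_row_isometries K k n lam V"
begin

section \<open>Commutation relations of the rows\<close>

lemma V_mem: "i \<in> {1..k} \<Longrightarrow> s \<in> {1..n i} \<Longrightarrow> V i s \<in> bounded_ops K"
  using V by (auto simp: doubly_commuting_row_isometries_def row_isometry_def)

lemma V_mem_UNIV: "i \<in> {1..k} \<Longrightarrow> s \<in> {1..n i} \<Longrightarrow> V i s \<in> bounded_ops UNIV"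
  using V_mem bounded_ops_subset_UNIV by blast

lemma adj_V_mem: "i \<in> {1..k} \<Longrightarrow> s \<in> {1..n i} \<Longrightarrow> adj (V i s) \<in> bounded_ops K"
  using V_mem adj_mem_bounded_ops_subspace[OF K] by blast

lemma adj_V_compose_V:
  assumes "i \<in> {1..k}" "s \<in> {1..n i}" "t \<in> {1..n i}"
  shows "adj (V i s) o\<^sub>L V i t = (if s = t then id_op K else 0)"
  using V assms by (auto simp: doubly_commuting_row_isometries_def row_isometry_def)

lemma adj_V_V:
  assumes "i \<in> {1..k}" "s \<in> {1..n i}" "t \<in> {1..n i}"
  shows "adj (V i s) (V i t x) = (if s = t then id_op K x else 0)"
  using arg_cong[OF adj_V_compose_V[OF assms], of "\<lambda>T. T x"] by auto

lemma adj_V_V_swap: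
  assumes "i \<in> {1..k}" "j \<in> {1..k}" "i \<noteq> j" "s \<in> {1..n i}" "t \<in> {1..n j}"
  shows "adj (V i s) (V j t x) = cnj (lam i j s t) *\<^sub>C V j t (adj (V i s) x)"
proof -
  have "adj (V i s) o\<^sub>L V j t = cnj (lam i j s t) *\<^sub>C (V j t o\<^sub>L adj (V i s))"
    using V assms unfolding doubly_commuting_row_isometries_def by blast
  from arg_cong[OF this, of "\<lambda>T. T x"] show ?thesis
    by simp
qed

lemma lam_unimodular:
  assumes "i \<in> {1..k}" "j \<in> {1..k}" "i \<noteq> j" "s \<in> {1..n i}" "t \<in> {1..n j}"
  shows "lam j i t s = cnj (lam i j s t)" "cnj (lam i j s t) * lam i j s t = 1"
proof -
  have "cmod (lam i j s t) = 1" and swap: "lam j i t s = cnj (lam i j s t)"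
    using lam assms unfolding twist_matrices_def by blast+
  then show "cnj (lam i j s t) * lam i j s t = 1"
    using complex_norm_square[of "lam i j s t"] by (simp add: mult.commute)
  show "lam j i t s = cnj (lam i j s t)"
    by (rule swap)
qed

lemma norm_V:
  assumes "i \<in> {1..k}" "s \<in> {1..n i}" "x \<in> K"
  shows "norm (V i s x) = norm x"
proof -
  have "cinner (V i s x) (V i s x) = cinner x x"
    using assms by (simp add: adj_V_V id_op_apply[OF K] flip: cinner_adj_right[OF V_mem_UNIV])
  then have "(norm (V i s x))\<^sup>2 = (norm x)\<^sup>2"
    unfolding cinner_self of_real_eq_iff .
  then show ?thesis
    by simp
qed

text \<open>The definition relates only adjoints to isometries. The relation between the isometries
  follows from equality in Cauchy-Schwarz: both sides have the norm of \<open>x\<close>, and by the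
  given relation their inner product is the square of that norm.\<close>

lemma V_V_commute:
  assumes i: "i \<in> {1..k}" and j: "j \<in> {1..k}" and ij: "i \<noteq> j"
    and s: "s \<in> {1..n i}" and t: "t \<in> {1..n j}"
  shows "V i s (V j t x) = lam i j s t *\<^sub>C V j t (V i s x)"
proof -
  have main: "V i s (V j t x) = lam i j s t *\<^sub>C V j t (V i s x)" if x: "x \<in> K" for x
  proof -
    define a where "a = V i s (V j t x)"
    define b where "b = lam i j s t *\<^sub>C V j t (V i s x)"
    have VK: "V i s x \<in> K" "V j t x \<in> K"
      using bounded_opsD(2)[OF V_mem] i j s t by auto
    have "cmod (lam i j s t) = 1"
      using lam i j ij s t unfolding twist_matrices_def by blast
    then have norms: "norm a = norm x" "norm b = norm x"
      using i j s t x VK by (simp_all add: a_def b_def norm_scaleC norm_V)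
    have "cinner a b = cnj (lam i j s t) * cinner (V j t x) (adj (V i s) (V j t (V i s x)))"
      using i s by (simp add: a_def b_def cinner_scaleC_right cinner_adj_right V_mem_UNIV)
    also have "adj (V i s) (V j t (V i s x)) = cnj (lam i j s t) *\<^sub>C V j t x"
      using i j ij s t x by (simp add: adj_V_V_swap adj_V_V id_op_apply[OF K])
    also have "cnj (lam i j s t) * cinner (V j t x) (cnj (lam i j s t) *\<^sub>C V j t x)
        = (cnj (lam i j s t) * lam i j s t) * cinner (V j t x) (V j t x)"
      by (simp add: cinner_scaleC_right)
    also have "\<dots> = complex_of_real ((norm x)\<^sup>2)"
      unfolding lam_unimodular(2)[OF i j ij s t] cinner_self norm_V[OF j t x] by simp
    finally have "(norm (a - b))\<^sup>2 = 0"
      unfolding norm_diff_square norms by simp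
    then show ?thesis
      by (simp add: a_def b_def)
  qed
  \<comment> \<open>\<open>main\<close> compares norms and is confined to \<open>x \<in> K\<close>.
    Since \<open>V i s\<close> kills the orthogonal complement of \<open>K\<close>, inserting the
    projection covers all \<open>x\<close>.\<close>
  have V_id: "V i s (id_op K y) = V i s y" if "i \<in> {1..k}" "s \<in> {1..n i}" for i s y
    using arg_cong[OF id_op_compose_right[OF K V_mem[OF that]], of "\<lambda>T. T y"] by simp
  show ?thesis
    using main[of "id_op K x"] bounded_opsD(2)[OF id_op_mem_bounded_ops[OF K]] i j s t
    by (simp add: V_id)
qed

lemma adj_V_adj_V_commute:
  assumes i: "i \<in> {1..k}" and j: "j \<in> {1..k}" and ij: "i \<noteq> j"
    and s: "s \<in> {1..n i}" and t: "t \<in> {1..n j}"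
  shows "adj (V i s) (adj (V j t) x) = lam i j s t *\<^sub>C adj (V j t) (adj (V i s) x)"
proof (rule cinner_ext_right)
  fix y
  have "cinner y (adj (V i s) (adj (V j t) x)) = cinner (V j t (V i s y)) x"
    using i j s t by (simp add: cinner_adj_right V_mem_UNIV)
  also have "V j t (V i s y) = lam j i t s *\<^sub>C V i s (V j t y)"
    using i j ij s t by (intro V_V_commute) auto
  also have "cinner \<dots> x = cinner y (lam i j s t *\<^sub>C adj (V j t) (adj (V i s) x))"
    using i j s t
    by (simp add: cinner_adj_right V_mem_UNIV cinner_scaleC_left cinner_scaleC_right
        lam_unimodular(1)[OF i j ij s t])
  finally show "cinner y (adj (V i s) (adj (V j t) x))
      = cinner y (lam i j s t *\<^sub>C adj (V j t) (adj (V i s) x))" .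
qed

section \<open>Range projections and weighted defect operators\<close>

definition range_proj :: "nat \<Rightarrow> 'a \<Rightarrow>\<^sub>L 'a" where
  "range_proj j = (\<Sum>s\<in>{1..n j}. V j s o\<^sub>L adj (V j s))"

lemma range_proj_apply: "range_proj j x = (\<Sum>s\<in>{1..n j}. V j s (adj (V j s) x))"
  by (simp add: range_proj_def blinfun.sum_left)

lemma adj_V_range_proj:
  assumes "j \<in> {1..k}" "s \<in> {1..n j}"
  shows "adj (V j s) (range_proj j x) = adj (V j s) x"
proof -
  have "adj (V j s) (range_proj j x) = (\<Sum>t\<in>{1..n j}. if s = t then id_op K (adj (V j s) x) else 0)"
    unfolding range_proj_apply blinfun.sum_right
    using assms by (intro sum.cong) (auto simp: adj_V_V)
  also have "\<dots> = adj (V j s) x"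
    using assms bounded_opsD(2)[OF adj_V_mem] by (simp add: id_op_apply[OF K])
  finally show ?thesis .
qed

lemma cinner_range_proj_left:
  assumes "j \<in> {1..k}"
  shows "cinner (range_proj j x) y = (\<Sum>s\<in>{1..n j}. cinner (adj (V j s) x) (adj (V j s) y))"
  unfolding range_proj_apply cinner.sum_left
  using assms by (intro sum.cong) (auto simp: cinner_adj_right V_mem_UNIV)

text \<open>All three parts rest on \<open>cinner p x = cinner p p\<close> for
  \<open>p = range_proj j x\<close>: the vectors \<open>x - p\<close> and \<open>p\<close> are
  orthogonal, and Pythagoras applies to their combinations.\<close>

lemma norm_range_proj:
  assumes j: "j \<in> {1..k}"
  shows "(norm (range_proj j x))\<^sup>2 = (\<Sum>s\<in>{1..n j}. (norm (adj (V j s) x))\<^sup>2)"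
    and "(norm (a *\<^sub>R (x - range_proj j x) + b *\<^sub>R range_proj j x))\<^sup>2
      = a\<^sup>2 * ((norm x)\<^sup>2 - (norm (range_proj j x))\<^sup>2) + b\<^sup>2 * (norm (range_proj j x))\<^sup>2"
    and "norm (range_proj j x) \<le> norm x"
proof -
  define p where "p = range_proj j x"
  have pp: "cinner p p = (\<Sum>s\<in>{1..n j}. complex_of_real ((norm (adj (V j s) x))\<^sup>2))"
    unfolding p_def cinner_range_proj_left[OF j]
    using j by (intro sum.cong) (auto simp: adj_V_range_proj cinner_self)
  then show "(norm (range_proj j x))\<^sup>2 = (\<Sum>s\<in>{1..n j}. (norm (adj (V j s) x))\<^sup>2)"
    unfolding p_def cinner_self of_real_sum[symmetric] of_real_eq_iff .
  have px: "cinner p x = cinner p p"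
    unfolding pp unfolding p_def cinner_range_proj_left[OF j]
    using j by (intro sum.cong) (auto simp: adj_V_range_proj cinner_self)
  then have xp: "cinner x p = cinner p p"
    by (metis cinner_commute)
  have diff: "(norm (x - p))\<^sup>2 = (norm x)\<^sup>2 - (norm p)\<^sup>2"
    by (simp add: norm_diff_square xp cinner_self)
  have "(norm (a *\<^sub>R (x - p) + b *\<^sub>R p))\<^sup>2 = (norm (a *\<^sub>R (x - p)))\<^sup>2 + (norm (b *\<^sub>R p))\<^sup>2"
    by (rule norm_add_orthogonal_square)
      (simp add: cinner.scaleR_left cinner.scaleR_right cinner.diff_left xp)
  then show "(norm (a *\<^sub>R (x - range_proj j x) + b *\<^sub>R range_proj j x))\<^sup>2
      = a\<^sup>2 * ((norm x)\<^sup>2 - (norm (range_proj j x))\<^sup>2) + b\<^sup>2 * (norm (range_proj j x))\<^sup>2"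
    unfolding p_def[symmetric] by (simp add: power_mult_distrib diff)
  have "(norm p)\<^sup>2 \<le> (norm x)\<^sup>2"
    using diff zero_le_power2[of "norm (x - p)"] by linarith
  then show "norm (range_proj j x) \<le> norm x"
    unfolding p_def[symmetric] by (rule power2_le_imp_le) simp
qed

lemma range_proj_mem: "j \<in> {1..k} \<Longrightarrow> range_proj j \<in> bounded_ops K"
  unfolding range_proj_def
  by (intro cstar_algebra_sum cstar_algebraD(5)[OF cstar_algebra_bounded_ops] K V_mem adj_V_mem
      cstar_algebra_bounded_ops)

text \<open>For \<open>a = 1\<close> and \<open>b = 0\<close> this is the defect projection of the
  Poisson kernel. The weight \<open>b\<close> retains part of the mass that would otherwise pass on
  to longer words.\<close>

definition defect :: "real \<Rightarrow> real \<Rightarrow> nat \<Rightarrow> 'a \<Rightarrow>\<^sub>L 'a" where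
  "defect a b j = a *\<^sub>R (id_op K - range_proj j) + b *\<^sub>R range_proj j"

lemma defect_apply: "x \<in> K \<Longrightarrow> defect a b j x = a *\<^sub>R (x - range_proj j x) + b *\<^sub>R range_proj j x"
  by (simp add: defect_def blinfun.add_left blinfun.diff_left blinfun.scaleR_left id_op_apply[OF K])

lemma defect_mem: "j \<in> {1..k} \<Longrightarrow> defect a b j \<in> bounded_ops K"
  unfolding defect_def
  by (intro cstar_algebraD[OF cstar_algebra_bounded_ops[OF K]] id_op_mem_bounded_ops K range_proj_mem)

text \<open>Passing an adjoint of row \<open>i\<close> through \<open>V j t\<close> and through the
  adjoint of \<open>V j t\<close> costs conjugate unimodular scalars, which cancel.\<close>

lemma adj_V_defect:
  assumes i: "i \<in> {1..k}" and j: "j \<in> {1..k}" and ij: "i \<noteq> j" and s: "s \<in> {1..n i}" and x: "x \<in> K"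
  shows "adj (V i s) (defect a b j x) = defect a b j (adj (V i s) x)"
proof -
  have "adj (V i s) (range_proj j x) = range_proj j (adj (V i s) x)"
    unfolding range_proj_apply blinfun.sum_right
  proof (rule sum.cong[OF refl])
    fix t
    assume t: "t \<in> {1..n j}"
    have "adj (V i s) (V j t (adj (V j t) x))
        = (cnj (lam i j s t) * lam i j s t) *\<^sub>C V j t (adj (V j t) (adj (V i s) x))"
      unfolding adj_V_V_swap[OF i j ij s t] adj_V_adj_V_commute[OF i j ij s t]
        bounded_opsD(1)[OF V_mem[OF j t]] scaleC_scaleC ..
    then show "adj (V i s) (V j t (adj (V j t) x)) = V j t (adj (V j t) (adj (V i s) x))"
      by (simp add: lam_unimodular(2)[OF i j ij s t])
  qed
  moreover have "adj (V i s) x \<in> K"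
    using bounded_opsD(2)[OF adj_V_mem] i s by blast
  ultimately show ?thesis
    using x by (simp add: defect_apply blinfun.add_right blinfun.diff_right blinfun.scaleR_right)
qed

text \<open>The adjoint of V_w for the word \<open>w\<close>, with the first letter acting first, so
  that prepending a letter, as a shift does, composes with an adjoint on the right.\<close>

primrec adj_word :: "nat \<Rightarrow> nat list \<Rightarrow> 'a \<Rightarrow>\<^sub>L 'a" where
  "adj_word j [] = id_op K"
| "adj_word j (s # w) = adj_word j w o\<^sub>L adj (V j s)"

lemma adj_word_mem:
  assumes "j \<in> {1..k}" "set w \<subseteq> {1..n j}"
  shows "adj_word j w \<in> bounded_ops K"
  using assms(2)
proof (induction w)
  case Nil
  then show ?case
    by (simp add: id_op_mem_bounded_ops K)
next
  case (Cons s w)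
  then show ?case
    using adj_V_mem[OF assms(1), of s]
    by (simp add: cstar_algebraD(5)[OF cstar_algebra_bounded_ops[OF K]])
qed

lemma adj_V_adj_word:
  assumes i: "i \<in> {1..k}" and j: "j \<in> {1..k}" and ij: "i \<noteq> j" and s: "s \<in> {1..n i}"
    and w: "set w \<subseteq> {1..n j}" and x: "x \<in> K"
  shows "adj (V i s) (adj_word j w x) = word_twist lam i j s w *\<^sub>C adj_word j w (adj (V i s) x)"
  using w x
proof (induction w arbitrary: x)
  case Nil
  then show ?case
    using bounded_opsD(2)[OF adj_V_mem] i s by (simp add: word_twist_def id_op_apply[OF K])
next
  case (Cons t w)
  have mem: "adj (V j t) x \<in> K" "adj_word j w \<in> bounded_ops K"
    using bounded_opsD(2)[OF adj_V_mem] j Cons.prems(1) by (auto intro!: adj_word_mem)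
  have t: "t \<in> {1..n j}" and w: "set w \<subseteq> {1..n j}"
    using Cons.prems(1) by auto
  have "adj (V i s) (adj_word j (t # w) x)
      = word_twist lam i j s w *\<^sub>C adj_word j w (adj (V i s) (adj (V j t) x))"
    using Cons.IH[OF w mem(1)] by simp
  also have "adj (V i s) (adj (V j t) x) = lam i j s t *\<^sub>C adj (V j t) (adj (V i s) x)"
    by (rule adj_V_adj_V_commute[OF i j ij s t])
  finally show ?case
    by (simp add: bounded_opsD(1)[OF mem(2)] scaleC_scaleC word_twist_def mult.commute)
qed

definition word_op :: "(nat \<Rightarrow> real) \<Rightarrow> (nat \<Rightarrow> real) \<Rightarrow> nat \<Rightarrow> nat list \<Rightarrow> 'a \<Rightarrow>\<^sub>L 'a" where
  "word_op a b j w = defect (a (length w)) (b (length w)) j o\<^sub>L adj_word j w"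

lemma word_op_mem:
  assumes "j \<in> {1..k}" "set w \<subseteq> {1..n j}"
  shows "word_op a b j w \<in> bounded_ops K"
  unfolding word_op_def
  by (intro cstar_algebraD[OF cstar_algebra_bounded_ops[OF K]] defect_mem adj_word_mem assms)

text \<open>The source of the intertwining error: a letter in front is exchanged for an adjoint of
  \<open>V\<close>, but the weights are then read one level higher.\<close>

lemma word_op_Cons:
  "word_op a b j (s # w) = word_op (\<lambda>m. a (Suc m)) (\<lambda>m. b (Suc m)) j w o\<^sub>L adj (V j s)"
  by (rule blinfun_eqI) (simp add: word_op_def)

lemma word_op_diff:
  "word_op a b j w - word_op a' b' j w = word_op (\<lambda>m. a m - a' m) (\<lambda>m. b m - b' m) j w"
  by (rule blinfun_eqI) (simp add: word_op_def defect_def blinfun.diff_left blinfun.add_left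
      blinfun.scaleR_left algebra_simps)

lemma word_op_eq_0: "a (length w) = 0 \<Longrightarrow> b (length w) = 0 \<Longrightarrow> word_op a b j w = 0"
  by (rule blinfun_eqI) (simp add: word_op_def defect_def)

lemma adj_V_word_op:
  assumes i: "i \<in> {1..k}" and j: "j \<in> {1..k}" and ij: "i \<noteq> j" and s: "s \<in> {1..n i}"
    and w: "set w \<subseteq> {1..n j}" and x: "x \<in> K"
  shows "adj (V i s) (word_op a b j w x) = word_twist lam i j s w *\<^sub>C word_op a b j w (adj (V i s) x)"
proof -
  have "adj_word j w x \<in> K"
    using bounded_opsD(2)[OF adj_word_mem[OF j w]] .
  then show ?thesis
    using adj_V_adj_word[OF assms]
    by (simp add: word_op_def adj_V_defect[OF i j ij s] bounded_opsD(1)[OF defect_mem[OF j]])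
qed

section \<open>Mass on the words of a given length\<close>

definition length_words :: "nat \<Rightarrow> nat \<Rightarrow> nat list set" where
  "length_words j m = {w. set w \<subseteq> {1..n j} \<and> length w = m}"

definition short_words :: "nat \<Rightarrow> nat \<Rightarrow> nat list set" where
  "short_words j N = {w. set w \<subseteq> {1..n j} \<and> length w \<le> N}"

lemma finite_length_words: "finite (length_words j m)"
  unfolding length_words_def by (rule finite_lists_length_eq) simp

lemma finite_short_words: "finite (short_words j N)"
  unfolding short_words_def by (rule finite_lists_length_le) simp

lemma sum_length_words_Suc:
  "(\<Sum>w\<in>length_words j (Suc m). f w) = (\<Sum>s\<in>{1..n j}. \<Sum>w\<in>length_words j m. f (s # w))"
proof -
  have "length_words j (Suc m) = (\<lambda>(s, w). s # w) ` ({1..n j} \<times> length_words j m)"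
  proof (intro equalityI subsetI)
    fix w
    assume "w \<in> length_words j (Suc m)"
    then show "w \<in> (\<lambda>(s, w). s # w) ` ({1..n j} \<times> length_words j m)"
      by (cases w) (auto simp: length_words_def)
  qed (auto simp: length_words_def)
  then show ?thesis
    by (simp add: sum.reindex inj_on_def case_prod_unfold sum.cartesian_product)
qed

lemma sum_short_words:
  "(\<Sum>w\<in>short_words j N. f w) = (\<Sum>m\<le>N. \<Sum>w\<in>length_words j m. f w)"
proof -
  have "short_words j N = (\<Union>m\<in>{..N}. length_words j m)"
    by (auto simp: short_words_def length_words_def)
  then show ?thesis
    by (simp only:) (rule sum.UNION_disjoint, simp, simp add: finite_length_words,
      auto simp: length_words_def)
qed

text \<open>For \<open>x\<close> in \<open>K\<close> this is the squared norm of the projection of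
  \<open>x\<close> onto the span of the ranges of the V_w with \<open>w\<close> of length
  \<open>m\<close>. It decreases in \<open>m\<close> but need not tend to 0.\<close>

definition level_mass :: "nat \<Rightarrow> 'a \<Rightarrow> nat \<Rightarrow> real" where
  "level_mass j x m = (\<Sum>w\<in>length_words j m. (norm (adj_word j w x))\<^sup>2)"

lemma level_mass_0: "x \<in> K \<Longrightarrow> level_mass j x 0 = (norm x)\<^sup>2"
proof -
  have "length_words j 0 = {[]}"
    by (auto simp: length_words_def)
  then show "x \<in> K \<Longrightarrow> level_mass j x 0 = (norm x)\<^sup>2"
    by (simp add: level_mass_def id_op_apply[OF K])
qed

lemma level_mass_Suc: "level_mass j x (Suc m) = (\<Sum>s\<in>{1..n j}. level_mass j (adj (V j s) x) m)"
  by (simp add: level_mass_def sum_length_words_Suc)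

text \<open>The range projection appends a letter at the end of \<open>w\<close>, whereas
  \<open>level_mass_Suc\<close> removes one in front; the induction reconciles the two.\<close>

lemma sum_norm_range_proj:
  assumes j: "j \<in> {1..k}" and x: "x \<in> K"
  shows "(\<Sum>w\<in>length_words j m. (norm (range_proj j (adj_word j w x)))\<^sup>2) = level_mass j x (Suc m)"
  using x
proof (induction m arbitrary: x)
  case 0
  have "length_words j 0 = {[]}"
    by (auto simp: length_words_def)
  moreover have "adj (V j s) x \<in> K" if "s \<in> {1..n j}" for s
    using bounded_opsD(2)[OF adj_V_mem[OF j that]] .
  ultimately show ?case
    using 0 by (simp add: level_mass_Suc level_mass_0 id_op_apply[OF K] norm_range_proj(1)[OF j])
next
  case (Suc m)
  have "adj (V j s) x \<in> K" if "s \<in> {1..n j}" for s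
    using bounded_opsD(2)[OF adj_V_mem[OF j that]] .
  then show ?case
    using Suc by (simp add: sum_length_words_Suc level_mass_Suc[of _ _ "Suc m"])
qed

lemma sum_norm_word_op:
  assumes j: "j \<in> {1..k}" and x: "x \<in> K"
  shows "(\<Sum>w\<in>length_words j m. (norm (word_op a b j w x))\<^sup>2)
    = (a m)\<^sup>2 * (level_mass j x m - level_mass j x (Suc m)) + (b m)\<^sup>2 * level_mass j x (Suc m)"
proof -
  have "(norm (word_op a b j w x))\<^sup>2 = (a m)\<^sup>2 * (norm (adj_word j w x))\<^sup>2
      - (a m)\<^sup>2 * (norm (range_proj j (adj_word j w x)))\<^sup>2
      + (b m)\<^sup>2 * (norm (range_proj j (adj_word j w x)))\<^sup>2" if "w \<in> length_words j m" for w
  proof -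
    have "adj_word j w x \<in> K"
      using bounded_opsD(2)[OF adj_word_mem[OF j]] that by (simp add: length_words_def)
    moreover have "length w = m"
      using that by (simp add: length_words_def)
    ultimately show ?thesis
      by (simp add: word_op_def defect_apply norm_range_proj(2)[OF j] right_diff_distrib)
  qed
  then have "(\<Sum>w\<in>length_words j m. (norm (word_op a b j w x))\<^sup>2)
      = (a m)\<^sup>2 * (\<Sum>w\<in>length_words j m. (norm (adj_word j w x))\<^sup>2)
      - (a m)\<^sup>2 * (\<Sum>w\<in>length_words j m. (norm (range_proj j (adj_word j w x)))\<^sup>2)
      + (b m)\<^sup>2 * (\<Sum>w\<in>length_words j m. (norm (range_proj j (adj_word j w x)))\<^sup>2)"
    by (simp add: sum.distrib sum_subtractf sum_distrib_left)
  then show ?thesis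
    unfolding sum_norm_range_proj[OF j x] by (simp add: level_mass_def right_diff_distrib)
qed

lemma level_mass_bounds:
  assumes j: "j \<in> {1..k}" and x: "x \<in> K"
  shows "0 \<le> level_mass j x m" "level_mass j x (Suc m) \<le> level_mass j x m"
    "level_mass j x m \<le> (norm x)\<^sup>2"
proof -
  show nonneg: "0 \<le> level_mass j x m" for m
    by (simp add: level_mass_def sum_nonneg)
  have step: "level_mass j x (Suc m) \<le> level_mass j x m" for m
    unfolding sum_norm_range_proj[OF j x, symmetric] unfolding level_mass_def
    by (intro sum_mono power_mono norm_range_proj(3)[OF j]) simp
  then show "level_mass j x (Suc m) \<le> level_mass j x m" .
  show "level_mass j x m \<le> (norm x)\<^sup>2"
  proof (induction m)
    case (Suc m)
    then show ?case
      using step[of m] by simp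
  qed (simp add: level_mass_0[OF x])
qed

text \<open>The squares of \<open>wt_a\<close> and \<open>wt_b\<close> are averages over M = 0, ...,
  N - 1 of the sharp cut-off at level M, which uses the defect projection below M, the identity at M
  and 0 above. Truncated subtraction makes \<open>wt_a\<close> vanish from level \<open>N\<close>
  on.\<close>

definition wt_a :: "nat \<Rightarrow> nat \<Rightarrow> real" where
  "wt_a N m = sqrt (real (N - m) / real N)"

definition wt_b :: "nat \<Rightarrow> nat \<Rightarrow> real" where
  "wt_b N m = (if m < N then sqrt (1 / real N) else 0)"

text \<open>The weights are chosen so that the sum of the squared norms over all words telescopes.\<close>

lemma sum_norm_word_op_weights:
  assumes N: "0 < N" and j: "j \<in> {1..k}" and x: "x \<in> K"
  shows "(\<Sum>w\<in>short_words j N. (norm (word_op (wt_a N) (wt_b N) j w x))\<^sup>2) = (norm x)\<^sup>2"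
proof -
  define p where "p = level_mass j x"
  \<comment> \<open>The telescoping quantity: \<open>f 0\<close> is the full mass, and
    \<open>f (Suc N)\<close> is 0 by truncated subtraction.\<close>
  define f where "f m = real (N - m) / real N * p m" for m
  have "(\<Sum>w\<in>short_words j N. (norm (word_op (wt_a N) (wt_b N) j w x))\<^sup>2)
      = (\<Sum>m\<le>N. (wt_a N m)\<^sup>2 * (p m - p (Suc m)) + (wt_b N m)\<^sup>2 * p (Suc m))"
    by (simp add: sum_short_words sum_norm_word_op[OF j x] p_def)
  also have "\<dots> = (\<Sum>m\<le>N. f m - f (Suc m))"
  proof (rule sum.cong[OF refl])
    fix m
    assume "m \<in> {..N}"
    then show "(wt_a N m)\<^sup>2 * (p m - p (Suc m)) + (wt_b N m)\<^sup>2 * p (Suc m) = f m - f (Suc m)"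
      using N by (cases "m = N") (auto simp: wt_a_def wt_b_def f_def of_nat_diff field_simps)
  qed
  also have "\<dots> = f 0 - f (Suc N)"
    by (rule sum_telescope)
  also have "\<dots> = (norm x)\<^sup>2"
    using N by (simp add: f_def p_def level_mass_0[OF x])
  finally show ?thesis .
qed

text \<open>Neighbouring squares of \<open>wt_a\<close> differ by at most \<open>1 / N\<close>,
  hence so do the squared differences of the roots, and the masses they multiply telescope.
  \<open>wt_b\<close> is constant except for its jump to 0 between the levels \<open>N - 1\<close>
  and \<open>N\<close>. Each of the two effects contributes \<open>1 / N\<close>.\<close>

lemma sum_norm_word_op_weight_shift:
  assumes N: "0 < N" and j: "j \<in> {1..k}" and x: "x \<in> K"
  shows "(\<Sum>w\<in>short_words j N. (norm (word_op (\<lambda>m. wt_a N (Suc m) - wt_a N m)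
      (\<lambda>m. wt_b N (Suc m) - wt_b N m) j w x))\<^sup>2) \<le> 2 / real N * (norm x)\<^sup>2"
proof -
  define p where "p = level_mass j x"
  note p = level_mass_bounds[OF j x, folded p_def]
  have "(\<Sum>w\<in>short_words j N. (norm (word_op (\<lambda>m. wt_a N (Suc m) - wt_a N m)
      (\<lambda>m. wt_b N (Suc m) - wt_b N m) j w x))\<^sup>2)
      = (\<Sum>m\<le>N. (wt_a N (Suc m) - wt_a N m)\<^sup>2 * (p m - p (Suc m))
          + (wt_b N (Suc m) - wt_b N m)\<^sup>2 * p (Suc m))"
    by (simp add: sum_short_words sum_norm_word_op[OF j x] p_def)
  also have "\<dots> \<le> (\<Sum>m\<le>N. 1 / real N * (p m - p (Suc m)) + (if m = N - 1 then (norm x)\<^sup>2 / real N else 0))"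
  proof (intro sum_mono add_mono)
    fix m
    assume m: "m \<in> {..N}"
    have sq: "(sqrt u - sqrt v)\<^sup>2 \<le> v - u" if "0 \<le> u" "u \<le> v" for u v :: real
    proof -
      have "sqrt u * sqrt u \<le> sqrt u * sqrt v"
        using that by (intro mult_left_mono) auto
      then show ?thesis
        using that by (simp add: power2_diff)
    qed
    have "(wt_a N (Suc m) - wt_a N m)\<^sup>2 \<le> real (N - m) / real N - real (N - Suc m) / real N"
      unfolding wt_a_def by (rule sq) (auto simp: divide_right_mono)
    also have "\<dots> \<le> 1 / real N"
      using m N by (cases "m = N") (auto simp: of_nat_diff field_simps)
    finally show "(wt_a N (Suc m) - wt_a N m)\<^sup>2 * (p m - p (Suc m)) \<le> 1 / real N * (p m - p (Suc m))"
      using p(2) by (intro mult_right_mono) auto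
    show "(wt_b N (Suc m) - wt_b N m)\<^sup>2 * p (Suc m) \<le> (if m = N - 1 then (norm x)\<^sup>2 / real N else 0)"
    proof (cases "m = N - 1")
      case True
      then have "wt_b N (Suc m) = 0" "wt_b N m = sqrt (1 / real N)"
        using N by (auto simp: wt_b_def)
      then show ?thesis
        using True N p(3)[of "Suc m"] by (simp add: divide_right_mono)
    next
      case False
      then have "wt_b N (Suc m) = wt_b N m"
        using m N by (auto simp: wt_b_def)
      then show ?thesis
        using False by simp
    qed
  qed
  also have "\<dots> = 1 / real N * (p 0 - p (Suc N)) + (norm x)\<^sup>2 / real N"
    by (simp add: sum.distrib sum_telescope flip: sum_divide_distrib)
  also have "\<dots> \<le> 2 / real N * (norm x)\<^sup>2"
    using p(1)[of "Suc N"] level_mass_0[OF x, of j] N by (simp add: p_def field_simps)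
  finally show ?thesis .
qed

end

section \<open>Families indexed by tuples of words\<close>

text \<open>Factor 1 acts first: an adjoint that enters in slot \<open>i\<close> has to pass exactly
  the factors \<open>j < i\<close> on its way to \<open>x\<close>, those that occur in the twist of
  S_i.\<close>

primrec op_seq :: "(nat \<Rightarrow> 'w \<Rightarrow> 'a::complex_hilbert \<Rightarrow>\<^sub>L 'a) \<Rightarrow> nat \<Rightarrow> (nat \<Rightarrow> 'w) \<Rightarrow> 'a \<Rightarrow> 'a" where
  "op_seq T 0 \<alpha> x = x"
| "op_seq T (Suc m) \<alpha> x = T (Suc m) (\<alpha> (Suc m)) (op_seq T m \<alpha> x)"

lemma op_seq_cong:
  "(\<And>j. j \<in> {1..m} \<Longrightarrow> T j (\<alpha> j) = T' j (\<beta> j)) \<Longrightarrow> op_seq T m \<alpha> x = op_seq T' m \<beta> x"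
  by (induction m) auto

lemma op_seq_mem:
  "(\<And>j. j \<in> {1..m} \<Longrightarrow> T j (\<alpha> j) \<in> bounded_ops H) \<Longrightarrow> x \<in> H \<Longrightarrow> op_seq T m \<alpha> x \<in> H"
  by (induction m) (auto intro: bounded_opsD(2))

lemma op_seq_scaleC:
  "(\<And>j. j \<in> {1..m} \<Longrightarrow> T j (\<alpha> j) \<in> bounded_ops H) \<Longrightarrow>
    op_seq T m \<alpha> (c *\<^sub>C x) = c *\<^sub>C op_seq T m \<alpha> x"
  by (induction m) (auto intro: bounded_opsD(1))

lemma op_seq_add: "op_seq T m \<alpha> (x + y) = op_seq T m \<alpha> x + op_seq T m \<alpha> y"
  by (induction m) (auto simp: blinfun.add_right)

lemma op_seq_diff: "op_seq T m \<alpha> (x - y) = op_seq T m \<alpha> x - op_seq T m \<alpha> y"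
  by (induction m) (auto simp: blinfun.diff_right)

lemma op_seq_eq_0: "j \<in> {1..m} \<Longrightarrow> T j (\<alpha> j) = 0 \<Longrightarrow> op_seq T m \<alpha> x = 0"
proof (induction m)
  case (Suc m)
  then show ?case
    by (cases "j = Suc m") (auto simp: blinfun.zero_right)
qed simp

lemma op_seq_upd_diff:
  assumes "i \<in> {1..m}" "\<And>w. T i w - T' w = D w"
  shows "op_seq T m \<alpha> x - op_seq (T(i := T')) m \<alpha> x = op_seq (T(i := D)) m \<alpha> x"
  using assms(1)
proof (induction m)
  case (Suc m)
  show ?case
  proof (cases "i = Suc m")
    case True
    have "op_seq (T(i := R)) m \<alpha> x = op_seq T m \<alpha> x" for R
      using True by (intro op_seq_cong) auto
    note eq = this[unfolded True]
    show ?thesis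
      unfolding True op_seq.simps fun_upd_same eq assms(2)[symmetric] blinfun.diff_left ..
  next
    case False
    with Suc show ?thesis
      by (simp flip: blinfun.diff_right)
  qed
qed simp

lemma sum_PiE_Suc:
  "(\<Sum>\<alpha>\<in>(\<Pi>\<^sub>E j\<in>{1..Suc m}. B j). f \<alpha>)
    = (\<Sum>\<alpha>\<in>(\<Pi>\<^sub>E j\<in>{1..m}. B j). \<Sum>w\<in>B (Suc m). f (\<alpha>(Suc m := w)))"
proof -
  have ins: "{1..Suc m} = insert (Suc m) {1..m}"
    by auto
  have "(\<Sum>\<alpha>\<in>(\<Pi>\<^sub>E j\<in>{1..Suc m}. B j). f \<alpha>)
      = (\<Sum>(w, \<alpha>)\<in>B (Suc m) \<times> (\<Pi>\<^sub>E j\<in>{1..m}. B j). f (\<alpha>(Suc m := w)))"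
    unfolding ins PiE_insert_eq
    by (subst sum.reindex[OF inj_combinator]) (auto simp: case_prod_unfold)
  also have "\<dots> = (\<Sum>w\<in>B (Suc m). \<Sum>\<alpha>\<in>(\<Pi>\<^sub>E j\<in>{1..m}. B j). f (\<alpha>(Suc m := w)))"
    by (rule sum.cartesian_product[symmetric])
  also have "\<dots> = (\<Sum>\<alpha>\<in>(\<Pi>\<^sub>E j\<in>{1..m}. B j). \<Sum>w\<in>B (Suc m). f (\<alpha>(Suc m := w)))"
    by (rule sum.swap)
  finally show ?thesis .
qed

lemma sum_norm_op_seq_Suc:
  "(\<Sum>\<alpha>\<in>(\<Pi>\<^sub>E j\<in>{1..Suc m}. B j). (norm (op_seq T (Suc m) \<alpha> x))\<^sup>2)
    = (\<Sum>\<alpha>\<in>(\<Pi>\<^sub>E j\<in>{1..m}. B j). \<Sum>w\<in>B (Suc m). (norm (T (Suc m) w (op_seq T m \<alpha> x)))\<^sup>2)"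
proof -
  have "op_seq T m (\<alpha>(Suc m := w)) x = op_seq T m \<alpha> x" for \<alpha> w
    by (rule op_seq_cong) auto
  then show ?thesis
    unfolding sum_PiE_Suc by (simp only: op_seq.simps fun_upd_same)
qed

lemma op_seq_mem_PiE:
  assumes "\<And>j w. j \<in> {1..Suc m} \<Longrightarrow> w \<in> B j \<Longrightarrow> T j w \<in> bounded_ops H"
    "\<alpha> \<in> (\<Pi>\<^sub>E j\<in>{1..m}. B j)" "x \<in> H"
  shows "op_seq T m \<alpha> x \<in> H"
  using assms by (intro op_seq_mem) (auto simp: PiE_iff)

lemma sum_norm_op_seq_eq:
  assumes T: "\<And>j w. j \<in> {1..m} \<Longrightarrow> w \<in> B j \<Longrightarrow> T j w \<in> bounded_ops H"
    and sum: "\<And>j y. j \<in> {1..m} \<Longrightarrow> y \<in> H \<Longrightarrow> (\<Sum>w\<in>B j. (norm (T j w y))\<^sup>2) = (norm y)\<^sup>2"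
    and x: "x \<in> H"
  shows "(\<Sum>\<alpha>\<in>(\<Pi>\<^sub>E j\<in>{1..m}. B j). (norm (op_seq T m \<alpha> x))\<^sup>2) = (norm x)\<^sup>2"
  using T sum
proof (induction m)
  case (Suc m)
  have "(\<Sum>\<alpha>\<in>(\<Pi>\<^sub>E j\<in>{1..Suc m}. B j). (norm (op_seq T (Suc m) \<alpha> x))\<^sup>2)
      = (\<Sum>\<alpha>\<in>(\<Pi>\<^sub>E j\<in>{1..m}. B j). (norm (op_seq T m \<alpha> x))\<^sup>2)"
    unfolding sum_norm_op_seq_Suc
    using op_seq_mem_PiE[OF Suc.prems(1) _ x] by (intro sum.cong refl Suc.prems(2)) auto
  also have "\<dots> = (norm x)\<^sup>2"
    using Suc.prems by (intro Suc.IH) auto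
  finally show ?case .
qed simp

lemma sum_norm_op_seq_le:
  assumes T: "\<And>j w. j \<in> {1..m} \<Longrightarrow> w \<in> B j \<Longrightarrow> T j w \<in> bounded_ops H"
    and sum: "\<And>j y. j \<in> {1..m} \<Longrightarrow> y \<in> H \<Longrightarrow> (\<Sum>w\<in>B j. (norm (T j w y))\<^sup>2) \<le> c j * (norm y)\<^sup>2"
    and c: "\<And>j. 0 \<le> c j" and x: "x \<in> H"
  shows "(\<Sum>\<alpha>\<in>(\<Pi>\<^sub>E j\<in>{1..m}. B j). (norm (op_seq T m \<alpha> x))\<^sup>2) \<le> (\<Prod>j\<in>{1..m}. c j) * (norm x)\<^sup>2"
  using T sum
proof (induction m)
  case (Suc m)
  have "(\<Sum>\<alpha>\<in>(\<Pi>\<^sub>E j\<in>{1..Suc m}. B j). (norm (op_seq T (Suc m) \<alpha> x))\<^sup>2)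
      \<le> (\<Sum>\<alpha>\<in>(\<Pi>\<^sub>E j\<in>{1..m}. B j). c (Suc m) * (norm (op_seq T m \<alpha> x))\<^sup>2)"
    unfolding sum_norm_op_seq_Suc
    using op_seq_mem_PiE[OF Suc.prems(1) _ x] by (intro sum_mono Suc.prems(2)) auto
  also have "\<dots> = c (Suc m) * (\<Sum>\<alpha>\<in>(\<Pi>\<^sub>E j\<in>{1..m}. B j). (norm (op_seq T m \<alpha> x))\<^sup>2)"
    by (rule sum_distrib_left[symmetric])
  also have "\<dots> \<le> c (Suc m) * ((\<Prod>j\<in>{1..m}. c j) * (norm x)\<^sup>2)"
    using Suc.prems by (intro mult_left_mono c Suc.IH) auto
  finally show ?case
    by (simp add: mult_ac)
qed simp

section \<open>Square summable families with values in a Hilbert space\<close>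

text \<open>A finitely supported family \<open>F\<close> of vectors of a Hilbert space is encoded by the antilinear map
  \<open>e \<mapsto> (\<alpha> \<mapsto> \<langle>F \<alpha>, e\<rangle>)\<close>; its Hilbert-Schmidt norm, approximated by finite orthonormal sets, is the
  norm of \<open>F\<close>, and an operator on the square summable sequences acts on the values.\<close>

definition coord_family :: "'x set \<Rightarrow> ('x \<Rightarrow> 'a::complex_hilbert) \<Rightarrow> 'a \<Rightarrow> 'x ell2" where
  "coord_family B F e = (\<Sum>\<alpha>\<in>B. cinner (F \<alpha>) e *\<^sub>C chi \<alpha>)"

lemma coord_family_apply:
  assumes "finite B"
  shows "ell2_fun (coord_family B F e) \<alpha> = (if \<alpha> \<in> B then cinner (F \<alpha>) e else 0)"
proof -
  have "ell2_fun (coord_family B F e) \<alpha> = (\<Sum>\<beta>\<in>B. if \<beta> = \<alpha> then cinner (F \<alpha>) e else 0)"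
    unfolding coord_family_def ell2_fun_sum
    by (rule sum.cong) (auto simp: scaleC_ell2.rep_eq chi.rep_eq)
  then show ?thesis
    using assms by simp
qed

lemma sum_norm_coord_family:
  assumes "finite B"
  shows "(\<Sum>e\<in>E. (norm (coord_family B F e))\<^sup>2) = (\<Sum>\<alpha>\<in>B. \<Sum>e\<in>E. (cmod (cinner (F \<alpha>) e))\<^sup>2)"
proof -
  have "(norm (coord_family B F e))\<^sup>2 = (\<Sum>\<alpha>\<in>B. (cmod (cinner (F \<alpha>) e))\<^sup>2)" for e
    using ell2_norm_square_finite_support[OF assms, of "coord_family B F e"]
    by (simp add: coord_family_apply assms)
  then show ?thesis
    by (simp only:) (rule sum.swap)
qed

lemma sum_norm_coord_family_le:
  assumes "finite B" "orthonormal E"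
  shows "(\<Sum>e\<in>E. (norm (coord_family B F e))\<^sup>2) \<le> (\<Sum>\<alpha>\<in>B. (norm (F \<alpha>))\<^sup>2)"
  unfolding sum_norm_coord_family[OF assms(1)] by (intro sum_mono bessel_inequality assms(2))

text \<open>Finitely many families over a finite index set have finitely many values, and an
  orthonormal set whose span contains these computes all their norms exactly. This is what lower
  bounds and cancellations of norms depend on.\<close>

lemma coord_family_resolving:
  assumes B: "finite B" and E: "orthonormal E" and X: "finite X"
  shows "\<exists>E'. E \<subseteq> E' \<and> orthonormal E' \<and>
    (\<forall>F\<in>X. (\<Sum>e\<in>E'. (norm (coord_family B F e))\<^sup>2) = (\<Sum>\<alpha>\<in>B. (norm (F \<alpha>))\<^sup>2))"
proof -
  have "finite (\<Union>F\<in>X. F ` B)"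
    using B X by auto
  from orthonormal_extend[OF E this] obtain E' where E': "E \<subseteq> E'" "orthonormal E'"
      "\<forall>v\<in>(\<Union>F\<in>X. F ` B). (\<Sum>e\<in>E'. (cmod (cinner v e))\<^sup>2) = (norm v)\<^sup>2"
    by blast
  have "(\<Sum>e\<in>E'. (norm (coord_family B F e))\<^sup>2) = (\<Sum>\<alpha>\<in>B. (norm (F \<alpha>))\<^sup>2)" if "F \<in> X" for F
    unfolding sum_norm_coord_family[OF B] using E'(3) that by (intro sum.cong) auto
  with E' show ?thesis
    by blast
qed

lemma L2_norm_add_le:
  fixes u v :: "'i \<Rightarrow> 'a::real_normed_vector"
  shows "L2_set (\<lambda>e. norm (u e + v e)) E \<le> L2_set (\<lambda>e. norm (u e)) E + L2_set (\<lambda>e. norm (v e)) E"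
  by (rule order_trans[OF L2_set_mono L2_set_triangle_ineq]) (auto intro: norm_triangle_ineq)

text \<open>The operator \<open>T\<close> tensor 1 has norm at most \<open>norm T\<close>.\<close>

lemma L2_norm_blinfun_le:
  "L2_set (\<lambda>e. norm (blinfun_apply T (u e))) E \<le> norm T * L2_set (\<lambda>e. norm (u e)) E"
  unfolding L2_set_right_distrib[OF norm_ge_zero] by (intro L2_set_mono norm_blinfun) auto

section \<open>The approximate intertwiner\<close>

context commuting_rows
begin

definition box :: "nat \<Rightarrow> (nat \<Rightarrow> nat list) set" where
  "box N = (\<Pi>\<^sub>E j\<in>{1..k}. short_words j N)"

lemma finite_box: "finite (box N)"
  unfolding box_def by (intro finite_PiE finite_short_words) auto

lemma box_iff: "\<alpha> \<in> box N \<longleftrightarrow> \<alpha> \<in> words k n \<and> (\<forall>j\<in>{1..k}. length (\<alpha> j) \<le> N)"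
  by (auto simp: box_def words_def short_words_def PiE_iff)

lemma words_set: "\<alpha> \<in> words k n \<Longrightarrow> j \<in> {1..k} \<Longrightarrow> set (\<alpha> j) \<subseteq> {1..n j}"
  using words_lists[of \<alpha> k n j] by auto

definition kernel_op :: "nat \<Rightarrow> nat \<Rightarrow> nat list \<Rightarrow> 'a \<Rightarrow>\<^sub>L 'a" where
  "kernel_op N j w = word_op (wt_a N) (wt_b N) j w"

definition kernel_vec :: "nat \<Rightarrow> 'a \<Rightarrow> (nat \<Rightarrow> nat list) \<Rightarrow> 'a" where
  "kernel_vec N x \<alpha> = op_seq (kernel_op N) k \<alpha> x"

text \<open>The coordinate sequence along \<open>e\<close> of J_N x in the overview.\<close>

definition kernel :: "nat \<Rightarrow> 'a \<Rightarrow> 'a \<Rightarrow> (nat \<Rightarrow> nat list) ell2" where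
  "kernel N x = coord_family (box N) (kernel_vec N x)"

lemma kernel_op_mem: "j \<in> {1..k} \<Longrightarrow> set w \<subseteq> {1..n j} \<Longrightarrow> kernel_op N j w \<in> bounded_ops K"
  unfolding kernel_op_def by (rule word_op_mem)

text \<open>J_N is isometric, because by the choice of the weights each of the \<open>k\<close>
  one-row kernels preserves norms.\<close>

lemma sum_norm_kernel_vec:
  assumes "0 < N" "x \<in> K"
  shows "(\<Sum>\<alpha>\<in>box N. (norm (kernel_vec N x \<alpha>))\<^sup>2) = (norm x)\<^sup>2"
  unfolding box_def kernel_vec_def
proof (rule sum_norm_op_seq_eq[where H = K])
  fix j
  assume j: "j \<in> {1..k}"
  show "kernel_op N j w \<in> bounded_ops K" if "w \<in> short_words j N" for w
    using that j by (intro kernel_op_mem) (auto simp: short_words_def)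
  show "(\<Sum>w\<in>short_words j N. (norm (kernel_op N j w y))\<^sup>2) = (norm y)\<^sup>2" if "y \<in> K" for y
    unfolding kernel_op_def by (rule sum_norm_word_op_weights[OF assms(1) j that])
qed (rule assms(2))

lemma L2_norm_kernel_le:
  assumes "0 < N" "x \<in> K" "orthonormal E"
  shows "L2_set (\<lambda>e. norm (kernel N x e)) E \<le> norm x"
proof -
  have "(\<Sum>e\<in>E. (norm (kernel N x e))\<^sup>2) \<le> (norm x)\<^sup>2"
    using sum_norm_coord_family_le[OF finite_box assms(3), of N "kernel_vec N x"]
    unfolding kernel_def sum_norm_kernel_vec[OF assms(1,2)] .
  then show ?thesis
    by (simp add: L2_set_def real_le_lsqrt sum_nonneg)
qed

lemma kernel_resolving:
  assumes "0 < N" "finite X" "X \<subseteq> K" "orthonormal E"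
  shows "\<exists>E'. E \<subseteq> E' \<and> orthonormal E' \<and> (\<forall>x\<in>X. (\<Sum>e\<in>E'. (norm (kernel N x e))\<^sup>2) = (norm x)\<^sup>2)"
proof -
  have "finite (kernel_vec N ` X)"
    using assms(2) by simp
  then obtain E' where E': "E \<subseteq> E'" "orthonormal E'" "\<And>F. F \<in> kernel_vec N ` X \<Longrightarrow>
      (\<Sum>e\<in>E'. (norm (coord_family (box N) F e))\<^sup>2) = (\<Sum>\<alpha>\<in>box N. (norm (F \<alpha>))\<^sup>2)"
    using coord_family_resolving[OF finite_box assms(4)] by metis
  have "(\<Sum>e\<in>E'. (norm (kernel N x e))\<^sup>2) = (norm x)\<^sup>2" if "x \<in> X" for x
    using E'(3)[of "kernel_vec N x"] that assms(1,3) by (simp add: kernel_def sum_norm_kernel_vec subsetD)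
  with E' show ?thesis
    by blast
qed

lemma kernel_linear:
  shows kernel_add: "kernel N (x + y) e = kernel N x e + kernel N y e"
    and kernel_diff: "kernel N (x - y) e = kernel N x e - kernel N y e"
    and kernel_scaleC: "kernel N (c *\<^sub>C x) e = c *\<^sub>C kernel N x e"
proof -
  show "kernel N (x + y) e = kernel N x e + kernel N y e"
    by (simp add: kernel_def coord_family_def kernel_vec_def op_seq_add cinner_add_left
        scaleC_add_left sum.distrib)
  show "kernel N (x - y) e = kernel N x e - kernel N y e"
    by (simp add: kernel_def coord_family_def kernel_vec_def op_seq_diff cinner.diff_left
        scaleC.diff_left sum_subtractf)
  show "kernel N (c *\<^sub>C x) e = c *\<^sub>C kernel N x e"
    unfolding kernel_def coord_family_def scaleC.sum_right
  proof (rule sum.cong[OF refl])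
    fix \<alpha>
    assume "\<alpha> \<in> box N"
    then have "kernel_vec N (c *\<^sub>C x) \<alpha> = c *\<^sub>C kernel_vec N x \<alpha>"
      unfolding kernel_vec_def
      by (intro op_seq_scaleC[where H = K] kernel_op_mem words_set) (auto simp: box_iff)
    then show "cinner (kernel_vec N (c *\<^sub>C x) \<alpha>) e *\<^sub>C chi \<alpha>
        = c *\<^sub>C cinner (kernel_vec N x \<alpha>) e *\<^sub>C chi \<alpha>"
      by (simp add: cinner_scaleC_left scaleC_scaleC)
  qed
qed

lemma kernel_op_eq_0: "N < length w \<Longrightarrow> kernel_op N j w = 0"
  unfolding kernel_op_def by (rule word_op_eq_0) (auto simp: wt_a_def wt_b_def)

text \<open>Outside the box a weight pair vanishes in some slot, so the formula persists there. An
  adjoint shift reads the kernel at words with one more letter, which may leave the box.\<close>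

lemma kernel_apply:
  assumes "\<alpha> \<in> words k n"
  shows "ell2_fun (kernel N x e) \<alpha> = cinner (kernel_vec N x \<alpha>) e"
proof (cases "\<alpha> \<in> box N")
  case False
  then obtain j where "j \<in> {1..k}" "N < length (\<alpha> j)"
    using assms by (auto simp: box_iff not_le)
  then have "kernel_vec N x \<alpha> = 0"
    unfolding kernel_vec_def by (intro op_seq_eq_0[of j]) (auto intro: kernel_op_eq_0)
  with False show ?thesis
    by (simp add: kernel_def coord_family_apply finite_box cinner.zero_left)
qed (simp add: kernel_def coord_family_apply finite_box)

lemma kernel_apply_outside: "\<alpha> \<notin> words k n \<Longrightarrow> ell2_fun (kernel N x e) \<alpha> = 0"
  by (simp add: kernel_def coord_family_apply finite_box box_iff)

section \<open>The kernel against adjoint shifts\<close>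

definition shifted_kernel_op :: "nat \<Rightarrow> nat \<Rightarrow> nat list \<Rightarrow> 'a \<Rightarrow>\<^sub>L 'a" where
  "shifted_kernel_op N j w = word_op (\<lambda>m. wt_a N (Suc m)) (\<lambda>m. wt_b N (Suc m)) j w"

definition kernel_op_defect :: "nat \<Rightarrow> nat \<Rightarrow> nat list \<Rightarrow> 'a \<Rightarrow>\<^sub>L 'a" where
  "kernel_op_defect N j w
    = word_op (\<lambda>m. wt_a N (Suc m) - wt_a N m) (\<lambda>m. wt_b N (Suc m) - wt_b N m) j w"

lemma adj_V_op_seq_kernel:
  assumes i: "i \<in> {1..k}" and s: "s \<in> {1..n i}" and \<alpha>: "\<alpha> \<in> words k n" and x: "x \<in> K" and m: "m < i"
  shows "adj (V i s) (op_seq (kernel_op N) m \<alpha> x)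
    = (\<Prod>j\<in>{1..m}. word_twist lam i j s (\<alpha> j)) *\<^sub>C op_seq (kernel_op N) m \<alpha> (adj (V i s) x)"
  using m
proof (induction m)
  case (Suc m)
  then have j: "Suc m \<in> {1..k}" "i \<noteq> Suc m"
    using i by auto
  have w: "set (\<alpha> (Suc m)) \<subseteq> {1..n (Suc m)}"
    by (rule words_set[OF \<alpha> j(1)])
  have mem: "op_seq (kernel_op N) m \<alpha> x \<in> K"
    using x i Suc.prems \<alpha> by (intro op_seq_mem kernel_op_mem words_set) auto
  have "adj (V i s) (op_seq (kernel_op N) (Suc m) \<alpha> x) = word_twist lam i (Suc m) s (\<alpha> (Suc m)) *\<^sub>C
      kernel_op N (Suc m) (\<alpha> (Suc m)) (adj (V i s) (op_seq (kernel_op N) m \<alpha> x))"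
    unfolding op_seq.simps kernel_op_def[of N "Suc m"] by (rule adj_V_word_op[OF i j s w mem])
  then show ?case
    using Suc by (simp add: bounded_opsD(1)[OF kernel_op_mem[OF j(1) w]] scaleC_scaleC mult.commute)
qed simp

text \<open>The new letter turns into an adjoint of \<open>V i s\<close> in slot \<open>i\<close>,
  with the weights moved up one level. Carrying it through the slots below \<open>i\<close> produces
  the twist of the standard shift; the slots above \<open>i\<close> are untouched, just as in the
  definition of that shift.\<close>

lemma kernel_vec_Cons:
  assumes i: "i \<in> {1..k}" and s: "s \<in> {1..n i}" and \<alpha>: "\<alpha> \<in> words k n" and x: "x \<in> K"
  shows "kernel_vec N x (\<alpha>(i := s # \<alpha> i)) = twist_coeff lam i s \<alpha> *\<^sub>C
    op_seq ((kernel_op N)(i := shifted_kernel_op N i)) k \<alpha> (adj (V i s) x)"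
proof -
  have "op_seq (kernel_op N) m (\<alpha>(i := s # \<alpha> i)) x = twist_coeff lam i s \<alpha> *\<^sub>C
      op_seq ((kernel_op N)(i := shifted_kernel_op N i)) m \<alpha> (adj (V i s) x)"
    if "i \<le> m" "m \<le> k" for m
    using that
  proof (induction m)
    case 0
    then show ?case
      using i by simp
  next
    case (Suc m)
    then have j: "Suc m \<in> {1..k}"
      by auto
    have w: "set (\<alpha> (Suc m)) \<subseteq> {1..n (Suc m)}"
      by (rule words_set[OF \<alpha> j])
    show ?case
    proof (cases "i = Suc m")
      case True
      have eq: "op_seq (kernel_op N) m (\<alpha>(i := s # \<alpha> i)) x = op_seq (kernel_op N) m \<alpha> x"
        "op_seq ((kernel_op N)(i := shifted_kernel_op N i)) m \<alpha> y = op_seq (kernel_op N) m \<alpha> y" for y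
        using True by (auto intro!: op_seq_cong)
      have tw: "twist_coeff lam i s \<alpha> = (\<Prod>j\<in>{1..m}. word_twist lam i j s (\<alpha> j))"
        unfolding twist_coeff_def True by (simp add: atLeastLessThanSuc_atLeastAtMost)
      have "op_seq (kernel_op N) (Suc m) (\<alpha>(i := s # \<alpha> i)) x
          = shifted_kernel_op N i (\<alpha> i) (adj (V i s) (op_seq (kernel_op N) m \<alpha> x))"
        using True eq(1) by (simp add: kernel_op_def shifted_kernel_op_def word_op_Cons)
      also have "adj (V i s) (op_seq (kernel_op N) m \<alpha> x)
          = twist_coeff lam i s \<alpha> *\<^sub>C op_seq (kernel_op N) m \<alpha> (adj (V i s) x)"
        unfolding tw using True by (intro adj_V_op_seq_kernel i s \<alpha> x) simp
      also have "shifted_kernel_op N i (\<alpha> i) \<dots>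
          = twist_coeff lam i s \<alpha> *\<^sub>C shifted_kernel_op N i (\<alpha> i) (op_seq (kernel_op N) m \<alpha> (adj (V i s) x))"
        unfolding shifted_kernel_op_def
        by (rule bounded_opsD(1)[OF word_op_mem[OF i words_set[OF \<alpha> i]]])
      also have "shifted_kernel_op N i (\<alpha> i) (op_seq (kernel_op N) m \<alpha> (adj (V i s) x))
          = op_seq ((kernel_op N)(i := shifted_kernel_op N i)) (Suc m) \<alpha> (adj (V i s) x)"
        unfolding op_seq.simps eq(2) unfolding True[symmetric] fun_upd_same ..
      finally show ?thesis .
    next
      case False
      then have "i \<le> m" "m \<le> k"
        using Suc.prems by auto
      from Suc.IH[OF this] show ?thesis
        using False by (simp add: bounded_opsD(1)[OF kernel_op_mem[OF j w]])
    qed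
  qed
  from this[of k] show ?thesis
    unfolding kernel_vec_def using i by simp
qed

text \<open>The twist produced by the kernel cancels against its conjugate in the adjoint shift.
  What remains is the change of weights in slot \<open>i\<close>, and multilinearity in that slot
  makes the difference again a family of the same kind.\<close>

lemma adj_shift_kernel:
  assumes i: "i \<in> {1..k}" and s: "s \<in> {1..n i}" and x: "x \<in> K"
  shows "adj (std_shift k n lam i s) (kernel N x e) - kernel N (adj (V i s) x) e
    = coord_family (box N)
        (\<lambda>\<alpha>. op_seq ((kernel_op N)(i := kernel_op_defect N i)) k \<alpha> (adj (V i s) x)) e"
proof (rule ell2_eqI)
  fix \<alpha>
  define y where "y = adj (V i s) x"
  define S where "S = (kernel_op N)(i := shifted_kernel_op N i)"
  define D where "D = (kernel_op N)(i := kernel_op_defect N i)"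
  show "ell2_fun (adj (std_shift k n lam i s) (kernel N x e) - kernel N (adj (V i s) x) e) \<alpha>
      = ell2_fun (coord_family (box N)
          (\<lambda>\<alpha>. op_seq ((kernel_op N)(i := kernel_op_defect N i)) k \<alpha> (adj (V i s) x)) e) \<alpha>"
    unfolding y_def[symmetric] D_def[symmetric]
  proof (cases "\<alpha> \<in> words k n")
    case True
    have s\<alpha>: "\<alpha>(i := s # \<alpha> i) \<in> words k n"
      using words_lists[OF True i] s by (intro words_upd True i) auto
    have tw: "cnj (twist_coeff lam i s \<alpha>) * twist_coeff lam i s \<alpha> = 1"
      using twist_coeff_mult_cnj[OF lam True i s] by (simp add: mult.commute)
    have "ell2_fun (adj (std_shift k n lam i s) (kernel N x e)) \<alpha>
        = (cnj (twist_coeff lam i s \<alpha>) * twist_coeff lam i s \<alpha>) * cinner (op_seq S k \<alpha> y) e"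
      using True s\<alpha> by (simp add: adj_std_shift_apply[OF lam i s] kernel_apply
          kernel_vec_Cons[OF i s True x] cinner_scaleC_left S_def y_def)
    then have "ell2_fun (adj (std_shift k n lam i s) (kernel N x e) - kernel N y e) \<alpha>
        = cinner (op_seq S k \<alpha> y - op_seq (S(i := kernel_op N i)) k \<alpha> y) e"
      using True by (simp add: tw ell2_fun_diff kernel_apply kernel_vec_def S_def cinner.diff_left)
    also have "op_seq S k \<alpha> y - op_seq (S(i := kernel_op N i)) k \<alpha> y
        = op_seq (S(i := kernel_op_defect N i)) k \<alpha> y"
      using i by (intro op_seq_upd_diff)
        (auto simp: S_def kernel_op_def shifted_kernel_op_def kernel_op_defect_def word_op_diff)
    also have "S(i := kernel_op_defect N i) = D"
      by (simp add: S_def D_def)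
    finally have eq: "ell2_fun (adj (std_shift k n lam i s) (kernel N x e) - kernel N y e) \<alpha>
        = cinner (op_seq D k \<alpha> y) e" .
    \<comment> \<open>The error is supported in the box as well: beyond length \<open>N\<close> the
      weights vanish both before and after the move by one level.\<close>
    have "op_seq D k \<alpha> y = 0" if "\<alpha> \<notin> box N"
    proof -
      obtain j where j: "j \<in> {1..k}" "N < length (\<alpha> j)"
        using True \<open>\<alpha> \<notin> box N\<close> by (auto simp: box_iff not_le)
      then have "D j (\<alpha> j) = 0"
        by (auto simp: D_def kernel_op_eq_0 kernel_op_defect_def wt_a_def wt_b_def intro!: word_op_eq_0)
      with j(1) show ?thesis
        by (rule op_seq_eq_0)
    qed
    then show "ell2_fun (adj (std_shift k n lam i s) (kernel N x e) - kernel N y e) \<alpha>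
        = ell2_fun (coord_family (box N) (\<lambda>\<alpha>. op_seq D k \<alpha> y) e) \<alpha>"
      unfolding eq by (auto simp: coord_family_apply finite_box cinner.zero_left)
  next
    case False
    then show "ell2_fun (adj (std_shift k n lam i s) (kernel N x e) - kernel N y e) \<alpha>
        = ell2_fun (coord_family (box N) (\<lambda>\<alpha>. op_seq D k \<alpha> y) e) \<alpha>"
      by (simp add: ell2_fun_diff adj_std_shift_apply[OF lam i s] kernel_apply_outside
          coord_family_apply finite_box box_iff)
  qed
qed

lemma sum_norm_adj_shift_kernel:
  assumes i: "i \<in> {1..k}" and s: "s \<in> {1..n i}" and x: "x \<in> K" and N: "0 < N" and E: "orthonormal E"
  shows "(\<Sum>e\<in>E. (norm (adj (std_shift k n lam i s) (kernel N x e) - kernel N (adj (V i s) x) e))\<^sup>2)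
    \<le> 2 / real N * (norm (adj (V i s) x))\<^sup>2"
proof -
  define y where "y = adj (V i s) x"
  have y: "y \<in> K"
    using bounded_opsD(2)[OF adj_V_mem[OF i s]] by (simp add: y_def)
  have "(\<Sum>e\<in>E. (norm (adj (std_shift k n lam i s) (kernel N x e) - kernel N y e))\<^sup>2)
      \<le> (\<Sum>\<alpha>\<in>box N. (norm (op_seq ((kernel_op N)(i := kernel_op_defect N i)) k \<alpha> y))\<^sup>2)"
    unfolding y_def adj_shift_kernel[OF i s x] by (rule sum_norm_coord_family_le[OF finite_box E])
  \<comment> \<open>Only slot \<open>i\<close> carries weight differences; in the other slots the
    kernel preserves norms.\<close>
  also have "\<dots> \<le> (\<Prod>j\<in>{1..k}. if j = i then 2 / real N else 1) * (norm y)\<^sup>2"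
    unfolding box_def
  proof (rule sum_norm_op_seq_le[where H = K])
    fix j w
    assume j: "j \<in> {1..k}"
    show "((kernel_op N)(i := kernel_op_defect N i)) j w \<in> bounded_ops K" if "w \<in> short_words j N"
      using that j by (auto simp: short_words_def kernel_op_mem kernel_op_defect_def intro!: word_op_mem)
    show "(\<Sum>w\<in>short_words j N. (norm (((kernel_op N)(i := kernel_op_defect N i)) j w z))\<^sup>2)
        \<le> (if j = i then 2 / real N else 1) * (norm z)\<^sup>2" if "z \<in> K" for z
    proof (cases "j = i")
      case True
      show ?thesis
        unfolding True fun_upd_same kernel_op_defect_def
        using sum_norm_word_op_weight_shift[OF N i that] by simp
    next
      case False
      then show ?thesis
        using sum_norm_word_op_weights[OF N j that] by (simp add: kernel_op_def)
    qed
  qed (use y in auto)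
  also have "(\<Prod>j\<in>{1..k}. if j = i then 2 / real N else 1) = 2 / real N"
    using i by simp
  finally show ?thesis
    by (simp add: y_def)
qed

text \<open>The shifts are isometric, so that intertwining their adjoints up to a small error forces
  intertwining the shifts themselves up to a small error.\<close>

lemma sum_norm_shift_kernel:
  assumes i: "i \<in> {1..k}" and s: "s \<in> {1..n i}" and x: "x \<in> K" and N: "0 < N" and E: "orthonormal E"
  shows "(\<Sum>e\<in>E. (norm (std_shift k n lam i s (kernel N x e) - kernel N (V i s x) e))\<^sup>2)
    \<le> 2 * sqrt (2 / real N) * (norm x)\<^sup>2"
proof -
  define S where "S = std_shift k n lam i s"
  define y where "y = V i s x"
  have S_mem: "S \<in> bounded_ops UNIV"
    using std_shift_mem_bounded_ops[OF lam i s] bounded_ops_subset_UNIV by (auto simp: S_def)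
  have y: "y \<in> K" "norm y = norm x" "adj (V i s) y = x"
    using bounded_opsD(2)[OF V_mem[OF i s]] norm_V[OF i s x] i s x
    by (simp_all add: y_def adj_V_V id_op_apply[OF K])
  \<comment> \<open>The enlarged set must resolve the kernels of both \<open>x\<close> and
    \<open>y\<close>: their norms are equal, and the two sums of squares have to cancel
    exactly.\<close>
  have "finite {x, y}" "{x, y} \<subseteq> K"
    using x y(1) by auto
  from kernel_resolving[OF N this E] obtain E' where E': "E \<subseteq> E'" "orthonormal E'"
      "(\<Sum>e\<in>E'. (norm (kernel N x e))\<^sup>2) = (norm x)\<^sup>2" "(\<Sum>e\<in>E'. (norm (kernel N y e))\<^sup>2) = (norm y)\<^sup>2"
    by auto
  define err where "err e = adj S (kernel N y e) - kernel N x e" for e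
  have sum_err: "(\<Sum>e\<in>E'. (norm (err e))\<^sup>2) \<le> 2 / real N * (norm x)\<^sup>2"
    using sum_norm_adj_shift_kernel[OF i s y(1) N E'(2)] by (simp add: err_def S_def y(3))
  have "(\<Sum>e\<in>E. (norm (S (kernel N x e) - kernel N y e))\<^sup>2)
      \<le> (\<Sum>e\<in>E'. (norm (S (kernel N x e) - kernel N y e))\<^sup>2)"
    using E' by (intro sum_mono2) (auto simp: orthonormal_def)
  \<comment> \<open>In the expanded square the isometry \<open>S\<close> is dropped from
    \<open>S u\<close>, and in the mixed term it is moved to the other side, where
    \<open>adj S (kernel N y e)\<close> equals \<open>u + err e\<close>.\<close>
  also have "\<dots> \<le> (\<Sum>e\<in>E'. (norm (kernel N y e))\<^sup>2 - (norm (kernel N x e))\<^sup>2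
      + 2 * (norm (kernel N x e) * norm (err e)))"
  proof (rule sum_mono)
    fix e
    define u where "u = kernel N x e"
    have "u \<in> fock_space k n"
      by (simp add: fock_space_def u_def kernel_apply_outside)
    then have "adj S (S u) = u"
      using arg_cong[OF std_shift_row_isometry[OF lam i s s], of "\<lambda>T. T u"]
      by (simp add: S_def id_op_apply)
    then have "cinner (S u) (S u) = cinner u u"
      using cinner_adj_left[OF S_mem, of "S u" u] by simp
    then have Su: "(norm (S u))\<^sup>2 = (norm u)\<^sup>2"
      unfolding cinner_self of_real_eq_iff .
    have "cinner (S u) (kernel N y e) = cinner u (u + err e)"
      by (simp add: err_def u_def cinner_adj_right[OF S_mem])
    then have "Re (cinner (S u) (kernel N y e)) = (norm u)\<^sup>2 + Re (cinner u (err e))"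
      by (simp add: cinner_add_right cinner_self del: of_real_power)
    moreover have "- Re (cinner u (err e)) \<le> norm u * norm (err e)"
      using abs_Re_le_cmod[of "cinner u (err e)"] cmod_cinner_le[of u "err e"] by linarith
    ultimately show "(norm (S (kernel N x e) - kernel N y e))\<^sup>2
        \<le> (norm (kernel N y e))\<^sup>2 - (norm (kernel N x e))\<^sup>2 + 2 * (norm (kernel N x e) * norm (err e))"
      unfolding norm_diff_square u_def[symmetric] Su by linarith
  qed
  also have "\<dots> = 2 * (\<Sum>e\<in>E'. norm (kernel N x e) * norm (err e))"
    using E'(3,4) y(2) by (simp add: sum.distrib sum_subtractf sum_distrib_left)
  also have "\<dots> \<le> 2 * (L2_set (\<lambda>e. norm (kernel N x e)) E' * L2_set (\<lambda>e. norm (err e)) E')"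
    using L2_set_mult_ineq[of "\<lambda>e. norm (kernel N x e)" "\<lambda>e. norm (err e)" E'] by simp
  also have "\<dots> \<le> 2 * (norm x * (sqrt (2 / real N) * norm x))"
  proof (intro mult_left_mono mult_mono)
    show "L2_set (\<lambda>e. norm (err e)) E' \<le> sqrt (2 / real N) * norm x"
      using real_sqrt_le_mono[OF sum_err] unfolding L2_set_def real_sqrt_mult by simp
  qed (use E' x N in \<open>auto intro: L2_norm_kernel_le\<close>)
  finally show ?thesis
    by (simp add: S_def y_def power2_eq_square mult_ac)
qed

section \<open>The homomorphism from the standard algebra\<close>

text \<open>The supremum of these values over all finite orthonormal \<open>E\<close> is the norm of
  (a tensor 1) J_N x - J_N b x.\<close>

definition error_le where
  "error_le N a b x \<epsilon> \<longleftrightarrow> (\<forall>E. orthonormal E \<longrightarrow>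
     L2_set (\<lambda>e. norm (blinfun_apply a (kernel N x e) - kernel N (blinfun_apply b x) e)) E \<le> \<epsilon>)"

definition intertwines :: "fock_op \<Rightarrow> ('a \<Rightarrow>\<^sub>L 'a) \<Rightarrow> bool" where
  "intertwines a b \<longleftrightarrow> (\<forall>x\<in>K. \<forall>\<epsilon>>0. \<forall>\<^sub>F N in sequentially. error_le N a b x \<epsilon>)"

lemma intertwinesD:
  "intertwines a b \<Longrightarrow> x \<in> K \<Longrightarrow> 0 < \<epsilon> \<Longrightarrow> \<forall>\<^sub>F N in sequentially. error_le N a b x \<epsilon>"
  by (simp add: intertwines_def)

lemma intertwinesI:
  fixes a :: fock_op and b :: "'a \<Rightarrow>\<^sub>L 'a"
  assumes c: "\<And>x. c x \<longlonglongrightarrow> 0" and sum: "\<And>x N E. x \<in> K \<Longrightarrow> 0 < N \<Longrightarrow> orthonormal E \<Longrightarrow>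
    (\<Sum>e\<in>E. (norm (a (kernel N x e) - kernel N (b x) e))\<^sup>2) \<le> c x N"
  shows "intertwines a b"
  unfolding intertwines_def
proof (intro ballI allI impI)
  fix x and \<epsilon> :: real
  assume x: "x \<in> K" and \<epsilon>: "0 < \<epsilon>"
  have "\<forall>\<^sub>F N in sequentially. c x N < \<epsilon>\<^sup>2"
    using c \<epsilon> by (intro order_tendstoD) auto
  then show "\<forall>\<^sub>F N in sequentially. error_le N a b x \<epsilon>"
    using eventually_gt_at_top[of 0]
  proof eventually_elim
    case (elim N)
    show ?case
      unfolding error_le_def
    proof (intro allI impI)
      fix E :: "'a set"
      assume "orthonormal E"
      then have "(\<Sum>e\<in>E. (norm (a (kernel N x e) - kernel N (b x) e))\<^sup>2) \<le> \<epsilon>\<^sup>2"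
        using sum[OF x elim(2), of E] elim(1) by linarith
      then show "L2_set (\<lambda>e. norm (a (kernel N x e) - kernel N (b x) e)) E \<le> \<epsilon>"
        unfolding L2_set_def using \<epsilon> by (intro real_le_lsqrt) auto
    qed
  qed
qed

lemma intertwines_shift:
  assumes i: "i \<in> {1..k}" and s: "s \<in> {1..n i}"
  shows "intertwines (std_shift k n lam i s) (V i s)"
    and "intertwines (adj (std_shift k n lam i s)) (adj (V i s))"
proof -
  have "(\<lambda>N. 2 * sqrt (2 / real N) * (norm x)\<^sup>2) \<longlonglongrightarrow> 2 * sqrt 0 * (norm x)\<^sup>2" for x :: 'a
    by (intro tendsto_intros lim_const_over_n)
  then show "intertwines (std_shift k n lam i s) (V i s)"
    by (intro intertwinesI[OF _ sum_norm_shift_kernel[OF i s]]) simp_all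
  have "(\<lambda>N. 2 / real N * (norm (adj (V i s) x))\<^sup>2) \<longlonglongrightarrow> 0 * (norm (adj (V i s) x))\<^sup>2" for x
    by (intro tendsto_intros lim_const_over_n)
  then show "intertwines (adj (std_shift k n lam i s)) (adj (V i s))"
    by (intro intertwinesI[OF _ sum_norm_adj_shift_kernel[OF i s]]) simp_all
qed

lemma intertwines_zero: "intertwines 0 0"
proof -
  have "kernel N 0 e = 0" for N e
    using kernel_diff[of N 0 0 e] by simp
  then show ?thesis
    by (intro intertwinesI[of "\<lambda>_ _. 0"]) simp_all
qed

lemma intertwines_add:
  assumes "intertwines a b" "intertwines a' b'"
  shows "intertwines (a + a') (b + b')"
  unfolding intertwines_def
proof (intro ballI allI impI)
  fix x and \<epsilon> :: real
  assume x: "x \<in> K" and "0 < \<epsilon>"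
  then have \<epsilon>: "0 < \<epsilon> / 2"
    by simp
  from intertwinesD[OF assms(1) x \<epsilon>] intertwinesD[OF assms(2) x \<epsilon>]
  show "\<forall>\<^sub>F N in sequentially. error_le N (a + a') (b + b') x \<epsilon>"
  proof eventually_elim
    case (elim N)
    have eq: "(a + a') (kernel N x e) - kernel N ((b + b') x) e
        = (a (kernel N x e) - kernel N (b x) e) + (a' (kernel N x e) - kernel N (b' x) e)" for e
      by (simp add: blinfun.add_left kernel_add)
    show ?case
      unfolding error_le_def eq
    proof (intro allI impI)
      fix E :: "'a set"
      assume "orthonormal E"
      then show "L2_set (\<lambda>e. norm ((a (kernel N x e) - kernel N (b x) e)
          + (a' (kernel N x e) - kernel N (b' x) e))) E \<le> \<epsilon>"
        using elim[unfolded error_le_def, rule_format, of E]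
          L2_norm_add_le[of "\<lambda>e. a (kernel N x e) - kernel N (b x) e"
            "\<lambda>e. a' (kernel N x e) - kernel N (b' x) e" E]
        by linarith
    qed
  qed
qed

text \<open>The error splits as a (a' J_N - J_N b') x + (a J_N - J_N b) b' x. The second term is
  small because pointwise convergence is used at the fixed vector \<open>b' x\<close>, which lies in
  \<open>K\<close>.\<close>

lemma intertwines_compose:
  assumes ab: "intertwines a b" "intertwines a' b'" and b': "b' \<in> bounded_ops K"
  shows "intertwines (a o\<^sub>L a') (b o\<^sub>L b')"
  unfolding intertwines_def
proof (intro ballI allI impI)
  fix x and \<epsilon> :: real
  assume x: "x \<in> K" and "0 < \<epsilon>"
  have cancel: "r * (d / r) = d" if "0 < r" for r d :: real
    using that by simp
  \<comment> \<open>\<open>norm a + 1\<close> serves as a positive bound to divide by, also for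
    \<open>a = 0\<close>.\<close>
  have a: "0 < norm a + 1"
    by (simp add: add_nonneg_pos)
  have \<epsilon>: "0 < \<epsilon> / 2" "0 < \<epsilon> / 2 / (norm a + 1)"
    using \<open>0 < \<epsilon>\<close> a by simp_all
  from intertwinesD[OF ab(2) x \<epsilon>(2)] intertwinesD[OF ab(1) bounded_opsD(2)[OF b', of x] \<epsilon>(1)]
  show "\<forall>\<^sub>F N in sequentially. error_le N (a o\<^sub>L a') (b o\<^sub>L b') x \<epsilon>"
  proof eventually_elim
    case (elim N)
    define u where "u e = a' (kernel N x e) - kernel N (b' x) e" for e
    define v where "v e = a (kernel N (b' x) e) - kernel N (b (b' x)) e" for e
    have eq: "(a o\<^sub>L a') (kernel N x e) - kernel N ((b o\<^sub>L b') x) e = a (u e) + v e" for e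
      by (simp add: u_def v_def blinfun.diff_right)
    show ?case
      unfolding error_le_def eq
    proof (intro allI impI)
      fix E :: "'a set"
      assume E: "orthonormal E"
      have "norm a * L2_set (\<lambda>e. norm (u e)) E \<le> (norm a + 1) * (\<epsilon> / 2 / (norm a + 1))"
        using elim(1) E a by (intro mult_mono) (auto simp: u_def error_le_def)
      then have "L2_set (\<lambda>e. norm (a (u e))) E \<le> \<epsilon> / 2"
        using L2_norm_blinfun_le[of a u E] unfolding cancel[OF a] by linarith
      moreover have "L2_set (\<lambda>e. norm (v e)) E \<le> \<epsilon> / 2"
        using elim(2) E by (simp add: v_def error_le_def)
      ultimately show "L2_set (\<lambda>e. norm (a (u e) + v e)) E \<le> \<epsilon>"
        using L2_norm_add_le[of "\<lambda>e. a (u e)" v E] by linarith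
    qed
  qed
qed

text \<open>Scalar operators are intertwined without error, as the kernel is complex linear in
  \<open>x\<close>; scaling is composition with them.\<close>

lemma intertwines_scaleC:
  assumes "intertwines a b" and b: "b \<in> bounded_ops K"
  shows "intertwines (c *\<^sub>C a) (c *\<^sub>C b)"
proof -
  have "intertwines (c *\<^sub>C id_blinfun) (c *\<^sub>C id_op K)"
    by (intro intertwinesI[of "\<lambda>_ _. 0"]) (simp_all add: kernel_scaleC id_op_apply[OF K])
  then have "intertwines ((c *\<^sub>C id_blinfun) o\<^sub>L a) ((c *\<^sub>C id_op K) o\<^sub>L b)"
    using assms by (rule intertwines_compose)
  moreover have "(c *\<^sub>C id_blinfun) o\<^sub>L a = c *\<^sub>C a" "(c *\<^sub>C id_op K) o\<^sub>L b = c *\<^sub>C b"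
    by (rule blinfun_eqI, simp add: id_op_apply[OF K bounded_opsD(2)[OF b]])+
  ultimately show ?thesis
    by simp
qed

text \<open>J_N is contractive uniformly in \<open>N\<close>, so replacing \<open>a\<close> and
  \<open>b\<close> by approximants costs at most \<open>\<delta> * norm x\<close> each, whatever
  \<open>N\<close> is.\<close>

lemma intertwines_limit:
  assumes b: "b \<in> bounded_ops K"
    and approx: "\<And>\<delta>. 0 < \<delta> \<Longrightarrow> \<exists>a' b'. intertwines a' b' \<and> b' \<in> bounded_ops K \<and>
      norm (a - a') \<le> \<delta> \<and> norm (b' - b) \<le> \<delta>"
  shows "intertwines a b"
  unfolding intertwines_def
proof (intro ballI allI impI)
  fix x and \<epsilon> :: real
  assume x: "x \<in> K" and "0 < \<epsilon>"
  then have \<epsilon>: "0 < \<epsilon> / 3"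
    by simp
  obtain \<delta> where \<delta>: "0 < \<delta>" "\<delta> * norm x \<le> \<epsilon> / 3"
  proof (cases "x = 0")
    case False
    then show ?thesis
      using \<open>0 < \<epsilon>\<close> that[of "\<epsilon> / 3 / norm x"] by simp
  qed (use \<epsilon> that[of 1] in simp)
  obtain a' b' where ab: "intertwines a' b'" "b' \<in> bounded_ops K" "norm (a - a') \<le> \<delta>" "norm (b' - b) \<le> \<delta>"
    using approx[OF \<delta>(1)] by blast
  from intertwinesD[OF ab(1) x \<epsilon>] eventually_gt_at_top[of 0]
  show "\<forall>\<^sub>F N in sequentially. error_le N a b x \<epsilon>"
  proof eventually_elim
    case (elim N)
    define u where "u e = (a - a') (kernel N x e)" for e
    define v where "v e = a' (kernel N x e) - kernel N (b' x) e" for e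
    define w where "w e = kernel N ((b' - b) x) e" for e
    have eq: "a (kernel N x e) - kernel N (b x) e = u e + v e + w e" for e
      by (simp add: u_def v_def w_def blinfun.diff_left kernel_diff)
    show ?case
      unfolding error_le_def eq
    proof (intro allI impI)
      fix E :: "'a set"
      assume E: "orthonormal E"
      have "L2_set (\<lambda>e. norm (u e)) E \<le> norm (a - a') * L2_set (\<lambda>e. norm (kernel N x e)) E"
        unfolding u_def by (rule L2_norm_blinfun_le)
      also have "\<dots> \<le> \<delta> * norm x"
        using \<delta>(1) ab(3) L2_norm_kernel_le[OF elim(2) x E] by (intro mult_mono) auto
      finally have u: "L2_set (\<lambda>e. norm (u e)) E \<le> \<epsilon> / 3"
        using \<delta>(2) by simp
      have v: "L2_set (\<lambda>e. norm (v e)) E \<le> \<epsilon> / 3"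
        using elim(1) E by (simp add: v_def error_le_def)
      have "(b' - b) x \<in> K"
        using bounded_opsD(2)[OF ab(2)] bounded_opsD(2)[OF b] closed_csubspaceD(5)[OF K]
        by (simp add: blinfun.diff_left)
      then have "L2_set (\<lambda>e. norm (w e)) E \<le> norm ((b' - b) x)"
        unfolding w_def by (rule L2_norm_kernel_le[OF elim(2) _ E])
      also have "\<dots> \<le> norm (b' - b) * norm x"
        by (rule norm_blinfun)
      also have "\<dots> \<le> \<delta> * norm x"
        using ab(4) by (rule mult_right_mono) simp
      finally have w: "L2_set (\<lambda>e. norm (w e)) E \<le> \<epsilon> / 3"
        using \<delta>(2) by simp
      show "L2_set (\<lambda>e. norm (u e + v e + w e)) E \<le> \<epsilon>"
        using L2_norm_add_le[of "\<lambda>e. u e + v e" w E] L2_norm_add_le[of u v E] u v w by linarith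
    qed
  qed
qed

lemma norm_le_if_intertwines:
  fixes a :: fock_op and b :: "'a \<Rightarrow>\<^sub>L 'a"
  assumes ab: "intertwines a b" and b: "b \<in> bounded_ops K"
  shows "norm b \<le> norm a"
proof (rule norm_blinfun_bound)
  have *: "norm (b x) \<le> norm a * norm x" if x: "x \<in> K" for x
  proof (rule field_le_epsilon)
    fix \<epsilon> :: real
    assume \<epsilon>: "0 < \<epsilon>"
    from eventually_conj[OF intertwinesD[OF ab x \<epsilon>] eventually_gt_at_top[of 0]]
    obtain N where N: "0 < N" "error_le N a b x \<epsilon>"
      by (auto simp: eventually_sequentially)
    \<comment> \<open>Resolving the single vector \<open>b x\<close> turns its norm into the norm of
      its kernel; the other terms need only upper bounds.\<close>
    have "finite {b x}" "{b x} \<subseteq> K" "orthonormal ({} :: 'a set)"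
      using bounded_opsD(2)[OF b] by (auto simp: orthonormal_def)
    from kernel_resolving[OF N(1) this] obtain E where E: "orthonormal E"
        "(\<Sum>e\<in>E. (norm (kernel N (b x) e))\<^sup>2) = (norm (b x))\<^sup>2"
      by auto
    have "norm (b x) = L2_set (\<lambda>e. norm (kernel N (b x) e)) E"
      by (simp add: L2_set_def E(2))
    also have "\<dots> = L2_set (\<lambda>e. norm (a (kernel N x e) + (kernel N (b x) e - a (kernel N x e)))) E"
      by simp
    also have "\<dots> \<le> L2_set (\<lambda>e. norm (a (kernel N x e))) E
        + L2_set (\<lambda>e. norm (kernel N (b x) e - a (kernel N x e))) E"
      by (rule L2_norm_add_le)
    also have "\<dots> \<le> norm a * L2_set (\<lambda>e. norm (kernel N x e)) E + \<epsilon>"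
      using N(2) E(1) by (intro add_mono L2_norm_blinfun_le) (simp add: error_le_def norm_minus_commute)
    also have "\<dots> \<le> norm a * norm x + \<epsilon>"
      using L2_norm_kernel_le[OF N(1) x E(1)] by (intro add_right_mono mult_left_mono) auto
    finally show "norm (b x) \<le> norm a * norm x + \<epsilon>" .
  qed
  fix x
  have "b x = b (id_op K x)"
    using arg_cong[OF id_op_compose_right[OF K b], of "\<lambda>T. T x"] by simp
  also have "norm \<dots> \<le> norm a * norm (id_op K x)"
    by (rule *) (rule bounded_opsD(2)[OF id_op_mem_bounded_ops[OF K]])
  also have "\<dots> \<le> norm a * norm x"
    by (intro mult_left_mono norm_id_op_le K) simp
  finally show "norm (b x) \<le> norm a * norm x" .
qed simp

section \<open>The closed algebra of intertwining pairs\<close>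

definition intertwining_pairs :: "(fock_op \<times> ('a \<Rightarrow>\<^sub>L 'a)) set" where
  "intertwining_pairs = {(a, b). a \<in> bounded_ops UNIV \<and> b \<in> bounded_ops K \<and>
     intertwines a b \<and> intertwines (adj a) (adj b)}"

lemma closed_intertwining_pairs: "closed intertwining_pairs"
  unfolding closed_sequential_limits
proof (intro allI impI)
  fix u l
  assume *: "(\<forall>m. u m \<in> intertwining_pairs) \<and> u \<longlonglongrightarrow> l"
  define a b a' b' where "a m = fst (u m)" and "b m = snd (u m)" and "a' = fst l" and "b' = snd l" for m
  have lim: "a \<longlonglongrightarrow> a'" "b \<longlonglongrightarrow> b'"
    using * tendsto_fst[of u l] tendsto_snd[of u l]
    by (simp_all add: a_def[abs_def] b_def[abs_def] a'_def b'_def)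
  have mem: "a m \<in> bounded_ops UNIV" "b m \<in> bounded_ops K" "intertwines (a m) (b m)"
    "intertwines (adj (a m)) (adj (b m))" for m
    using * by (auto simp: intertwining_pairs_def a_def b_def split_beta)
  have a': "a' \<in> bounded_ops UNIV"
    by (rule closed_sequentially[OF closed_bounded_ops[OF closed_csubspace_UNIV] mem(1) lim(1)])
  have b': "b' \<in> bounded_ops K"
    by (rule closed_sequentially[OF closed_bounded_ops[OF K] mem(2) lim(2)])
  note UNIV = subsetD[OF bounded_ops_subset_UNIV[of K]]
  have ev: "\<exists>m. norm (a' - a m) \<le> \<delta> \<and> norm (b m - b') \<le> \<delta>" if "0 < \<delta>" for \<delta>
  proof -
    have "\<forall>\<^sub>F m in sequentially. dist (a m) a' < \<delta> \<and> dist (b m) b' < \<delta>"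
      using tendstoD[OF lim(1) that] tendstoD[OF lim(2) that] by (rule eventually_conj)
    then obtain m where "dist (a m) a' < \<delta> \<and> dist (b m) b' < \<delta>"
      by (auto simp: eventually_sequentially)
    then show ?thesis
      by (intro exI[of _ m]) (auto simp: dist_norm norm_minus_commute)
  qed
  have "intertwines a' b'"
    using ev mem by (intro intertwines_limit[OF b']) blast
  moreover have "intertwines (adj a') (adj b')"
  proof (rule intertwines_limit[OF adj_mem_bounded_ops_subspace[OF K b']])
    fix \<delta> :: real
    assume "0 < \<delta>"
    then obtain m where m: "norm (a' - a m) \<le> \<delta>" "norm (b m - b') \<le> \<delta>"
      using ev by blast
    have "norm (adj a' - adj (a m)) = norm (a' - a m)" "norm (adj (b m) - adj b') = norm (b m - b')"
      by (rule norm_adj_diff[OF a' mem(1)], rule norm_adj_diff[OF UNIV[OF mem(2)] UNIV[OF b']])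
    then show "\<exists>a b. intertwines a b \<and> b \<in> bounded_ops K \<and> norm (adj a' - a) \<le> \<delta> \<and> norm (b - adj b') \<le> \<delta>"
      using m mem(4)[of m] adj_mem_bounded_ops_subspace[OF K mem(2)[of m]]
      by (intro exI[of _ "adj (a m)"] exI[of _ "adj (b m)"]) simp
  qed
  ultimately show "l \<in> intertwining_pairs"
    using a' b' by (simp add: intertwining_pairs_def a'_def b'_def split_beta)
qed

lemma standard_star_hom:
  "\<exists>\<phi>. star_hom (cstar_generated k n (standard_tuple k n lam)) (cstar_generated k n V) \<phi> \<and>
    (\<forall>i\<in>{1..k}. \<forall>s\<in>{1..n i}. \<phi> (standard_tuple k n lam i s) = V i s)"
proof -
  define G where "G = {(standard_tuple k n lam i s, V i s) | i s. i \<in> {1..k} \<and> s \<in> {1..n i}}"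
  note UNIV = subsetD[OF bounded_ops_subset_UNIV[of K]]
  note AD = cstar_algebraD[OF cstar_algebra_bounded_ops[OF K]]
  have "\<exists>\<phi>. star_hom (cstar_algebra hull (fst ` G)) (cstar_algebra hull (snd ` G)) \<phi> \<and>
      (\<forall>g\<in>G. \<phi> (fst g) = snd g)"
  proof (rule star_hom_if_relation[of intertwining_pairs])
    show "intertwining_pairs \<subseteq> bounded_ops UNIV \<times> bounded_ops UNIV"
      using UNIV by (auto simp: intertwining_pairs_def)
    show "(0, 0) \<in> intertwining_pairs"
      using intertwines_zero K by (simp add: intertwining_pairs_def)
    show "G \<subseteq> intertwining_pairs"
      using subsetD[OF bounded_ops_subset_UNIV std_shift_mem_bounded_ops[OF lam]] V_mem intertwines_shift
      by (auto simp: G_def intertwining_pairs_def standard_tuple_eq[OF lam])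
    fix a b
    assume "(a, b) \<in> intertwining_pairs"
    then have ab: "a \<in> bounded_ops UNIV" "b \<in> bounded_ops K" "intertwines a b" "intertwines (adj a) (adj b)"
      by (auto simp: intertwining_pairs_def)
    show "norm b \<le> norm a"
      using ab by (intro norm_le_if_intertwines)
    show "(adj a, adj b) \<in> intertwining_pairs"
      using ab adj_mem_bounded_ops_subspace[OF K]
      by (auto simp: intertwining_pairs_def adj_adj[OF UNIV] adj_adj adj_mem_bounded_ops)
    show "(c *\<^sub>C a, c *\<^sub>C b) \<in> intertwining_pairs" for c
      using ab UNIV AD(4) by (auto simp: intertwining_pairs_def adj_scaleC[OF ab(1)]
          adj_scaleC[OF UNIV[OF ab(2)]] bounded_ops_UNIV_closure intertwines_scaleC
          adj_mem_bounded_ops_subspace[OF K])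
    fix a' b'
    assume "(a', b') \<in> intertwining_pairs"
    then have ab': "a' \<in> bounded_ops UNIV" "b' \<in> bounded_ops K" "intertwines a' b'"
      "intertwines (adj a') (adj b')"
      by (auto simp: intertwining_pairs_def)
    show "(a + a', b + b') \<in> intertwining_pairs"
      using ab ab' UNIV AD(3) by (auto simp: intertwining_pairs_def adj_add
          bounded_ops_UNIV_closure intertwines_add)
    show "(a o\<^sub>L a', b o\<^sub>L b') \<in> intertwining_pairs"
      using ab ab' UNIV AD(5) by (auto simp: intertwining_pairs_def adj_compose
          bounded_ops_UNIV_closure intertwines_compose adj_mem_bounded_ops_subspace[OF K])
  qed (rule closed_intertwining_pairs)
  then obtain \<phi> where \<phi>: "star_hom (cstar_algebra hull (fst ` G)) (cstar_algebra hull (snd ` G)) \<phi>"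
      "\<forall>g\<in>G. \<phi> (fst g) = snd g"
    by blast
  have img: "fst ` G = {standard_tuple k n lam i s | i s. i \<in> {1..k} \<and> s \<in> {1..n i}}"
    "snd ` G = {V i s | i s. i \<in> {1..k} \<and> s \<in> {1..n i}}"
    by (force simp: G_def)+
  show ?thesis
  proof (intro exI[of _ \<phi>] conjI ballI)
    show "star_hom (cstar_generated k n (standard_tuple k n lam)) (cstar_generated k n V) \<phi>"
      using \<phi>(1) unfolding cstar_generated_def img .
    show "\<phi> (standard_tuple k n lam i s) = V i s" if "i \<in> {1..k}" "s \<in> {1..n i}" for i s
      using that \<phi>(2)[rule_format, of "(standard_tuple k n lam i s, V i s)"] by (auto simp: G_def)
  qed
qed

section \<open>The algebra generated by a tuple\<close>

lemma generators_mem: "i \<in> {1..k} \<Longrightarrow> s \<in> {1..n i} \<Longrightarrow> V i s \<in> cstar_generated k n V"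
  unfolding cstar_generated_def by (rule hull_inc) blast

lemma cstar_generated_subset: "cstar_generated k n V \<subseteq> bounded_ops K"
  unfolding cstar_generated_def
  using V_mem cstar_algebra_bounded_ops[OF K] by (intro hull_minimal) auto

lemma cstar_algebra_cstar_generated: "cstar_algebra (cstar_generated k n V)"
  unfolding cstar_generated_def using V_mem_UNIV by (intro cstar_algebra_hull) auto

text \<open>The image is itself a C*-algebra, by the closed range theorem, and contains the
  generators; hence it contains their hull.\<close>

lemma star_hom_onto_cstar_generated:
  assumes A: "cstar_algebra A" and \<phi>: "star_hom A (cstar_generated k n V) \<phi>"
    and gen: "\<And>i s. i \<in> {1..k} \<Longrightarrow> s \<in> {1..n i} \<Longrightarrow> V i s \<in> \<phi> ` A"
  shows "\<phi> ` A = cstar_generated k n V"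
proof
  show "\<phi> ` A \<subseteq> cstar_generated k n V"
    using \<phi> by (auto simp: star_hom_def)
  have "cstar_algebra (\<phi> ` A)"
    using cstar_generated_subset bounded_ops_subset_UNIV
    by (intro star_hom_image_cstar_algebra[OF A \<phi>]) blast
  then show "cstar_generated k n V \<subseteq> \<phi> ` A"
    unfolding cstar_generated_def using gen by (intro hull_minimal) auto
qed

section \<open>Wandering vectors\<close>

text \<open>The isometry relation for a single generator already yields the unit of the generated
  algebra.\<close>

lemma id_op_mem_cstar_generated:
  assumes "1 \<in> {1..k}" "1 \<in> {1..n 1}"
  shows "id_op K \<in> cstar_generated k n V"
proof -
  have "adj (V 1 1) o\<^sub>L V 1 1 \<in> cstar_generated k n V"
    by (intro cstar_algebraD[OF cstar_algebra_cstar_generated] generators_mem assms)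
  then show ?thesis
    using assms by (simp add: adj_V_compose_V)
qed

lemma range_proj_mem_cstar_generated:
  assumes j: "j \<in> {1..k}"
  shows "range_proj j \<in> cstar_generated k n V"
  unfolding range_proj_def
  by (intro cstar_algebra_sum cstar_algebraD(5,6)[OF cstar_algebra_cstar_generated] generators_mem j
      cstar_algebra_cstar_generated)

text \<open>At \<open>m = k\<close> this is the projection onto the intersection of the kernels of
  all adjoints. As a polynomial in the generators and their adjoints it is carried along by
  homomorphisms.\<close>

primrec wandering_proj :: "nat \<Rightarrow> 'a \<Rightarrow>\<^sub>L 'a" where
  "wandering_proj 0 = id_op K"
| "wandering_proj (Suc m) = (id_op K - range_proj (Suc m)) o\<^sub>L wandering_proj m"

lemma wandering_proj_mem_cstar_generated:
  assumes one: "1 \<in> {1..k}" "1 \<in> {1..n 1}" and "m \<le> k"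
  shows "wandering_proj m \<in> cstar_generated k n V"
  using assms(3)
proof (induction m)
  case 0
  then show ?case
    using id_op_mem_cstar_generated[OF one] by simp
next
  case (Suc m)
  then show ?case
    unfolding wandering_proj.simps
    by (intro cstar_algebraD(5,8)[OF cstar_algebra_cstar_generated] id_op_mem_cstar_generated one
        range_proj_mem_cstar_generated) auto
qed

lemma wandering_proj_apply:
  assumes e: "e \<in> K" "\<And>i s. i \<in> {1..k} \<Longrightarrow> s \<in> {1..n i} \<Longrightarrow> adj (V i s) e = 0" and "m \<le> k"
  shows "wandering_proj m e = e"
  using assms(3)
proof (induction m)
  case (Suc m)
  then have "range_proj (Suc m) e = 0"
    by (simp add: range_proj_apply e(2) blinfun.zero_right)
  with Suc show ?case
    by (simp add: blinfun.diff_left id_op_apply[OF K e(1)])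
qed (simp add: id_op_apply[OF K e(1)])

end

lemma star_hom_range_proj:
  assumes V: "commuting_rows K k n lam V" and W: "commuting_rows H k n lam W"
    and \<phi>: "star_hom (cstar_generated k n V) B \<phi>"
    and gen: "\<And>i s. i \<in> {1..k} \<Longrightarrow> s \<in> {1..n i} \<Longrightarrow> \<phi> (V i s) = W i s" and j: "j \<in> {1..k}"
  shows "\<phi> (commuting_rows.range_proj n V j) = commuting_rows.range_proj n W j"
proof -
  interpret V: commuting_rows K k n lam V by (rule V)
  interpret W: commuting_rows H k n lam W by (rule W)
  note AD = cstar_algebraD[OF V.cstar_algebra_cstar_generated]
  note hom = star_homD[OF V.cstar_algebra_cstar_generated \<phi>]
  have "\<phi> (V j s o\<^sub>L adj (V j s)) = W j s o\<^sub>L adj (W j s)" "V j s o\<^sub>L adj (V j s) \<in> cstar_generated k n V"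
    if "s \<in> {1..n j}" for s
    using V.generators_mem[OF j that] gen[OF j that] AD(5,6) hom(4,5) by simp_all
  then show ?thesis
    unfolding V.range_proj_def W.range_proj_def
    by (subst star_hom_sum[OF V.cstar_algebra_cstar_generated \<phi>]) auto
qed

lemma star_hom_wandering_proj:
  assumes V: "commuting_rows K k n lam V" and W: "commuting_rows H k n lam W"
    and \<phi>: "star_hom (cstar_generated k n V) B \<phi>"
    and gen: "\<And>i s. i \<in> {1..k} \<Longrightarrow> s \<in> {1..n i} \<Longrightarrow> \<phi> (V i s) = W i s"
    and id: "\<phi> (id_op K) = id_op H" and one: "1 \<in> {1..k}" "1 \<in> {1..n 1}" and "m \<le> k"
  shows "\<phi> (commuting_rows.wandering_proj K n V m) = commuting_rows.wandering_proj H n W m"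
proof -
  interpret V: commuting_rows K k n lam V by (rule V)
  interpret W: commuting_rows H k n lam W by (rule W)
  note AD = cstar_algebraD[OF V.cstar_algebra_cstar_generated]
  note hom = star_homD[OF V.cstar_algebra_cstar_generated \<phi>]
  show ?thesis
    using \<open>m \<le> k\<close>
  proof (induction m)
    case (Suc m)
    then have j: "Suc m \<in> {1..k}"
      by auto
    have "V.wandering_proj m \<in> cstar_generated k n V"
      using Suc.prems by (intro V.wandering_proj_mem_cstar_generated one) auto
    moreover note V.range_proj_mem_cstar_generated[OF j] V.id_op_mem_cstar_generated[OF one]
    moreover have "\<phi> (V.range_proj (Suc m)) = W.range_proj (Suc m)"
      by (rule star_hom_range_proj[OF V W \<phi> _ j]) (rule gen)
    ultimately show ?case
      using Suc by (simp add: AD(8) hom(4,8) id)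
  qed (simp add: id)
qed

section \<open>The vacuum of the standard tuple\<close>

abbreviation (input) standard_algebra where
  "standard_algebra k n lam \<equiv> cstar_generated k n (standard_tuple k n lam)"

definition empty_words :: "nat \<Rightarrow> nat \<Rightarrow> nat list" where
  "empty_words k = (\<lambda>j\<in>{1..k}. [])"

lemma empty_words_mem: "empty_words k \<in> words k n"
  by (auto simp: empty_words_def words_def)

lemma empty_words_eq: "\<alpha> = empty_words k" if "\<alpha> \<in> words k n" "\<forall>j\<in>{1..k}. \<alpha> j = []"
proof
  show "\<alpha> j = empty_words k j" for j
    using that by (cases "j \<in> {1..k}") (auto simp: empty_words_def words_def PiE_iff extensional_def)
qed

context
  fixes k n lam
  assumes lam: "twist_matrices k n lam"
begin

lemma commuting_rows_standard_tuple:
  "commuting_rows (fock_space k n) k n lam (standard_tuple k n lam)"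
  by (rule commuting_rows.intro) (simp_all add: lam standard_tuple_doubly_commuting)

interpretation F: commuting_rows "fock_space k n" k n lam "standard_tuple k n lam"
  by (rule commuting_rows_standard_tuple)

text \<open>The summand for \<open>s\<close> keeps the coordinates whose word in slot
  \<open>j\<close> begins with \<open>s\<close>, the twist meeting its conjugate. Every nonempty
  word has exactly one first letter.\<close>

lemma standard_range_proj_apply:
  assumes j: "j \<in> {1..k}"
  shows "ell2_fun (F.range_proj j f) \<alpha> = (if \<alpha> \<in> words k n \<and> \<alpha> j \<noteq> [] then ell2_fun f \<alpha> else 0)"
proof (cases "\<alpha> \<in> words k n \<and> \<alpha> j \<noteq> []")
  case True
  define w where "w = tl (\<alpha> j)"
  define t where "t = hd (\<alpha> j)"
  have \<alpha>: "\<alpha> \<in> words k n" and \<alpha>j: "\<alpha> j = t # w"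
    using True by (auto simp: w_def t_def)
  then have tw: "t \<in> {1..n j}" "w \<in> lists {1..n j}"
    using words_lists[OF \<alpha> j] by auto
  have up: "\<alpha>(j := w) \<in> words k n"
    by (rule words_upd[OF \<alpha> j tw(2)])
  have "ell2_fun (F.range_proj j f) \<alpha>
      = (\<Sum>s\<in>{1..n j}. if s = t then ell2_fun f \<alpha> else 0)"
    unfolding F.range_proj_apply ell2_fun_sum
  proof (rule sum.cong[OF refl])
    fix s
    assume s: "s \<in> {1..n j}"
    have "twist_coeff lam j s \<alpha> * cnj (twist_coeff lam j s \<alpha>) = 1"
      by (rule twist_coeff_mult_cnj[OF lam \<alpha> j s])
    moreover have "\<alpha>(j := t # w) = \<alpha>"
      using \<alpha>j by auto
    ultimately show "ell2_fun (standard_tuple k n lam j s (adj (standard_tuple k n lam j s) f)) \<alpha>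
        = (if s = t then ell2_fun f \<alpha> else 0)"
      unfolding standard_tuple_eq[OF lam j s] std_shift_apply[OF lam j s]
        adj_std_shift_apply[OF lam j s]
      using \<alpha> up by (auto simp: \<alpha>j simp flip: mult.assoc)
  qed
  then show ?thesis
    using True tw(1) by simp
next
  case False
  have "ell2_fun (F.range_proj j f) \<alpha> = (\<Sum>s\<in>{1..n j}. 0)"
    unfolding F.range_proj_apply ell2_fun_sum
    using False by (intro sum.cong) (auto simp: standard_tuple_eq[OF lam j] std_shift_apply[OF lam j])
  then show ?thesis
    using False by auto
qed

lemma standard_wandering_proj_apply:
  "F.wandering_proj k f = ell2_fun f (empty_words k) *\<^sub>C chi (empty_words k)"
proof -
  have "ell2_fun (F.wandering_proj m f) \<alpha>
      = (if \<alpha> \<in> words k n \<and> (\<forall>j\<in>{1..m}. \<alpha> j = []) then ell2_fun f \<alpha> else 0)" if "m \<le> k" for m \<alpha>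
    using that
  proof (induction m)
    case (Suc m)
    then have j: "Suc m \<in> {1..k}"
      by auto
    define u where "u = F.wandering_proj m f"
    have IH: "ell2_fun u \<alpha> = (if \<alpha> \<in> words k n \<and> (\<forall>j\<in>{1..m}. \<alpha> j = []) then ell2_fun f \<alpha> else 0)"
      using Suc by (simp add: u_def)
    have "ell2_fun (F.wandering_proj (Suc m) f) \<alpha>
        = (if \<alpha> \<in> words k n \<and> \<alpha> (Suc m) = [] then ell2_fun u \<alpha> else 0)"
      by (simp add: blinfun.diff_left ell2_fun_diff id_op_fock_space standard_range_proj_apply[OF j]
          flip: u_def)
    also have "\<dots> = (if \<alpha> \<in> words k n \<and> (\<forall>j\<in>insert (Suc m) {1..m}. \<alpha> j = []) then ell2_fun f \<alpha> else 0)"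
      unfolding IH by simp
    also have "insert (Suc m) {1..m} = {1..Suc m}"
      by auto
    finally show ?case .
  qed (simp add: id_op_fock_space)
  note app = this[OF order_refl]
  have "\<alpha> \<in> words k n \<and> (\<forall>j\<in>{1..k}. \<alpha> j = []) \<longleftrightarrow> \<alpha> = empty_words k" for \<alpha>
    using empty_words_mem[of k n] empty_words_eq[of \<alpha> k n] by (auto simp: empty_words_def)
  then show ?thesis
    by (intro ell2_eqI) (simp add: app scaleC_ell2.rep_eq chi.rep_eq)
qed

text \<open>Induction on the total length of the words. A shift restores a removed first letter up
  to a unimodular factor \<open>c\<close>, which \<open>cnj c\<close> undoes.\<close>

lemma chi_cyclic:
  assumes one: "1 \<in> {1..k}" "1 \<in> {1..n 1}" and \<alpha>: "\<alpha> \<in> words k n"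
  shows "\<exists>T \<in> standard_algebra k n lam. T (chi (empty_words k)) = chi \<alpha>"
  using \<alpha>
proof (induction "\<Sum>j\<in>{1..k}. length (\<alpha> j)" arbitrary: \<alpha> rule: less_induct)
  case less
  note AD = cstar_algebraD[OF F.cstar_algebra_cstar_generated]
  show ?case
  proof (cases "\<forall>j\<in>{1..k}. \<alpha> j = []")
    case True
    then have "\<alpha> = empty_words k"
      using empty_words_eq less.prems by blast
    moreover have "id_op (fock_space k n) (chi (empty_words k)) = chi (empty_words k)"
      by (simp add: id_op_apply chi_mem_fock_space empty_words_mem)
    ultimately show ?thesis
      using F.id_op_mem_cstar_generated[OF one] by blast
  next
    case False
    then obtain i where i: "i \<in> {1..k}" "\<alpha> i \<noteq> []"
      by blast
    then obtain s w where \<alpha>i: "\<alpha> i = s # w"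
      by (cases "\<alpha> i") auto
    then have sw: "s \<in> {1..n i}" "w \<in> lists {1..n i}"
      using words_lists[OF less.prems i(1)] by auto
    define \<beta> where "\<beta> = \<alpha>(i := w)"
    have \<beta>: "\<beta> \<in> words k n"
      unfolding \<beta>_def by (rule words_upd[OF less.prems i(1) sw(2)])
    have "(\<Sum>j\<in>{1..k}. length (\<beta> j)) < (\<Sum>j\<in>{1..k}. length (\<alpha> j))"
      by (rule sum_strict_mono_ex1) (use i \<alpha>i in \<open>auto simp: \<beta>_def\<close>)
    from less.hyps[OF this \<beta>] obtain T where T: "T \<in> standard_algebra k n lam"
        "T (chi (empty_words k)) = chi \<beta>"
      by blast
    define c where "c = twist_coeff lam i s \<beta>"
    have c: "cnj c * c = 1"
      using twist_coeff_mult_cnj[OF lam \<beta> i(1) sw(1)] by (simp add: c_def mult.commute)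
    have "standard_tuple k n lam i s (chi \<beta>) = c *\<^sub>C chi \<alpha>"
    proof (rule ell2_eqI)
      fix \<gamma>
      have "\<gamma> \<in> words k n \<and> \<gamma> i \<noteq> [] \<and> hd (\<gamma> i) = s \<and> \<gamma>(i := tl (\<gamma> i)) = \<beta> \<longleftrightarrow> \<gamma> = \<alpha>"
      proof
        assume *: "\<gamma> \<in> words k n \<and> \<gamma> i \<noteq> [] \<and> hd (\<gamma> i) = s \<and> \<gamma>(i := tl (\<gamma> i)) = \<beta>"
        then have "\<gamma> = \<beta>(i := s # \<beta> i)"
          by auto
        then show "\<gamma> = \<alpha>"
          using \<alpha>i by (auto simp: \<beta>_def)
      qed (use less.prems \<alpha>i in \<open>auto simp: \<beta>_def\<close>)
      moreover have "twist_coeff lam i s \<alpha> = c"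
        by (simp add: c_def \<beta>_def)
      ultimately show "ell2_fun (standard_tuple k n lam i s (chi \<beta>)) \<gamma> = ell2_fun (c *\<^sub>C chi \<alpha>) \<gamma>"
        unfolding standard_tuple_eq[OF lam i(1) sw(1)] std_shift_apply[OF lam i(1) sw(1)]
          scaleC_ell2.rep_eq chi.rep_eq by auto
    qed
    then have "(cnj c *\<^sub>C (standard_tuple k n lam i s o\<^sub>L T)) (chi (empty_words k)) = chi \<alpha>"
      by (simp add: T(2) scaleC_scaleC c)
    moreover have "cnj c *\<^sub>C (standard_tuple k n lam i s o\<^sub>L T) \<in> standard_algebra k n lam"
      by (intro AD(4,5) T(1) F.generators_mem i(1) sw(1))
    ultimately show ?thesis
      by blast
  qed
qed

text \<open>A nonzero element of the kernel of \<open>\<phi>\<close> has a nonzero matrix coefficient. Moving it to the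
  vacuum vector by the algebra shows that the vacuum projection lies in the kernel, contradicting
  that its image fixes the wandering vector \<open>e\<close>.\<close>

lemma star_hom_injective:
  assumes one: "1 \<in> {1..k}" "1 \<in> {1..n 1}" and W: "commuting_rows H k n lam W"
    and \<phi>: "star_hom (standard_algebra k n lam) B \<phi>"
    and gen: "\<And>i s. i \<in> {1..k} \<Longrightarrow> s \<in> {1..n i} \<Longrightarrow> \<phi> (standard_tuple k n lam i s) = W i s"
    and id: "\<phi> (id_op (fock_space k n)) = id_op H"
    and e: "e \<in> H" "e \<noteq> 0" "\<And>i s. i \<in> {1..k} \<Longrightarrow> s \<in> {1..n i} \<Longrightarrow> adj (W i s) e = 0"
    and a: "a \<in> standard_algebra k n lam" "\<phi> a = 0"
  shows "a = 0"
proof -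
  interpret W: commuting_rows H k n lam W by (rule W)
  let ?A = "standard_algebra k n lam"
  note A = F.cstar_algebra_cstar_generated
  note AD = cstar_algebraD[OF A] and hom = star_homD[OF A \<phi>]
  define v where "v = chi (empty_words k)"
  define Q where "Q = F.wandering_proj k"
  have Q: "Q f = cinner f v *\<^sub>C v" for f
    by (simp add: Q_def v_def standard_wandering_proj_apply cinner_chi_right)
  have QA: "Q \<in> ?A"
    unfolding Q_def by (rule F.wandering_proj_mem_cstar_generated[OF one order_refl])
  have \<phi>Q: "\<phi> Q = W.wandering_proj k"
    unfolding Q_def
    by (rule star_hom_wandering_proj[OF commuting_rows_standard_tuple W \<phi> gen id one order_refl])
  have coeff: "cinner (a (chi \<alpha>)) (chi \<beta>) = 0" if "\<alpha> \<in> words k n" "\<beta> \<in> words k n" for \<alpha> \<beta>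
  proof -
    obtain T where T: "T \<in> ?A" "T v = chi \<alpha>"
      using chi_cyclic[OF one \<open>\<alpha> \<in> _\<close>] unfolding v_def by blast
    obtain R where R: "R \<in> ?A" "R v = chi \<beta>"
      using chi_cyclic[OF one \<open>\<beta> \<in> _\<close>] unfolding v_def by blast
    \<comment> \<open>\<open>b\<close> stays in the kernel of the homomorphism, and its coefficient
      at the vacuum is the coefficient of \<open>a\<close> at \<open>\<alpha>\<close> and
      \<open>\<beta>\<close>.\<close>
    define b where "b = adj R o\<^sub>L (a o\<^sub>L T)"
    have bA: "b \<in> ?A"
      using T(1) R(1) a(1) AD by (simp add: b_def)
    have "\<phi> b = adj (\<phi> R) o\<^sub>L (0 o\<^sub>L \<phi> T)"
      using T(1) R(1) a AD by (simp add: b_def hom)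
    then have \<phi>b: "\<phi> b = 0"
      by simp
    define c where "c = cinner (a (chi \<alpha>)) (chi \<beta>)"
    have c: "cinner (b v) v = c"
      using R AD(1) by (simp add: c_def b_def cinner_adj_left subsetD T(2))
    have lin: "b (x *\<^sub>C f) = x *\<^sub>C b f" for x f
      using bA AD(1) by (auto intro: bounded_opsD(1))
    \<comment> \<open>Compression by the rank one projection \<open>Q\<close> leaves only the vacuum
      coefficient \<open>c\<close>. The left side is sent to 0, while the image of \<open>Q\<close>
      fixes the nonzero vector \<open>e\<close>; so \<open>c = 0\<close>.\<close>
    have "Q o\<^sub>L (b o\<^sub>L Q) = c *\<^sub>C Q"
      by (rule blinfun_eqI) (simp add: Q lin cinner_scaleC_left c scaleC_scaleC mult.commute)
    then have "c *\<^sub>C \<phi> Q = \<phi> Q o\<^sub>L (\<phi> b o\<^sub>L \<phi> Q)"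
      using QA bA AD(5) hom(3,4) by metis
    then have "(c *\<^sub>C \<phi> Q) e = 0"
      by (simp add: \<phi>b blinfun.zero_right)
    moreover have "\<phi> Q e = e"
      unfolding \<phi>Q by (rule W.wandering_proj_apply[OF e(1) e(3) order_refl])
    ultimately have "norm (c *\<^sub>C e) = 0"
      by simp
    then show ?thesis
      using e(2) by (simp add: norm_scaleC c_def)
  qed
  have a_mem: "a \<in> bounded_ops (fock_space k n)"
    using a(1) F.cstar_generated_subset by blast
  show "a = 0"
  proof (rule ell2_op_eqI)
    fix \<alpha>
    have "ell2_fun (a (chi \<alpha>)) \<beta> = 0" for \<beta>
    proof (cases "\<alpha> \<in> words k n")
      case True
      have "a (chi \<alpha>) \<in> fock_space k n"
        by (rule bounded_opsD(2)[OF a_mem])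
      then show ?thesis
        using coeff[OF True, of \<beta>] by (cases "\<beta> \<in> words k n") (auto simp: fock_space_def cinner_chi_right)
    next
      case False
      then have "a (chi \<alpha>) = 0"
        by (intro bounded_opsD(3)[OF a_mem]) (auto simp: cinner_chi_left fock_space_def)
      then show ?thesis
        by (simp add: zero_ell2.rep_eq)
    qed
    then show "a (chi \<alpha>) = blinfun_apply 0 (chi \<alpha>)"
      by (intro ell2_eqI) (simp add: zero_ell2.rep_eq)
  qed (use a_mem bounded_ops_subset_UNIV in auto)
qed

end

section \<open>From the standard algebra to arbitrary tuples\<close>

lemma cstar_isomorphic_if_bij:
  assumes A: "cstar_algebra A" and \<phi>: "star_hom A B \<phi>" and bij: "bij_betw \<phi> A B"
  shows "cstar_isomorphic B A"
proof -
  note AD = cstar_algebraD[OF A] and hom = star_homD[OF A \<phi>]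
  define \<psi> where "\<psi> = inv_into A \<phi>"
  have \<psi>: "\<psi> b \<in> A" "\<phi> (\<psi> b) = b" if "b \<in> B" for b
    using bij that by (auto simp: \<psi>_def bij_betw_def inv_into_into f_inv_into_f)
  have \<psi>_eq: "\<psi> (\<phi> a) = a" if "a \<in> A" for a
    using bij that by (simp add: \<psi>_def bij_betw_def)
  have "star_hom B A \<psi>"
    unfolding star_hom_def
  proof (intro conjI ballI allI)
    fix a
    assume a: "a \<in> B"
    show "\<psi> a \<in> A"
      by (rule \<psi>(1)[OF a])
    show "\<psi> (c *\<^sub>C a) = c *\<^sub>C \<psi> a" for c
      using \<psi>_eq[of "c *\<^sub>C \<psi> a"] \<psi>[OF a] AD(4) hom(3) by simp
    show "\<psi> (adj a) = adj (\<psi> a)"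
      using \<psi>_eq[of "adj (\<psi> a)"] \<psi>[OF a] AD(6) hom(5) by simp
    fix b
    assume b: "b \<in> B"
    show "\<psi> (a + b) = \<psi> a + \<psi> b"
      using \<psi>_eq[of "\<psi> a + \<psi> b"] \<psi>[OF a] \<psi>[OF b] AD(3) hom(2) by simp
    show "\<psi> (a o\<^sub>L b) = \<psi> a o\<^sub>L \<psi> b"
      using \<psi>_eq[of "\<psi> a o\<^sub>L \<psi> b"] \<psi>[OF a] \<psi>[OF b] AD(5) hom(4) by simp
  qed
  moreover have "bij_betw \<psi> B A"
    unfolding \<psi>_def using bij by (rule bij_betw_inv_into)
  ultimately show ?thesis
    unfolding cstar_isomorphic_def by blast
qed

text \<open>Unitality is automatic: both identities are of the form adjoint times isometry for
  corresponding generators.\<close>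

lemma star_hom_id_op:
  assumes V: "commuting_rows K k n lam V" and W: "commuting_rows H k n lam W"
    and \<phi>: "star_hom (cstar_generated k n V) B \<phi>"
    and gen: "\<And>i s. i \<in> {1..k} \<Longrightarrow> s \<in> {1..n i} \<Longrightarrow> \<phi> (V i s) = W i s"
    and one: "1 \<in> {1..k}" "1 \<in> {1..n 1}"
  shows "\<phi> (id_op K) = id_op H"
proof -
  interpret V: commuting_rows K k n lam V by (rule V)
  interpret W: commuting_rows H k n lam W by (rule W)
  have "\<phi> (adj (V 1 1) o\<^sub>L V 1 1) = adj (W 1 1) o\<^sub>L W 1 1"
    using V.generators_mem[OF one] gen[OF one]
      cstar_algebraD(6)[OF V.cstar_algebra_cstar_generated]
      star_homD(4,5)[OF V.cstar_algebra_cstar_generated \<phi>] by simp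
  then show ?thesis
    using one by (simp add: V.adj_V_compose_V W.adj_V_compose_V)
qed

text \<open>The relations are polynomial identities in the generators, their adjoints and the unit.
  Unitality of the representation makes the images isometries on \<open>H\<close>.\<close>

lemma star_representation_doubly_commuting:
  assumes V: "commuting_rows K k n lam V"
    and \<pi>: "star_representation K (cstar_generated k n V) H \<pi>"
  shows "doubly_commuting_row_isometries H k n lam (\<lambda>i s. \<pi> (V i s))"
proof -
  interpret V: commuting_rows K k n lam V by (rule V)
  have hom: "star_hom (cstar_generated k n V) (bounded_ops H) \<pi>" and id: "\<pi> (id_op K) = id_op H"
    using \<pi> by (auto simp: star_representation_def)
  note AD = cstar_algebraD[OF V.cstar_algebra_cstar_generated]
  note h = star_homD[OF V.cstar_algebra_cstar_generated hom]
  have "adj (\<pi> (V i s)) o\<^sub>L \<pi> (V i t) = (if s = t then id_op H else 0)"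
    if i: "i \<in> {1..k}" and s: "s \<in> {1..n i}" and t: "t \<in> {1..n i}" for i s t
  proof -
    have "\<pi> (adj (V i s) o\<^sub>L V i t) = adj (\<pi> (V i s)) o\<^sub>L \<pi> (V i t)"
      using V.generators_mem[OF i s] V.generators_mem[OF i t] AD(6) h(4,5) by simp
    then show ?thesis
      using id h(6) by (auto simp: V.adj_V_compose_V[OF i s t] split: if_splits)
  qed
  moreover have "adj (\<pi> (V i s)) o\<^sub>L \<pi> (V j t) = cnj (lam i j s t) *\<^sub>C (\<pi> (V j t) o\<^sub>L adj (\<pi> (V i s)))"
    if i: "i \<in> {1..k}" and j: "j \<in> {1..k}" and ij: "i \<noteq> j" and s: "s \<in> {1..n i}" and t: "t \<in> {1..n j}"
    for i j s t
  proof -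
    have "adj (V i s) o\<^sub>L V j t = cnj (lam i j s t) *\<^sub>C (V j t o\<^sub>L adj (V i s))"
      by (rule blinfun_eqI) (simp add: V.adj_V_V_swap[OF i j ij s t])
    then have "\<pi> (adj (V i s) o\<^sub>L V j t) = \<pi> (cnj (lam i j s t) *\<^sub>C (V j t o\<^sub>L adj (V i s)))"
      by simp
    then show ?thesis
      using V.generators_mem[OF i s] V.generators_mem[OF j t] AD(5,6) h(3,4,5) by simp
  qed
  ultimately show ?thesis
    unfolding doubly_commuting_row_isometries_def row_isometry_def
    using h(1) V.generators_mem by simp
qed

lemma standard_star_hom_onto:
  assumes W: "commuting_rows H k n lam W"
  shows "\<exists>\<phi>. star_hom (standard_algebra k n lam) (cstar_generated k n W) \<phi> \<and>
    \<phi> ` standard_algebra k n lam = cstar_generated k n W \<and>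
    (\<forall>i\<in>{1..k}. \<forall>s\<in>{1..n i}. \<phi> (standard_tuple k n lam i s) = W i s)"
proof -
  interpret W: commuting_rows H k n lam W by (rule W)
  interpret F: commuting_rows "fock_space k n" k n lam "standard_tuple k n lam"
    by (rule commuting_rows_standard_tuple[OF W.lam])
  obtain \<phi> where \<phi>: "star_hom (standard_algebra k n lam) (cstar_generated k n W) \<phi>"
      "\<forall>i\<in>{1..k}. \<forall>s\<in>{1..n i}. \<phi> (standard_tuple k n lam i s) = W i s"
    using W.standard_star_hom by blast
  have "\<phi> ` standard_algebra k n lam = cstar_generated k n W"
  proof (rule W.star_hom_onto_cstar_generated[OF F.cstar_algebra_cstar_generated \<phi>(1)])
    show "W i s \<in> \<phi> ` standard_algebra k n lam"
      if "i \<in> {1..k}" "s \<in> {1..n i}" for i s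
      using F.generators_mem[OF that] that \<phi>(2) by (metis imageI)
  qed
  with \<phi> show ?thesis
    by blast
qed

text \<open>The spaces \<open>H\<close> live in types \<open>'b\<close> and \<open>'c\<close>
  independent of \<open>'a\<close>; as these are free type variables, every Hilbert space type is
  covered. In (iii) the kernels are cut down to \<open>K\<close>, because an operator on
  \<open>K\<close> is stored as its extension by 0 and its adjoint kills the orthogonal
  complement.\<close>

theorem theorem4p14:
  fixes k :: nat and n :: "nat \<Rightarrow> nat"
    and lam :: "nat \<Rightarrow> nat \<Rightarrow> nat \<Rightarrow> nat \<Rightarrow> complex"
    and K :: "'a::complex_hilbert set"
    and V :: "nat \<Rightarrow> nat \<Rightarrow> 'a \<Rightarrow>\<^sub>L 'a"
  assumes "k \<ge> 1" and "\<forall>i\<in>{1..k}. n i \<ge> 1" and "twist_matrices k n lam"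
    and "closed_csubspace K" and "doubly_commuting_row_isometries K k n lam V"
  defines "S \<equiv> standard_tuple k n lam"
  shows
    "((\<exists>\<pi>. star_representation (fock_space k n) (cstar_generated k n S) K \<pi> \<and>
         (\<forall>i\<in>{1..k}. \<forall>s\<in>{1..n i}. \<pi> (S i s) = V i s)) \<and>
      (\<forall>(H :: 'b::complex_hilbert set) \<pi>.
         closed_csubspace H \<and>
         star_representation (fock_space k n) (cstar_generated k n S) H \<pi> \<longrightarrow>
           doubly_commuting_row_isometries H k n lam (\<lambda>i s. \<pi> (S i s)) \<and>
           (\<forall>\<pi>'. star_representation (fock_space k n) (cstar_generated k n S) H \<pi>' \<and>
              (\<forall>i\<in>{1..k}. \<forall>s\<in>{1..n i}. \<pi>' (S i s) = \<pi> (S i s)) \<longrightarrow>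
              (\<forall>a\<in>cstar_generated k n S. \<pi>' a = \<pi> a)))) \<and>
     (doubly_commuting_row_isometries (fock_space k n) k n lam S \<and>
      (\<forall>(H :: 'c::complex_hilbert set) W.
         closed_csubspace H \<and> doubly_commuting_row_isometries H k n lam W \<longrightarrow>
           (\<exists>\<phi>. star_hom (cstar_generated k n S) (cstar_generated k n W) \<phi> \<and>
              \<phi> ` cstar_generated k n S = cstar_generated k n W \<and>
              (\<forall>i\<in>{1..k}. \<forall>s\<in>{1..n i}. \<phi> (S i s) = W i s)))) \<and>
     ((\<Inter>i\<in>{1..k}. \<Inter>s\<in>{1..n i}. {x\<in>K. adj (V i s) x = 0}) \<noteq> {0} \<longrightarrow>
        cstar_isomorphic (cstar_generated k n V) (cstar_generated k n S))"
proof -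
  have one: "1 \<in> {1..k}" "1 \<in> {1..n 1}"
    using assms(1,2) by auto
  have F: "commuting_rows (fock_space k n) k n lam S"
    unfolding S_def by (rule commuting_rows_standard_tuple[OF assms(3)])
  have V: "commuting_rows K k n lam V"
    using assms(3-5) by (simp add: commuting_rows_def)
  interpret F: commuting_rows "fock_space k n" k n lam S by (rule F)
  interpret V: commuting_rows K k n lam V by (rule V)
  obtain \<phi> where \<phi>: "star_hom (cstar_generated k n S) (cstar_generated k n V) \<phi>"
      "\<forall>i\<in>{1..k}. \<forall>s\<in>{1..n i}. \<phi> (S i s) = V i s"
      "\<phi> ` cstar_generated k n S = cstar_generated k n V"
    using standard_star_hom_onto[OF V] unfolding S_def by blast
  have \<phi>_id: "\<phi> (id_op (fock_space k n)) = id_op K"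
    by (rule star_hom_id_op[OF F V \<phi>(1) _ one]) (use \<phi>(2) in blast)
  have "star_representation (fock_space k n) (cstar_generated k n S) K \<phi>"
    unfolding star_representation_def
    using \<phi>(1) V.cstar_generated_subset \<phi>_id by (auto simp: star_hom_def)
  then have i1: "\<exists>\<pi>. star_representation (fock_space k n) (cstar_generated k n S) K \<pi> \<and>
      (\<forall>i\<in>{1..k}. \<forall>s\<in>{1..n i}. \<pi> (S i s) = V i s)"
    using \<phi>(2) by blast
  have i2: "\<forall>(H :: 'b set) \<pi>. closed_csubspace H \<and>
      star_representation (fock_space k n) (cstar_generated k n S) H \<pi> \<longrightarrow>
      doubly_commuting_row_isometries H k n lam (\<lambda>i s. \<pi> (S i s)) \<and>
      (\<forall>\<pi>'. star_representation (fock_space k n) (cstar_generated k n S) H \<pi>' \<and>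
        (\<forall>i\<in>{1..k}. \<forall>s\<in>{1..n i}. \<pi>' (S i s) = \<pi> (S i s)) \<longrightarrow>
        (\<forall>a\<in>cstar_generated k n S. \<pi>' a = \<pi> a))"
  proof (intro allI impI conjI ballI; elim conjE)
    fix H :: "'b set" and \<pi>
    assume \<pi>: "star_representation (fock_space k n) (cstar_generated k n S) H \<pi>"
    show "doubly_commuting_row_isometries H k n lam (\<lambda>i s. \<pi> (S i s))"
      by (rule star_representation_doubly_commuting[OF F \<pi>])
    fix \<pi>' a
    assume \<pi>': "star_representation (fock_space k n) (cstar_generated k n S) H \<pi>'"
        "\<forall>i\<in>{1..k}. \<forall>s\<in>{1..n i}. \<pi>' (S i s) = \<pi> (S i s)"
      and a: "a \<in> cstar_generated k n S"
    show "\<pi>' a = \<pi> a"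
    proof (rule star_hom_eq_on_hull[where \<phi> = \<pi>' and \<psi> = \<pi>])
      show "{S i s |i s. i \<in> {1..k} \<and> s \<in> {1..n i}} \<subseteq> bounded_ops UNIV"
        using F.V_mem_UNIV by auto
      show "star_hom (cstar_algebra hull {S i s |i s. i \<in> {1..k} \<and> s \<in> {1..n i}}) (bounded_ops H) \<pi>'"
        "star_hom (cstar_algebra hull {S i s |i s. i \<in> {1..k} \<and> s \<in> {1..n i}}) (bounded_ops H) \<pi>"
        using \<pi> \<pi>' by (simp_all add: cstar_generated_def star_representation_def)
      show "a \<in> cstar_algebra hull {S i s |i s. i \<in> {1..k} \<and> s \<in> {1..n i}}"
        using a by (simp add: cstar_generated_def)
      show "\<pi>' g = \<pi> g" if "g \<in> {S i s |i s. i \<in> {1..k} \<and> s \<in> {1..n i}}" for g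
        using that \<pi>' by blast
    qed (rule bounded_ops_subset_UNIV)
  qed
  have ii: "\<forall>(H :: 'c set) W. closed_csubspace H \<and> doubly_commuting_row_isometries H k n lam W \<longrightarrow>
      (\<exists>\<phi>. star_hom (cstar_generated k n S) (cstar_generated k n W) \<phi> \<and>
        \<phi> ` cstar_generated k n S = cstar_generated k n W \<and>
        (\<forall>i\<in>{1..k}. \<forall>s\<in>{1..n i}. \<phi> (S i s) = W i s))"
    unfolding S_def using assms(3)
    by (auto intro!: standard_star_hom_onto simp only: commuting_rows_def)
  have iii: "cstar_isomorphic (cstar_generated k n V) (cstar_generated k n S)"
    if "(\<Inter>i\<in>{1..k}. \<Inter>s\<in>{1..n i}. {x\<in>K. adj (V i s) x = 0}) \<noteq> {0}"
  proof -
    define X where "X = (\<Inter>i\<in>{1..k}. \<Inter>s\<in>{1..n i}. {x\<in>K. adj (V i s) x = 0})"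
    \<comment> \<open>As 0 belongs to \<open>X\<close>, being different from \<open>{0}\<close>
      yields a nonzero vector and not merely an empty set.\<close>
    have "0 \<in> X" "X \<noteq> {0}"
      using closed_csubspaceD(1)[OF assms(4)] that by (auto simp: X_def blinfun.zero_right)
    then obtain e where e: "e \<in> X" "e \<noteq> 0"
      by blast
    have X: "x \<in> K \<and> adj (V i s) x = 0" if "x \<in> X" "i \<in> {1..k}" "s \<in> {1..n i}" for x i s
      using that unfolding X_def by blast
    \<comment> \<open>Membership in \<open>K\<close> is read off at the index pair (1, 1), which
      exists because \<open>k\<close> and \<open>n 1\<close> are at least 1.\<close>
    have eK: "e \<in> K" "\<And>i s. i \<in> {1..k} \<Longrightarrow> s \<in> {1..n i} \<Longrightarrow> adj (V i s) e = 0"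
      using X[OF e(1) one] X[OF e(1)] by blast+
    note A = F.cstar_algebra_cstar_generated
    have "inj_on \<phi> (cstar_generated k n S)"
    proof (rule inj_onI)
      fix a b
      assume a: "a \<in> cstar_generated k n S" and b: "b \<in> cstar_generated k n S" and eq: "\<phi> a = \<phi> b"
      have "a - b = 0"
      proof (rule star_hom_injective[OF assms(3) one V \<phi>(1)[unfolded S_def] _ \<phi>_id eK(1) e(2) eK(2)])
        show "a - b \<in> standard_algebra k n lam"
          using cstar_algebraD(8)[OF A a b] by (simp add: S_def)
        show "\<phi> (a - b) = 0"
          using star_homD(8)[OF A \<phi>(1) a b] eq by simp
      qed (use \<phi>(2) in \<open>auto simp: S_def\<close>)
      then show "a = b"
        by simp
    qed
    then have "bij_betw \<phi> (cstar_generated k n S) (cstar_generated k n V)"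
      using \<phi>(3) by (simp add: bij_betw_def)
    then show ?thesis
      by (rule cstar_isomorphic_if_bij[OF A \<phi>(1)])
  qed
  show ?thesis
    by (intro conjI[OF conjI[OF i1 i2] conjI[OF conjI[OF F.V ii]]] impI iii)
qed

end
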